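(* Let $\xi(t)=\beta^{2}\sum_{p\geq2}\beta_{p}^{2}t^{p}$ satisfy $\xi(1+\epsilon)<\infty$ for some $\epsilon>0$, let $h\ge 0$, and let $\eta$ be optimal for the dual problem $\max_{\eta\in\Lambda_{\xi,h}}D_{\xi,h}(\eta)$. Then: (Optimality) $$\left(\frac{1}{\sqrt{\eta''}}\right)''=-\mu$$ in the sense of distributions on $(0,1)$, where $\mu$ is the minimizer of $P_{\xi,h}$ over $\Pr([0,1])$. Moreover, the support of $\mu$ is contained in the coincidence set $\{s\in[0,1):\eta(s)=\xi(s)\}$. (Regularity) (1) $\eta\in C^{2}([0,1))$ and $\eta'''\in BV((0,1-\delta))\cap L^{\infty}((0,1-\delta))$ for all $\delta\in(0,1)$. (2) $\frac{1}{(1-s)^{2}}\leq\eta''(s)\leq\frac{C}{(1-s)^{2}}$ for all $s\in[0,1)$, for some positive constant $C=C(\xi,h)$. (3) $\eta''(s)=\frac{1}{(1-s)^{2}}$ for all $s<1$ sufficiently close to $1$. (Consistency) If $s\in[0,1)$ and $\eta(s)=\xi(s)$, then $$\eta'(s)=\xi'(s)\quad\text{and}\quad\eta''(s)\geq\xi''(s).$$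
   Context: Here $\beta$ and $\beta_p$ ($p\ge2$) are real numbers. $\Pr([0,1])$ is the set of Borel probability measures on $[0,1]$. For $\mu\in\Pr([0,1])$, let $\phi_{\mu}(t)=\int_{t}^{1}\mu([0,s])\,ds$ for $t\in[0,1]$; note $0\le\phi_\mu(s)\le 1-s$. The Crisanti-Sommers functional is $$P_{\xi,h}(\mu)=\frac{1}{2}\left(\int_{0}^{1}\xi''\phi_{\mu}\,ds+\int_{0}^{1}\left(\frac{1}{\phi_{\mu}}-\frac{1}{1-s}\right)ds+h^{2}\phi_{\mu}(0)\right)\in(-\infty,+\infty],$$ where the second integrand is non-negative (with $1/0=+\infty$). This functional is strictly convex, and its minimizer over $\Pr([0,1])$ is unique. Let $X=\{\eta:\eta\in C^{1}([0,1)),\ \eta'\in Lip_{\mathrm{loc}}([0,1))\}$, where $\eta$ is real-valued and may blow up at $1$ and $Lip_{\mathrm{loc}}$ denotes locally Lipschitz functions. For $\eta\in X$, the second distributional derivative $\eta''$ is identified with an a.e. unique measurable function, essentially bounded on each $[0,1-\delta]$, $\delta>0$. Let $$\Lambda_{\xi,h}=\left\{ \eta\in X:\ \eta\geq\xi \text{ on } [0,1),\ \eta'(0)=-h^{2},\ \eta''\geq0\ \text{Lebesgue-a.e.}\right\}$$ and define $D_{\xi,h}:\Lambda_{\xi,h}\to[-\infty,\infty)$ by $$D_{\xi,h}(\eta)=\frac{1}{2}\left(\int_{0}^{1}\left(2\sqrt{\eta''(s)}-\eta''(s)(1-s)-\frac{1}{1-s}\right)ds-\eta(0)+h^{2}+\xi(1)\right),$$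 where the integrand is non-positive by the arithmetic-geometric mean inequality. "Optimal" means that $\eta\in\Lambda_{\xi,h}$ attains the maximum of $D_{\xi,h}$ over $\Lambda_{\xi,h}$. Derivatives at $s=0$ are one-sided. *)

theory Defs
  imports "HOL-Probability.Probability"
begin

section \<open>Test functions and distributional derivatives on open subsets of the line\<close>

definition test_function :: "real set \<Rightarrow> (real \<Rightarrow> real) \<Rightarrow> bool" where
  "test_function U f \<longleftrightarrow>
     (\<forall>n x. (deriv ^^ n) f field_differentiable (at x)) \<and>
     compact (closure {x. f x \<noteq> 0}) \<and> closure {x. f x \<noteq> 0} \<subseteq> U"

definition loc_integrable :: "real set \<Rightarrow> (real \<Rightarrow> real) \<Rightarrow> bool" where
  "loc_integrable U f \<longleftrightarrow> (\<forall>K. compact K \<and> K \<subseteq> U \<longrightarrow> set_integrable lborel K f)"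

text \<open>The distributional derivative of \<open>f\<close> of order \<open>k\<close> on \<open>U\<close> is the function \<open>g\<close>.\<close>

definition distr_deriv :: "nat \<Rightarrow> real set \<Rightarrow> (real \<Rightarrow> real) \<Rightarrow> (real \<Rightarrow> real) \<Rightarrow> bool" where
  "distr_deriv k U f g \<longleftrightarrow> loc_integrable U f \<and> loc_integrable U g \<and>
     (\<forall>\<phi>. test_function U \<phi> \<longrightarrow>
        (LBINT x:U. f x * (deriv ^^ k) \<phi> x) = (-1) ^ k * (LBINT x:U. g x * \<phi> x))"

text \<open>\<open>f'' = - \<mu>\<close> as distributions on \<open>U\<close>. Test functions vanish off \<open>U\<close>, so
  only the part of \<open>\<mu>\<close> inside \<open>U\<close> matters.\<close>

definition distr_deriv2_eq_neg_measure ::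
  "real set \<Rightarrow> (real \<Rightarrow> real) \<Rightarrow> real measure \<Rightarrow> bool" where
  "distr_deriv2_eq_neg_measure U f \<mu> \<longleftrightarrow> loc_integrable U f \<and>
     (\<forall>\<phi>. test_function U \<phi> \<longrightarrow>
        (LBINT x:U. f x * (deriv ^^ 2) \<phi> x) = - (LINT x|\<mu>. \<phi> x))"

definition L_infty_on :: "real set \<Rightarrow> (real \<Rightarrow> real) \<Rightarrow> bool" where
  "L_infty_on S f \<longleftrightarrow> set_borel_measurable lborel S f \<and>
     (\<exists>B. AE x in lborel. x \<in> S \<longrightarrow> \<bar>f x\<bar> \<le> B)"

text \<open>\<open>BV(U)\<close>: integrable functions whose distributional derivative is a finite signed
  measure, i.e. whose total variation (the supremum below) is finite.\<close>

definition BV_on :: "real set \<Rightarrow> (real \<Rightarrow> real) \<Rightarrow> bool" where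
  "BV_on U f \<longleftrightarrow> set_integrable lborel U f \<and>
     bdd_above {LBINT x:U. f x * deriv \<phi> x | \<phi>. test_function U \<phi> \<and> (\<forall>x. \<bar>\<phi> x\<bar> \<le> 1)}"

section \<open>Classical regularity on the half-open interval\<close>

text \<open>Functions on \<open>[0,1)\<close> are represented by total functions whose values elsewhere
  are irrelevant; hence the derivative is taken within \<open>[0,1)\<close>. It is one-sided at \<open>0\<close>
  and the usual one at interior points.\<close>

definition deriv01 :: "(real \<Rightarrow> real) \<Rightarrow> real \<Rightarrow> real" where
  "deriv01 f s = vector_derivative f (at s within {0..<1})"

definition C1_01 :: "(real \<Rightarrow> real) \<Rightarrow> bool" where
  "C1_01 f \<longleftrightarrow> (\<forall>s\<in>{0..<1}. f differentiable (at s within {0..<1})) \<and>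
     continuous_on {0..<1} (deriv01 f)"

definition C2_01 :: "(real \<Rightarrow> real) \<Rightarrow> bool" where
  "C2_01 f \<longleftrightarrow> C1_01 f \<and> C1_01 (deriv01 f)"

definition Lip_loc :: "real set \<Rightarrow> (real \<Rightarrow> real) \<Rightarrow> bool" where
  "Lip_loc S f \<longleftrightarrow> (\<forall>x\<in>S. \<exists>u>0. \<exists>L. L-lipschitz_on (cball x u \<inter> S) f)"

definition X_space :: "(real \<Rightarrow> real) set" where
  "X_space = {\<eta>. C1_01 \<eta> \<and> Lip_loc {0..<1} (deriv01 \<eta>)}"

text \<open>A representative of the second distributional derivative of \<open>\<eta> \<in> X_space\<close>.
  It is unique only up to Lebesgue-null sets; all uses are insensitive to the choice.\<close>

definition distr2 :: "(real \<Rightarrow> real) \<Rightarrow> real \<Rightarrow> real" where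
  "distr2 \<eta> = (SOME g. distr_deriv 2 {0<..<1} \<eta> g \<and> (\<forall>\<delta>>0. L_infty_on {0..1 - \<delta>} g))"

section \<open>The Crisanti-Sommers functional\<close>

definition mixture :: "real \<Rightarrow> (nat \<Rightarrow> real) \<Rightarrow> real \<Rightarrow> real" where
  "mixture \<beta> b t = \<beta>\<^sup>2 * (\<Sum>p. (b (p + 2))\<^sup>2 * t ^ (p + 2))"

definition Pr01 :: "real measure set" where
  "Pr01 = {\<mu>. prob_space \<mu> \<and> sets \<mu> = sets (restrict_space borel {0..1})}"

definition phi :: "real measure \<Rightarrow> real \<Rightarrow> real" where
  "phi \<mu> t = (LBINT s:{t..1}. measure \<mu> {0..s})"

text \<open>In the second integrand the quotients and the difference are those of
  \<^typ>\<open>ennreal\<close>: \<open>1 / 0 = \<infinity>\<close>, and the truncation in the difference never takes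
  effect as \<open>0 \<le> phi \<mu> s \<le> 1 - s\<close>.\<close>

definition CS_functional :: "(real \<Rightarrow> real) \<Rightarrow> real \<Rightarrow> real measure \<Rightarrow> ereal" where
  "CS_functional \<xi> h \<mu> = ereal (1/2) *
     (ereal (LBINT s:{0..1}. deriv (deriv \<xi>) s * phi \<mu> s)
      + enn2ereal (\<integral>\<^sup>+ s\<in>{0..<1}. (1 / ennreal (phi \<mu> s) - 1 / ennreal (1 - s)) \<partial>lborel)
      + ereal (h\<^sup>2 * phi \<mu> 0))"

definition measure_support :: "real measure \<Rightarrow> real set" where
  "measure_support \<mu> =
     {x \<in> space \<mu>. \<forall>U. open U \<and> x \<in> U \<longrightarrow> emeasure \<mu> (U \<inter> space \<mu>) > 0}"

section \<open>The dual problem\<close>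

definition Lambda_set :: "(real \<Rightarrow> real) \<Rightarrow> real \<Rightarrow> (real \<Rightarrow> real) set" where
  "Lambda_set \<xi> h = {\<eta> \<in> X_space. (\<forall>s\<in>{0..<1}. \<xi> s \<le> \<eta> s) \<and> deriv01 \<eta> 0 = - h\<^sup>2 \<and>
     (AE s in lborel. s \<in> {0..<1} \<longrightarrow> 0 \<le> distr2 \<eta> s)}"

text \<open>The integrand of the dual functional is non-positive on \<open>Lambda_set\<close>, so its
  integral is minus the non-negative integral of its negation.\<close>

definition dual_functional :: "(real \<Rightarrow> real) \<Rightarrow> real \<Rightarrow> (real \<Rightarrow> real) \<Rightarrow> ereal" where
  "dual_functional \<xi> h \<eta> = ereal (1/2) *
     (- enn2ereal (\<integral>\<^sup>+ s\<in>{0..<1}.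
          ennreal (- (2 * sqrt (distr2 \<eta> s) - distr2 \<eta> s * (1 - s) - 1 / (1 - s))) \<partial>lborel)
      + ereal (- \<eta> 0 + h\<^sup>2 + \<xi> 1))"

end

theory Submission
  imports Defs
begin

text \<open>
  The theorem is a duality statement, and the proof exhibits the dual optimizer. Pair a
  probability measure \<open>\<mu>\<close> on \<open>[0,1]\<close>, through its distribution function \<open>F\<close> and \<open>\<phi>(t) = \<integral>\<^sub>t\<^sup>1 F\<close>,
  with a competitor \<open>\<zeta>\<close> of the dual problem, and write \<open>g = \<zeta>''\<close>. Completing the square gives
  \<open>-(2 sqrt g - g (1 - s) - 1/(1 - s)) + (1/\<phi> - 1/(1 - s)) = g (1 - s - \<phi>) + \<phi> (sqrt g - 1/\<phi>)^2\<close>.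
  If \<open>\<phi>(s) = 1 - s\<close> near \<open>1\<close>, then the term \<open>g (1 - s - \<phi>)\<close> can be integrated by parts twice, which
  yields \<open>h^2 (1 - \<phi>(0)) - \<zeta>(0) + \<integral> \<zeta> d\<mu>\<close>. Therefore
  \<open>2 D(\<zeta>) = V - \<integral> \<phi> (sqrt g - 1/\<phi>)^2 - \<integral> (\<zeta> - \<xi>) d\<mu>\<close> for a number \<open>V\<close> that depends on \<open>\<mu>\<close> only
  (\<open>gap_identity\<close>, \<open>dual_value\<close>). Both subtracted terms are non-negative, and they vanish exactly
  if \<open>\<zeta>'' = 1/\<phi>^2\<close> almost everywhere and \<open>\<zeta> = \<xi>\<close> holds \<open>\<mu>\<close>-almost everywhere.

  If \<open>\<mu>\<close> minimizes the Crisanti-Sommers functional, then some competitor reaches \<open>V\<close>. Let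
  \<open>\<eta>\<^sub>0'' = 1/\<phi>^2\<close>, \<open>\<eta>\<^sub>0'(0) = -h^2\<close>, and fix the additive constant by \<open>\<integral> (\<eta>\<^sub>0 - \<xi>) d\<mu> = 0\<close>. The
  first variation of the functional at \<open>\<mu>\<close> in the direction of the Dirac mass at \<open>x\<close> is a positive
  multiple of \<open>\<eta>\<^sub>0(x) - \<xi>(x)\<close>, so \<open>\<eta>\<^sub>0\<close> lies above the obstacle (\<open>u_nonneg\<close>). Consequently every
  dual maximizer equals \<open>\<eta>\<^sub>0\<close> on \<open>[0,1)\<close> (\<open>maximizer_eq_eta0\<close>), and the claims can be read off
  from \<open>\<eta>'' = 1/\<phi>^2\<close>. Indeed \<open>\<phi>'' = -\<mu>\<close> as distributions, \<open>\<eta> - \<xi>\<close> vanishes on the support of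
  \<open>\<mu>\<close>, \<open>\<eta>''' = 2 F/\<phi>^3\<close> is monotone and locally bounded, and a contact point is an interior
  minimum of \<open>\<eta> - \<xi>\<close> or the point \<open>0\<close>.

  On the primal side, pushing any mass that \<open>\<mu>\<close> has beyond a certain point \<open>q0 < 1\<close> back to \<open>q0\<close> strictly
  lowers the functional (\<open>cost_trunc_less\<close>), where \<open>q0\<close> depends on \<open>\<xi>\<close> and \<open>h\<close> only. Hence
  minimizers live on \<open>[0,q0]\<close>, where \<open>\<phi> \<ge> 1 - q0\<close>; this gives the constant \<open>C\<close>, the identity
  \<open>\<eta>'' = 1/(1 - s)^2\<close> near \<open>1\<close>, and, by Helly's selection theorem, the existence of a minimizer
  (\<open>minimizer_exists\<close>), on which the regularity part rests.

  A competitor \<open>\<zeta>\<close> is known only through a distributional second derivative that is chosen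
  arbitrarily among its representatives. Lipschitz functions have bounded densities
  (\<open>lipschitz_imp_abs_cont_on\<close>), and test functions determine a locally integrable function almost
  everywhere (\<open>test_function_separates\<close>); so the chosen representative is a density of \<open>\<zeta>'\<close>
  (\<open>distr2_abs_cont_on\<close>), which is what integration by parts needs.
\<close>

section \<open>Absolutely continuous functions\<close>

text \<open>The density \<open>g\<close> is part of the predicate because integration by parts needs both \<open>f\<close> and \<open>g\<close>,
  and densities are compared up to null sets. Asking for the fundamental theorem on all subintervals makes restriction immediate.\<close>

definition abs_cont_on :: "real \<Rightarrow> real \<Rightarrow> (real \<Rightarrow> real) \<Rightarrow> (real \<Rightarrow> real) \<Rightarrow> bool" where
  "abs_cont_on a b f g \<longleftrightarrow> set_integrable lborel {a..b} g \<and>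
     (\<forall>x y. a \<le> x \<and> x \<le> y \<and> y \<le> b \<longrightarrow> (LBINT t:{x..y}. g t) = f y - f x)"

lemma abs_cont_on_integrable: "abs_cont_on a b f g \<Longrightarrow> set_integrable lborel {a..b} g"
  by (simp add: abs_cont_on_def)

lemma abs_cont_on_integral:
  "abs_cont_on a b f g \<Longrightarrow> a \<le> x \<Longrightarrow> x \<le> y \<Longrightarrow> y \<le> b \<Longrightarrow> (LBINT t:{x..y}. g t) = f y - f x"
  by (simp add: abs_cont_on_def)

lemma abs_cont_on_subset:
  assumes "abs_cont_on a b f g" "a \<le> c" "d \<le> b"
  shows "abs_cont_on c d f g"
  using assms set_integrable_subset[of lborel "{a..b}" g "{c..d}"]
  unfolding abs_cont_on_def by auto

lemma set_integral_Icc_split: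
  fixes g :: "real \<Rightarrow> real"
  assumes "set_integrable lborel {a..c} g" "a \<le> b" "b \<le> c"
  shows "(LBINT t:{a..c}. g t) = (LBINT t:{a..b}. g t) + (LBINT t:{b..c}. g t)"
proof -
  have "{a..c} = {a..b} \<union> {b..c}" using assms by auto
  moreover have "AE t in lborel. \<not> (t \<in> {a..b} \<and> t \<in> {b..c})"
    using AE_lborel_singleton[of b] by eventually_elim auto
  moreover have "set_integrable lborel {a..b} g" "set_integrable lborel {b..c} g"
    using assms by (auto intro: set_integrable_subset)
  ultimately show ?thesis by (simp add: set_integral_Un_AE)
qed

lemma abs_cont_onI:
  assumes g: "set_integrable lborel {a..b} g"
    and f: "\<And>x. x \<in> {a..b} \<Longrightarrow> f x = c + (LBINT t:{a..x}. g t)"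
  shows "abs_cont_on a b f g"
  unfolding abs_cont_on_def
proof (intro conjI allI impI g)
  fix x y assume *: "a \<le> x \<and> x \<le> y \<and> y \<le> b"
  have "set_integrable lborel {a..y} g"
    using g by (rule set_integrable_subset) (use * in auto)
  from set_integral_Icc_split[OF this, of x] * f[of x] f[of y]
  show "(LBINT t:{x..y}. g t) = f y - f x" by auto
qed

lemma abs_cont_on_cong:
  assumes "abs_cont_on a b f g" "\<And>x. x \<in> {a..b} \<Longrightarrow> f x = f' x" "\<And>x. x \<in> {a..b} \<Longrightarrow> g x = g' x"
  shows "abs_cont_on a b f' g'"
proof -
  have "set_integrable lborel {a..b} g = set_integrable lborel {a..b} g'"
    by (rule set_integrable_cong) (use assms in auto)
  moreover have "(LBINT t:{x..y}. g t) = (LBINT t:{x..y}. g' t)" if "a \<le> x" "y \<le> b" for x y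
    by (rule set_lebesgue_integral_cong) (use assms that in auto)
  ultimately show ?thesis using assms(1,2) unfolding abs_cont_on_def by auto
qed

lemma set_integral_cong_AE_integrable:
  fixes f g :: "real \<Rightarrow> real"
  assumes "set_integrable lborel A f" "set_integrable lborel A g"
    and "AE x in lborel. x \<in> A \<longrightarrow> f x = g x"
  shows "(LBINT x:A. f x) = (LBINT x:A. g x)"
  using assms(1,2) unfolding set_lebesgue_integral_def set_integrable_def
  by (intro integral_cong_AE) (use assms(3) in \<open>auto split: split_indicator\<close>)

lemma abs_cont_on_cong_AE:
  assumes f: "abs_cont_on a b f g" and ae: "AE x in lborel. x \<in> {a..b} \<longrightarrow> g x = g' x"
    and g': "set_borel_measurable lborel {a..b} g'"
  shows "abs_cont_on a b f g'"
proof -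
  have i: "set_integrable lborel {a..b} g'"
    by (rule set_integrable_bound[OF abs_cont_on_integrable[OF f] g']) (use ae in auto)
  have "(LBINT t:{x..y}. g t) = (LBINT t:{x..y}. g' t)" if "a \<le> x" "y \<le> b" for x y
  proof (rule set_integral_cong_AE_integrable)
    show "set_integrable lborel {x..y} g" "set_integrable lborel {x..y} g'"
      using set_integrable_subset[OF i] set_integrable_subset[OF abs_cont_on_integrable[OF f]] that by auto
    show "AE t in lborel. t \<in> {x..y} \<longrightarrow> g t = g' t" using ae by eventually_elim (use that in auto)
  qed
  then show ?thesis using f i unfolding abs_cont_on_def by auto
qed

lemma abs_cont_on_add:
  assumes "abs_cont_on a b f f'" "abs_cont_on a b g g'"
  shows "abs_cont_on a b (\<lambda>x. f x + g x) (\<lambda>x. f' x + g' x)"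
proof -
  have "set_integrable lborel {x..y} f'" "set_integrable lborel {x..y} g'" if "a \<le> x" "y \<le> b" for x y
    using assms that unfolding abs_cont_on_def by (auto intro: set_integrable_subset)
  then show ?thesis using assms unfolding abs_cont_on_def by auto
qed

lemma abs_cont_on_cmult:
  assumes "abs_cont_on a b f f'"
  shows "abs_cont_on a b (\<lambda>x. c * f x) (\<lambda>x. c * f' x)"
  using assms unfolding abs_cont_on_def by (auto simp: right_diff_distrib)

lemma abs_cont_on_const: "abs_cont_on a b (\<lambda>x. c) (\<lambda>x. 0)"
  unfolding abs_cont_on_def by (auto simp: set_integrable_def)

lemma abs_cont_on_diff:
  assumes "abs_cont_on a b f f'" "abs_cont_on a b g g'"
  shows "abs_cont_on a b (\<lambda>x. f x - g x) (\<lambda>x. f' x - g' x)"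
  using abs_cont_on_add[OF assms(1) abs_cont_on_cmult[OF assms(2), of "-1"]] by simp

lemma abs_cont_on_C1:
  assumes "\<And>x. x \<in> {a..b} \<Longrightarrow> (f has_real_derivative g x) (at x within {a..b})"
    and "continuous_on {a..b} g"
  shows "abs_cont_on a b f g"
  unfolding abs_cont_on_def
proof (intro conjI allI impI)
  show "set_integrable lborel {a..b} g" by (rule borel_integrable_atLeastAtMost'[OF assms(2)])
  fix x y assume *: "a \<le> x \<and> x \<le> y \<and> y \<le> b"
  show "(LBINT t:{x..y}. g t) = f y - f x"
    unfolding set_lebesgue_integral_def
  proof (rule integral_FTC_atLeastAtMost)
    show "continuous_on {x..y} g" by (rule continuous_on_subset[OF assms(2)]) (use * in auto)
    fix t assume "x \<le> t" "t \<le> y"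
    then show "(f has_vector_derivative g t) (at t within {x..y})"
      using has_vector_derivative_within_subset[of f "g t" t "{a..b}" "{x..y}"] assms(1)[of t] *
      by (simp add: has_real_derivative_iff_has_vector_derivative)
  qed (use * in auto)
qed

lemma abs_cont_on_continuous:
  assumes "abs_cont_on a b f g" shows "continuous_on {a..b} f"
proof -
  note i = set_borel_integral_eq_integral[OF abs_cont_on_integrable[OF assms]]
  have eq: "f a + integral {a..x} g = f x" if "x \<in> {a..b}" for x
  proof -
    have "set_integrable lborel {a..x} g"
      by (rule set_integrable_subset[OF abs_cont_on_integrable[OF assms]]) (use that in auto)
    from set_borel_integral_eq_integral(2)[OF this] abs_cont_on_integral[OF assms, of a x] that
    show ?thesis by simp
  qed
  have "continuous_on {a..b} (\<lambda>x. f a + integral {a..x} g)"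
    by (rule continuous_on_add[OF continuous_on_const indefinite_integral_continuous_1[OF i(1)]])
  then show ?thesis by (rule continuous_on_eq) (rule eq)
qed

lemma set_integrable_mult_continuous:
  fixes f g :: "real \<Rightarrow> real"
  assumes f: "set_integrable lborel {a..b} f" and g: "continuous_on {a..b} g"
  shows "set_integrable lborel {a..b} (\<lambda>x. f x * g x)"
proof -
  have "bounded (g ` {a..b})"
    by (rule compact_imp_bounded[OF compact_continuous_image[OF g compact_Icc]])
  then obtain B where "\<forall>y\<in>g ` {a..b}. norm y \<le> B"
    unfolding bounded_iff by blast
  then have B: "norm (g x) \<le> B" if "x \<in> {a..b}" for x
    using that by blast
  have m: "set_borel_measurable lborel {a..b} g"
    using borel_integrable_atLeastAtMost'[OF g] unfolding set_integrable_def set_borel_measurable_def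
    by (rule borel_measurable_integrable)
  show ?thesis
  proof (rule set_integrable_bound[where f="\<lambda>x. B * f x"])
    show "set_integrable lborel {a..b} (\<lambda>x. B * f x)" using f by simp
    have "(\<lambda>x. (indicator {a..b} x *\<^sub>R f x) * (indicator {a..b} x *\<^sub>R g x)) \<in> borel_measurable lborel"
      using m f unfolding set_integrable_def set_borel_measurable_def
      by (intro borel_measurable_times) (auto dest: borel_measurable_integrable)
    then show "set_borel_measurable lborel {a..b} (\<lambda>x. f x * g x)"
      unfolding set_borel_measurable_def
      by (rule measurable_cong[THEN iffD1, rotated]) (auto split: split_indicator)
    show "AE x in lborel. x \<in> {a..b} \<longrightarrow> norm (f x * g x) \<le> norm (B * f x)"
    proof (intro AE_I2 impI)
      fix x assume "x \<in> {a..b}"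
      from B[OF this] have "\<bar>g x\<bar> \<le> \<bar>B\<bar>" by simp
      then show "norm (f x * g x) \<le> norm (B * f x)"
        using mult_right_mono[of "\<bar>g x\<bar>" "\<bar>B\<bar>" "\<bar>f x\<bar>"] by (simp add: abs_mult mult.commute)
    qed
  qed
qed

text \<open>All exchanges of integrals below are between a product \<open>A x * B y\<close> and a region of the plane
  such as \<open>x \<le> y\<close>; the indicator of the region is bounded, so integrability is that of the factors.\<close>

lemma integrable_triangle:
  fixes A B :: "real \<Rightarrow> real"
  assumes M: "sigma_finite_measure M" "sets M = sets borel" and A: "integrable M A" and B: "integrable lborel B"
    and S: "S \<in> sets (borel \<Otimes>\<^sub>M borel)"
  shows "integrable (M \<Otimes>\<^sub>M lborel) (\<lambda>(x, y). A x * B y * indicator S (x, y))"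
    and "(\<integral>y. (\<integral>x. A x * B y * indicator S (x, y) \<partial>M) \<partial>lborel) =
         (\<integral>x. (\<integral>y. A x * B y * indicator S (x, y) \<partial>lborel) \<partial>M)"
proof -
  interpret M: sigma_finite_measure M by fact
  interpret P: pair_sigma_finite M lborel ..
  have [measurable]: "A \<in> borel_measurable M" "B \<in> borel_measurable lborel"
    using A B by auto
  have [measurable]: "S \<in> sets (M \<Otimes>\<^sub>M lborel)"
    using S M(2) by (simp cong: sets_pair_measure_cong)
  have "integrable (M \<Otimes>\<^sub>M lborel) (\<lambda>(x, y). A x * B y)"
  proof (rule P.Fubini_integrable)
    show "(\<lambda>(x, y). A x * B y) \<in> borel_measurable (M \<Otimes>\<^sub>M lborel)" by measurable
    show "integrable M (\<lambda>x. \<integral>y. norm (case (x, y) of (x, y) \<Rightarrow> A x * B y) \<partial>lborel)"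
      using A by (auto simp: abs_mult)
    show "AE x in M. integrable lborel (\<lambda>y. case (x, y) of (x, y) \<Rightarrow> A x * B y)"
      using B by auto
  qed
  then show *: "integrable (M \<Otimes>\<^sub>M lborel) (\<lambda>(x, y). A x * B y * indicator S (x, y))"
    by (rule Bochner_Integration.integrable_bound) (auto split: split_indicator)
  show "(\<integral>y. (\<integral>x. A x * B y * indicator S (x, y) \<partial>M) \<partial>lborel) =
         (\<integral>x. (\<integral>y. A x * B y * indicator S (x, y) \<partial>lborel) \<partial>M)"
    using P.Fubini_integral[of "\<lambda>x y. A x * B y * indicator S (x, y)"] * by simp
qed

text \<open>The square \<open>[a,b] \<times> [a,b]\<close> is split along its diagonal: integrating \<open>f' s * g' t\<close> over the two
  triangles gives the two terms on the left up to boundary values, and over the square it gives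
  \<open>(f b - f a) * (g b - g a)\<close>.\<close>

lemma integral_product_by_parts:
  assumes f: "abs_cont_on a b f f'" and g: "abs_cont_on a b g g'" and ab: "a \<le> b"
  shows "(LBINT t:{a..b}. f' t * g t + f t * g' t) = f b * g b - f a * g a"
proof -
  define A B where "A = (\<lambda>t. indicator {a..b} t * f' t)" and "B = (\<lambda>t. indicator {a..b} t * g' t)"
  have iA: "integrable lborel A" and iB: "integrable lborel B"
    using f g unfolding A_def B_def abs_cont_on_def set_integrable_def by auto
  have intA: "(\<integral>s. A s * indicator {..t} s \<partial>lborel) = f t - f a" if "t \<in> {a..b}" for t
  proof -
    have "(\<integral>s. A s * indicator {..t} s \<partial>lborel) = (LBINT s:{a..t}. f' s)"
      unfolding set_lebesgue_integral_def A_def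
      by (rule Bochner_Integration.integral_cong) (use that in \<open>auto split: split_indicator\<close>)
    then show ?thesis using abs_cont_on_integral[OF f, of a t] that by auto
  qed
  have intB: "(\<integral>t. B t * indicator {..s} t \<partial>lborel) = g s - g a" if "s \<in> {a..b}" for s
  proof -
    have "(\<integral>t. B t * indicator {..s} t \<partial>lborel) = (LBINT t:{a..s}. g' t)"
      unfolding set_lebesgue_integral_def B_def
      by (rule Bochner_Integration.integral_cong) (use that in \<open>auto split: split_indicator\<close>)
    then show ?thesis using abs_cont_on_integral[OF g, of a s] that by auto
  qed
  have totA: "integral\<^sup>L lborel A = f b - f a"
    using abs_cont_on_integral[OF f, of a b] ab unfolding A_def set_lebesgue_integral_def by simp
  have totB: "integral\<^sup>L lborel B = g b - g a"
    using abs_cont_on_integral[OF g, of a b] ab unfolding B_def set_lebesgue_integral_def by simp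
  define S where "S = {p::real\<times>real. fst p \<le> snd p}"
  have S[measurable]: "S \<in> sets (borel \<Otimes>\<^sub>M borel)"
  proof -
    have "closed S" unfolding S_def by (intro closed_Collect_le continuous_intros)
    then show ?thesis by (subst borel_prod) (rule borel_closed)
  qed
  have "(\<integral>t. (\<integral>s. A s * B t * indicator S (s, t) \<partial>lborel) \<partial>lborel) =
         (\<integral>s. (\<integral>t. A s * B t * indicator S (s, t) \<partial>lborel) \<partial>lborel)"
    by (rule integrable_triangle(2)[OF _ _ iA iB S]) (auto intro: lborel.sigma_finite_measure_axioms)
  also have "(\<lambda>t. \<integral>s. A s * B t * indicator S (s, t) \<partial>lborel) = (\<lambda>t. indicator {a..b} t * (g' t * (f t - f a)))"
  proof
    fix t
    have "(\<integral>s. A s * B t * indicator S (s, t) \<partial>lborel) = B t * (\<integral>s. A s * indicator {..t} s \<partial>lborel)"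
      unfolding Bochner_Integration.integral_mult_right_zero[symmetric]
      by (rule Bochner_Integration.integral_cong) (auto simp: S_def split: split_indicator)
    then show "(\<integral>s. A s * B t * indicator S (s, t) \<partial>lborel) = indicator {a..b} t * (g' t * (f t - f a))"
      using intA[of t] by (auto simp: B_def split: split_indicator)
  qed
  also have "(\<lambda>s. \<integral>t. A s * B t * indicator S (s, t) \<partial>lborel) =
     (\<lambda>s. A s * (g b - g a) - indicator {a..b} s * (f' s * (g s - g a)))"
  proof
    fix s
    have "(\<integral>t. A s * B t * indicator S (s, t) \<partial>lborel) = A s * (\<integral>t. B t * indicator {s..} t \<partial>lborel)"
      unfolding Bochner_Integration.integral_mult_right_zero[symmetric]
      by (rule Bochner_Integration.integral_cong) (auto simp: S_def split: split_indicator)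
    also have "(\<integral>t. B t * indicator {s..} t \<partial>lborel) = (\<integral>t. B t - B t * indicator {..s} t \<partial>lborel)"
    proof (rule integral_cong_AE)
      show "AE t in lborel. B t * indicat_real {s..} t = B t - B t * indicat_real {..s} t"
        using AE_lborel_singleton[of s] by eventually_elim (auto split: split_indicator)
    qed (use iB in auto)
    also have "\<dots> = (g b - g a) - (\<integral>t. B t * indicator {..s} t \<partial>lborel)"
      using iB totB by (subst Bochner_Integration.integral_diff)
        (auto intro!: integrable_real_mult_indicator simp: integrable_real_mult_indicator)
    finally have "(\<integral>t. A s * B t * indicator S (s, t) \<partial>lborel) =
      A s * ((g b - g a) - (\<integral>t. B t * indicator {..s} t \<partial>lborel))" .
    then show "(\<integral>t. A s * B t * indicator S (s, t) \<partial>lborel) =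
      A s * (g b - g a) - indicator {a..b} s * (f' s * (g s - g a))"
      using intB[of s] by (cases "s \<in> {a..b}") (simp_all add: A_def right_diff_distrib)
  qed
  also have "(\<integral>s. A s * (g b - g a) - indicator {a..b} s * (f' s * (g s - g a)) \<partial>lborel) = 
     (f b - f a) * (g b - g a) - (LBINT s:{a..b}. f' s * (g s - g a))"
  proof -
    have "set_integrable lborel {a..b} (\<lambda>s. f' s * (g s - g a))"
      by (intro set_integrable_mult_continuous abs_cont_on_integrable[OF f] continuous_intros abs_cont_on_continuous[OF g])
    then show ?thesis using iA totA unfolding set_integrable_def set_lebesgue_integral_def
      by (subst Bochner_Integration.integral_diff) auto
  qed
  finally have 1: "(LBINT t:{a..b}. g' t * (f t - f a)) = (f b - f a) * (g b - g a) - (LBINT s:{a..b}. f' s * (g s - g a))"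
    unfolding set_lebesgue_integral_def by simp
  have i: "set_integrable lborel {a..b} (\<lambda>s. g' s * f s)" "set_integrable lborel {a..b} (\<lambda>s. f' s * g s)"
    by (intro set_integrable_mult_continuous abs_cont_on_integrable[OF f] abs_cont_on_integrable[OF g] 
      abs_cont_on_continuous[OF g] abs_cont_on_continuous[OF f])+
  have "(LBINT t:{a..b}. g' t * (f t - f a)) = (LBINT t:{a..b}. g' t * f t) - (g b - g a) * f a"
    using i abs_cont_on_integrable[OF g] abs_cont_on_integral[OF g, of a b] ab by (simp add: right_diff_distrib)
  moreover have "(LBINT t:{a..b}. f' t * (g t - g a)) = (LBINT t:{a..b}. f' t * g t) - (f b - f a) * g a"
    using i abs_cont_on_integrable[OF f] abs_cont_on_integral[OF f, of a b] ab by (simp add: right_diff_distrib)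
  moreover have "(LBINT t:{a..b}. f' t * g t + f t * g' t) = (LBINT t:{a..b}. f' t * g t) + (LBINT t:{a..b}. g' t * f t)"
    using i by (simp add: mult.commute)
  ultimately show ?thesis using 1 by (simp add: algebra_simps)
qed

lemma abs_cont_on_mult:
  assumes f: "abs_cont_on a b f f'" and g: "abs_cont_on a b g g'"
  shows "abs_cont_on a b (\<lambda>x. f x * g x) (\<lambda>x. f' x * g x + f x * g' x)"
  unfolding abs_cont_on_def
proof (intro conjI allI impI)
  have 1: "set_integrable lborel {a..b} (\<lambda>s. f' s * g s)"
    by (rule set_integrable_mult_continuous[OF abs_cont_on_integrable[OF f] abs_cont_on_continuous[OF g]])
  have 2: "set_integrable lborel {a..b} (\<lambda>s. f s * g' s)"
    using set_integrable_mult_continuous[OF abs_cont_on_integrable[OF g] abs_cont_on_continuous[OF f]]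
    by (simp add: mult.commute)
  show "set_integrable lborel {a..b} (\<lambda>x. f' x * g x + f x * g' x)"
    by (rule set_integral_add(1)[OF 1 2])
  fix x y assume *: "a \<le> x \<and> x \<le> y \<and> y \<le> b"
  then have "abs_cont_on x y f f'" "abs_cont_on x y g g'"
    using abs_cont_on_subset[OF f] abs_cont_on_subset[OF g] by auto
  then show "(LBINT t:{x..y}. f' t * g t + f t * g' t) = f y * g y - f x * g x"
    using integral_product_by_parts * by simp
qed

text \<open>The positive and negative parts of \<open>g\<close> are densities of two measures that agree on all half-lines,
  hence everywhere, so these densities agree almost everywhere.\<close>

lemma integral_zero_imp_AE_zero:
  assumes "abs_cont_on a b (\<lambda>x. c) g"
  shows "AE x in lborel. x \<in> {a..b} \<longrightarrow> g x = 0"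
proof -
  define h where "h = (\<lambda>x. indicator {a..b} x * g x)"
  have h: "integrable lborel h" using assms unfolding h_def abs_cont_on_def set_integrable_def by simp
  have [measurable]: "h \<in> borel_measurable borel" using h by auto
  have *: "(\<integral>t. h t * indicator {x<..} t \<partial>lborel) = 0" for x
  proof (cases "x < b")
    case True
    have "(\<integral>t. h t * indicator {x<..} t \<partial>lborel) = (LBINT t:{max a x..b}. g t)"
      unfolding set_lebesgue_integral_def
    proof (rule integral_cong_AE)
      show "(\<lambda>t. indicat_real {max a x..b} t *\<^sub>R g t) \<in> borel_measurable lborel"
        using set_integrable_subset[OF abs_cont_on_integrable[OF assms], of "{max a x..b}"]
        unfolding set_integrable_def by (intro borel_measurable_integrable) auto
      show "AE t in lborel. h t * indicat_real {x<..} t = indicat_real {max a x..b} t *\<^sub>R g t"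
        using AE_lborel_singleton[of x] by eventually_elim (auto simp: h_def split: split_indicator)
    qed simp
    also have "\<dots> = 0"
    proof (cases "a \<le> b")
      case True then show ?thesis using abs_cont_on_integral[OF assms, of "max a x" b] \<open>x < b\<close> by auto
    qed (auto simp: set_lebesgue_integral_def)
    finally show ?thesis .
  next
    case False
    then have "(\<lambda>t. h t * indicator {x<..} t) = (\<lambda>t. 0)" by (auto simp: h_def split: split_indicator)
    then show ?thesis by simp
  qed
  have ip: "integrable lborel (\<lambda>t. max 0 (h t) * indicator {x<..} t)" 
    and im: "integrable lborel (\<lambda>t. max 0 (- h t) * indicator {x<..} t)" for x
    by (intro integrable_real_mult_indicator integrable_max integrable_zero integrable_minus h; simp)+
  have em: "emeasure (density lborel (\<lambda>t. ennreal (h t))) {x<..} = 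
      ennreal (\<integral>t. max 0 (h t) * indicator {x<..} t \<partial>lborel)" for x
  proof -
    have "emeasure (density lborel (\<lambda>t. ennreal (h t))) {x<..} =
        (\<integral>\<^sup>+t. ennreal (max 0 (h t) * indicator {x<..} t) \<partial>lborel)"
      by (subst emeasure_density) (auto intro!: nn_integral_cong split: split_indicator)
    also have "\<dots> = ennreal (\<integral>t. max 0 (h t) * indicator {x<..} t \<partial>lborel)"
      by (rule nn_integral_eq_integral[OF ip]) (auto split: split_indicator)
    finally show ?thesis .
  qed
  have em': "emeasure (density lborel (\<lambda>t. ennreal (- h t))) {x<..} = 
      ennreal (\<integral>t. max 0 (- h t) * indicator {x<..} t \<partial>lborel)" for x
  proof -
    have "emeasure (density lborel (\<lambda>t. ennreal (- h t))) {x<..} =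
        (\<integral>\<^sup>+t. ennreal (max 0 (- h t) * indicator {x<..} t) \<partial>lborel)"
      by (subst emeasure_density) (auto intro!: nn_integral_cong split: split_indicator)
    also have "\<dots> = ennreal (\<integral>t. max 0 (- h t) * indicator {x<..} t \<partial>lborel)"
      by (rule nn_integral_eq_integral[OF im]) (auto split: split_indicator)
    finally show ?thesis .
  qed
  have "(\<integral>t. max 0 (h t) * indicator {x<..} t \<partial>lborel) - (\<integral>t. max 0 (- h t) * indicator {x<..} t \<partial>lborel) = 
     (\<integral>t. h t * indicator {x<..} t \<partial>lborel)" for x
    unfolding Bochner_Integration.integral_diff[OF ip im, symmetric]
    by (rule Bochner_Integration.integral_cong) (auto split: split_indicator)
  then have eq: "(\<integral>t. max 0 (h t) * indicator {x<..} t \<partial>lborel) = (\<integral>t. max 0 (- h t) * indicator {x<..} t \<partial>lborel)" for x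
    using * by simp
  have "density lborel (\<lambda>t. ennreal (h t)) = density lborel (\<lambda>t. ennreal (- h t))"
    by (rule measure_eqI_lessThan) (auto simp: em em' eq)
  then have "AE t in lborel. ennreal (h t) = ennreal (- h t)"
    by (subst (asm) sigma_finite_measure.density_unique_iff[OF lborel.sigma_finite_measure_axioms]) auto
  then show ?thesis
  proof eventually_elim
    case (elim t)
    then have "h t = 0" by (cases "0 \<le> h t") (auto simp: ennreal_neg ennreal_eq_0_iff)
    then show ?case by (auto simp: h_def)
  qed
qed

lemma abs_cont_on_unique:
  assumes "abs_cont_on a b f g" "abs_cont_on a b f g'"
  shows "AE x in lborel. x \<in> {a..b} \<longrightarrow> g x = g' x"
proof -
  have "abs_cont_on a b (\<lambda>x. 0) (\<lambda>x. g x - g' x)"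
    using abs_cont_on_diff[OF assms] by simp
  from integral_zero_imp_AE_zero[OF this] show ?thesis by simp
qed

text \<open>Here \<open>F\<close> is a bi-Lipschitz bijection of the line. The image of Lebesgue measure under its inverse
  gives \<open>{x..y}\<close> the mass \<open>F y - F x\<close>, and it is absolutely continuous because Lipschitz maps send
  null sets to null sets; its Radon-Nikodym density is the derivative of \<open>F\<close>.\<close>

lemma steep_imp_density:
  fixes F :: "real \<Rightarrow> real"
  assumes L1: "0 < L1" and low: "\<And>x y. x \<le> y \<Longrightarrow> L1 * (y - x) \<le> F y - F x"
    and up: "\<And>x y. x \<le> y \<Longrightarrow> F y - F x \<le> L2 * (y - x)"
  shows "\<exists>\<psi>. (\<forall>x. 0 \<le> \<psi> x) \<and> (\<forall>a b. abs_cont_on a b F \<psi>)"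
proof -
  have mono: "F x < F y" if "x < y" for x y
    using low[of x y] that L1 by (smt (verit) mult_pos_pos)
  then have inj: "inj F" by (metis injI linorder_neqE_linordered_idom order_less_irrefl)
  have le: "F x \<le> F y" if "x \<le> y" for x y
    using mono[of x y] that by (auto simp: le_less)
  have lip: "\<bar>F y - F x\<bar> \<le> L2 * \<bar>y - x\<bar>" for x y
  proof (cases "x \<le> y")
    case True
    then show ?thesis using up[OF True] le[OF True] by simp
  next
    case False
    then show ?thesis using up[of y x] le[of y x] by simp
  qed
  then have "continuous_on UNIV F"
    by (intro lipschitz_on_continuous_on[of "\<bar>L2\<bar>"] lipschitz_onI)
      (auto simp: dist_real_def abs_minus_commute intro: order_trans[OF _ mult_right_mono[of L2]])
  then have cont: "continuous_on S F" for S by (rule continuous_on_subset) auto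
  have surj: "\<exists>x. F x = y" for y
  proof -
    define R where "R = \<bar>y - F 0\<bar> / L1"
    have R: "0 \<le> R" "L1 * R = \<bar>y - F 0\<bar>" using L1 by (auto simp: R_def)
    have "F (- R) \<le> y" "y \<le> F R" using low[of "-R" 0] low[of 0 R] R by auto
    then show ?thesis using IVT'[of F "-R" y R] R cont by auto
  qed
  define K where "K = inv F"
  have "surj F" unfolding surj_def using surj by metis
  then have FK: "F (K y) = y" and KF: "K (F x) = x" for x y
    unfolding K_def using inj by (simp_all add: surj_f_inv_f)
  have "mono K"
  proof (rule monoI, rule ccontr)
    fix x y assume "x \<le> y" "\<not> K x \<le> K y"
    then show False using mono[of "K y" "K x"] FK by simp
  qed
  then have K[measurable]: "K \<in> borel_measurable borel" by (rule borel_measurable_mono)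
  have vim: "K -` A = F ` A" for A
  proof (intro set_eqI iffI)
    fix y assume "y \<in> K -` A"
    then show "y \<in> F ` A" using imageI[of "K y" A F] FK[of y] by simp
  qed (use KF in auto)
  define N where "N = distr lborel borel K"
  have emN: "emeasure N A = emeasure lborel (F ` A)" if "A \<in> sets borel" for A
    using that unfolding N_def by (subst emeasure_distr) (auto simp: vim)
  have "absolutely_continuous lborel N"
    unfolding absolutely_continuous_def
  proof (rule subsetI)
    fix A :: "real set" assume A: "A \<in> null_sets lborel"
    then have "negligible A" by (simp add: negligible_iff_null_sets null_sets_completionI)
    have "negligible (F ` A)"
    proof (rule negligible_locally_Lipschitz_image)
      show "\<exists>T B. open T \<and> x \<in> T \<and> (\<forall>y\<in>A \<inter> T. norm (F y - F x) \<le> B * norm (y - x))" for x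
        by (rule exI[of _ UNIV], rule exI[of _ L2]) (use lip in auto)
    qed (use \<open>negligible A\<close> in auto)
    moreover have "F ` A \<in> sets borel"
      using measurable_sets[OF K, of A] A vim by auto
    ultimately have "emeasure lborel (F ` A) = 0"
      by (simp add: negligible_iff_emeasure0)
    then show "A \<in> null_sets N" using A emN by (auto simp: null_sets_def N_def)
  qed
  from sigma_finite_measure.Radon_Nikodym[OF lborel.sigma_finite_measure_axioms this]
  obtain f where f[measurable]: "f \<in> borel_measurable lborel" and fN: "density lborel f = N"
    by (auto simp: N_def)
  define \<psi> where "\<psi> = (\<lambda>x. enn2real (f x))"
  have int: "(\<integral>\<^sup>+t. f t * indicator {x..y} t \<partial>lborel) = ennreal (F y - F x)" if "x \<le> y" for x y
  proof -
    have "F ` {x..y} = {F x..F y}"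
    proof
      show "F ` {x..y} \<subseteq> {F x..F y}" using mono by (force simp: le_less)
      show "{F x..F y} \<subseteq> F ` {x..y}"
      proof
        fix z assume "z \<in> {F x..F y}"
        then show "z \<in> F ` {x..y}" using IVT'[of F x z y] cont that by (auto simp: image_iff)
      qed
    qed
    moreover have "F x \<le> F y" using mono[of x y] that by (auto simp: le_less)
    ultimately have "emeasure N {x..y} = ennreal (F y - F x)" by (simp add: emN)
    then show ?thesis unfolding fN[symmetric] by (simp add: emeasure_density)
  qed
  have fin: "AE t in lborel. t \<in> {x..y} \<longrightarrow> f t \<noteq> \<infinity>" if "x \<le> y" for x y
    using nn_integral_PInf_AE[of "\<lambda>t. f t * indicator {x..y} t" lborel] int[OF that]
    by (auto split: split_indicator_asm elim!: eventually_mono)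
  have hb: "has_bochner_integral lborel (\<lambda>t. indicator {x..y} t *\<^sub>R \<psi> t) (F y - F x)" if "x \<le> y" for x y
  proof (rule has_bochner_integral_nn_integral)
    have "(\<integral>\<^sup>+t. ennreal (indicator {x..y} t *\<^sub>R \<psi> t) \<partial>lborel) = (\<integral>\<^sup>+t. f t * indicator {x..y} t \<partial>lborel)"
    proof (rule nn_integral_cong_AE)
      show "AE t in lborel. ennreal (indicator {x..y} t *\<^sub>R \<psi> t) = f t * indicator {x..y} t"
        using fin[OF that] by eventually_elim (auto simp: \<psi>_def less_top split: split_indicator)
    qed
    then show "(\<integral>\<^sup>+t. ennreal (indicator {x..y} t *\<^sub>R \<psi> t) \<partial>lborel) = ennreal (F y - F x)"
      using int[OF that] by simp
    show "0 \<le> F y - F x" using mono[of x y] that by (auto simp: le_less)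
  qed (auto simp: \<psi>_def)
  have "abs_cont_on a b F \<psi>" for a b
  proof (cases "a \<le> b")
    case True
    then show ?thesis using hb unfolding abs_cont_on_def set_integrable_def set_lebesgue_integral_def
      by (auto simp: has_bochner_integral_iff)
  qed (auto simp: abs_cont_on_def set_integrable_def)
  then show ?thesis by (intro exI[of _ \<psi>]) (auto simp: \<psi>_def)
qed

text \<open>Adding a steep linear function to \<open>f\<close> and to \<open>-f\<close> produces two increasing functions. The sum of
  their densities is constant by uniqueness, and as both are non-negative, each is bounded.\<close>

lemma lipschitz_imp_abs_cont_on:
  fixes f :: "real \<Rightarrow> real"
  assumes f: "L-lipschitz_on {a..b} f"
  shows "\<exists>g. abs_cont_on a b f g \<and> g \<in> borel_measurable borel \<and> (\<forall>x. \<bar>g x\<bar> \<le> 2 * L + 2)"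
proof (cases "a \<le> b")
  case True
  \<comment> \<open>The nearest-point retraction onto the interval extends the restriction of \<open>f\<close> to the line.\<close>
  define c where "c = (\<lambda>x. max a (min b x))"
  define M where "M = L + 1"
  have L: "0 \<le> L" by (rule lipschitz_on_nonneg[OF f])
  have c: "c x \<in> {a..b}" "\<bar>c x - c y\<bar> \<le> \<bar>x - y\<bar>" for x y using True by (auto simp: c_def)
  have fc: "\<bar>f (c x) - f (c y)\<bar> \<le> L * \<bar>x - y\<bar>" for x y
    using lipschitz_onD[OF f c(1) c(1), of x y] mult_left_mono[OF c(2) L, of x y]
    by (auto simp: dist_real_def)
  have b1: "- (L * (y - x)) \<le> f (c y) - f (c x)" "f (c y) - f (c x) \<le> L * (y - x)" if "x \<le> y" for x y
    using fc[of y x] that by (auto simp: abs_le_iff)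
  have "\<exists>\<psi>. (\<forall>x. 0 \<le> \<psi> x) \<and> (\<forall>a b. abs_cont_on a b (\<lambda>x. f (c x) + (2 * L + 1) * x) \<psi>)"
  proof (rule steep_imp_density[of 1 _ "3 * L + 1"])
    fix x y :: real assume "x \<le> y"
    with b1[OF this] mult_left_mono[OF this L]
    show "1 * (y - x) \<le> f (c y) + (2 * L + 1) * y - (f (c x) + (2 * L + 1) * x)"
      and "f (c y) + (2 * L + 1) * y - (f (c x) + (2 * L + 1) * x) \<le> (3 * L + 1) * (y - x)"
      by (simp_all add: algebra_simps)
  qed simp
  then obtain \<psi>1 where p1: "\<And>x. 0 \<le> \<psi>1 x" "abs_cont_on a b (\<lambda>x. f (c x) + (2 * L + 1) * x) \<psi>1" by blast
  have "\<exists>\<psi>. (\<forall>x. 0 \<le> \<psi> x) \<and> (\<forall>a b. abs_cont_on a b (\<lambda>x. - f (c x) + (2 * L + 1) * x) \<psi>)"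
  proof (rule steep_imp_density[of 1 _ "3 * L + 1"])
    fix x y :: real assume "x \<le> y"
    with b1[OF this] mult_left_mono[OF this L]
    show "1 * (y - x) \<le> - f (c y) + (2 * L + 1) * y - (- f (c x) + (2 * L + 1) * x)"
      and "- f (c y) + (2 * L + 1) * y - (- f (c x) + (2 * L + 1) * x) \<le> (3 * L + 1) * (y - x)"
      by (simp_all add: algebra_simps)
  qed simp
  then obtain \<psi>2 where p2: "\<And>x. 0 \<le> \<psi>2 x" "abs_cont_on a b (\<lambda>x. - f (c x) + (2 * L + 1) * x) \<psi>2" by blast
  have lin: "abs_cont_on a b (\<lambda>x. r * x) (\<lambda>x. r)" for r
    by (rule abs_cont_on_C1) (auto intro!: derivative_eq_intros)
  have "abs_cont_on a b (\<lambda>x. (4 * L + 2) * x) (\<lambda>x. \<psi>1 x + \<psi>2 x)"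
    using abs_cont_on_add[OF p1(2) p2(2)] by (rule abs_cont_on_cong) (auto simp: algebra_simps)
  from abs_cont_on_unique[OF this lin]
  have ae: "AE x in lborel. x \<in> {a..b} \<longrightarrow> \<psi>1 x + \<psi>2 x = 4 * L + 2" .
  \<comment> \<open>Clipping turns the almost-everywhere bound into one that holds at every point.\<close>
  define g where "g = (\<lambda>x. indicator {a..b} x * max (- (2 * L + 1)) (min (2 * L + 1) (\<psi>1 x - (2 * L + 1))))"
  have "abs_cont_on a b f (\<lambda>x. \<psi>1 x - (2 * L + 1))"
    using abs_cont_on_diff[OF p1(2) lin[of "2 * L + 1"]]
    by (rule abs_cont_on_cong) (auto simp: c_def)
  moreover from this have m[measurable]: "(\<lambda>x. indicator {a..b} x *\<^sub>R (\<psi>1 x - (2 * L + 1))) \<in> borel_measurable lborel"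
    unfolding abs_cont_on_def set_integrable_def by (auto dest!: borel_measurable_integrable)
  have g2: "g = (\<lambda>x. max (- (2 * L + 1)) (min (2 * L + 1) (indicator {a..b} x *\<^sub>R (\<psi>1 x - (2 * L + 1)))))"
    using L by (auto simp: g_def fun_eq_iff split: split_indicator)
  have gm: "g \<in> borel_measurable borel" unfolding g2 using m by simp
  have "AE x in lborel. x \<in> {a..b} \<longrightarrow> \<psi>1 x - (2 * L + 1) = g x"
    using ae by eventually_elim (use p1(1) p2(1) in \<open>auto simp: g_def max_def min_def; smt (verit)\<close>)
  moreover have "set_borel_measurable lborel {a..b} g" using gm unfolding set_borel_measurable_def by simp
  ultimately have "abs_cont_on a b f g" by (blast intro: abs_cont_on_cong_AE)
  moreover have "\<bar>g x\<bar> \<le> 2 * L + 2" for x using L by (auto simp: g_def abs_le_iff split: split_indicator)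
  ultimately show ?thesis using gm by blast
qed (use lipschitz_on_nonneg[OF f] in \<open>auto intro!: exI[of _ "\<lambda>x. 0"] simp: abs_cont_on_def set_integrable_def\<close>)

section \<open>Test functions\<close>

text \<open>The powers of \<open>1/x\<close> make the family closed under differentiation up to linear combinations,
  whereas \<open>exp (-1/x)\<close> alone is not.\<close>

definition bump :: "nat \<Rightarrow> real \<Rightarrow> real" where
  "bump k x = (if 0 < x then (1 / x) ^ k * exp (- (1 / x)) else 0)"

lemma bump_has_derivative:
  "(bump k has_real_derivative (- real k * bump (k + 1) x + bump (k + 2) x)) (at x)"
proof -
  consider "x < 0" | "x = 0" | "x > 0" by linarith
  then show ?thesis
  proof cases
    case 1
    have "((\<lambda>_. 0) has_real_derivative 0) (at x)" by simp
    then have "(bump k has_real_derivative 0) (at x)"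
      by (rule has_field_derivative_transform_within_open[of _ _ _ "{..<0}"]) (use 1 in \<open>auto simp: bump_def\<close>)
    then show ?thesis using 1 by (simp add: bump_def)
  next
    case 3
    have "((\<lambda>x. (1 / x) ^ k * exp (- (1 / x))) has_real_derivative (- real k * bump (k + 1) x + bump (k + 2) x)) (at x)"
    proof -
      have "((\<lambda>x. (1 / x) ^ k * exp (- (1 / x))) has_real_derivative
        (real k * ((- (1 / x\<^sup>2)) * (1 / x) ^ (k - 1))) * exp (- (1 / x)) + (1 / x) ^ k * (exp (- (1 / x)) * (1 / x\<^sup>2))) (at x)"
        using 3 by (auto intro!: derivative_eq_intros simp: power2_eq_square)
      also have "(real k * ((- (1 / x\<^sup>2)) * (1 / x) ^ (k - 1))) * exp (- (1 / x)) + (1 / x) ^ k * (exp (- (1 / x)) * (1 / x\<^sup>2))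
         = - real k * bump (k + 1) x + bump (k + 2) x"
        using 3 by (cases k) (auto simp: bump_def power2_eq_square field_simps)
      finally show ?thesis .
    qed
    then show ?thesis
      by (rule has_field_derivative_transform_within_open[of _ _ _ "{0<..}"]) (use 3 in \<open>auto simp: bump_def\<close>)
  next
    case 2
    have "((\<lambda>y::real. y ^ (k + 1) / exp y) \<longlongrightarrow> 0) at_top" by (rule tendsto_power_div_exp_0)
    then have "((\<lambda>h::real. (inverse h) ^ (k + 1) / exp (inverse h)) \<longlongrightarrow> 0) (at_right 0)"
      by (rule filterlim_compose[OF _ filterlim_inverse_at_top_right])
    then have R: "((\<lambda>h. bump k h / h) \<longlongrightarrow> 0) (at_right 0)"
      by (rule Lim_transform_eventually)
        (auto simp: bump_def eventually_at_filter field_simps exp_minus power_divide)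
    have L: "((\<lambda>h. bump k h / h) \<longlongrightarrow> 0) (at_left 0)"
      by (rule Lim_transform_eventually[OF tendsto_const]) (auto simp: bump_def eventually_at_filter)
    from L R have "((\<lambda>h. bump k h / h) \<longlongrightarrow> 0) (at 0)" by (simp add: filterlim_split_at)
    then show ?thesis using 2 by (simp add: DERIV_def bump_def)
  qed
qed

text \<open>A class of functions that is closed under differentiation, so all of its members are smooth.\<close>

inductive bump_algebra :: "(real \<Rightarrow> real) \<Rightarrow> bool" where
  base: "bump_algebra (\<lambda>x. bump k (c * x + d))"
| const: "bump_algebra (\<lambda>x. c)"
| add: "bump_algebra f \<Longrightarrow> bump_algebra g \<Longrightarrow> bump_algebra (\<lambda>x. f x + g x)"
| mult: "bump_algebra f \<Longrightarrow> bump_algebra g \<Longrightarrow> bump_algebra (\<lambda>x. f x * g x)"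

lemma bump_algebra_derivative:
  "bump_algebra f \<Longrightarrow> \<exists>f'. bump_algebra f' \<and> (\<forall>x. (f has_real_derivative f' x) (at x))"
proof (induction rule: bump_algebra.induct)
  case (base k c d)
  define f' where "f' = (\<lambda>x. (- real k * bump (k + 1) (c * x + d) + bump (k + 2) (c * x + d)) * c)"
  have "bump_algebra f'" unfolding f'_def by (intro bump_algebra.intros)
  moreover have "((\<lambda>x. bump k (c * x + d)) has_real_derivative f' x) (at x)" for x
    unfolding f'_def
    by (rule DERIV_chain2[OF bump_has_derivative]) (auto intro!: derivative_eq_intros)
  ultimately show ?case by blast
next
  case (const c)
  show ?case using bump_algebra.const[of 0] by (intro exI[of _ "\<lambda>_. 0"]) auto
next
  case (add f g)
  then obtain f' g' where *: "bump_algebra f'" "bump_algebra g'"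
    "\<And>x. (f has_real_derivative f' x) (at x)" "\<And>x. (g has_real_derivative g' x) (at x)" by blast
  show ?case
    by (rule exI[of _ "\<lambda>x. f' x + g' x"]) (use * in \<open>auto intro!: bump_algebra.intros derivative_eq_intros\<close>)
next
  case (mult f g)
  then obtain f' g' where *: "bump_algebra f'" "bump_algebra g'"
    "\<And>x. (f has_real_derivative f' x) (at x)" "\<And>x. (g has_real_derivative g' x) (at x)" by blast
  have "((\<lambda>x. f x * g x) has_real_derivative f' x * g x + f x * g' x) (at x)" for x
    using DERIV_mult[OF *(3) *(4), of x] by (simp add: algebra_simps)
  moreover have "bump_algebra (\<lambda>x. f' x * g x + f x * g' x)"
    by (intro bump_algebra.add bump_algebra.mult *(1,2) mult.hyps)
  ultimately show ?case by blast
qed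

lemma bump_algebra_smooth:
  assumes "bump_algebra f" shows "(deriv ^^ n) f field_differentiable (at x)"
proof -
  have "bump_algebra ((deriv ^^ n) f)"
  proof (induction n)
    case (Suc n)
    then obtain f' where f': "bump_algebra f'" "\<And>x. ((deriv ^^ n) f has_real_derivative f' x) (at x)"
      using bump_algebra_derivative by blast
    then have "deriv ((deriv ^^ n) f) = f'" by (intro ext DERIV_imp_deriv)
    then show ?case using f'(1) by simp
  qed (use assms in simp)
  from bump_algebra_derivative[OF this] show ?thesis
    unfolding field_differentiable_def by blast
qed

text \<open>Rescaled products of two bumps that increase to the indicator function of \<open>(a,b)\<close>, because
  \<open>exp (-1/y)\<close> tends to \<open>1\<close> as \<open>y\<close> grows.\<close>

definition plateau :: "real \<Rightarrow> real \<Rightarrow> nat \<Rightarrow> real \<Rightarrow> real" where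
  "plateau a b n x = bump 0 (real n * x + (- real n * a)) * bump 0 (- real n * x + real n * b)"

lemma plateau_zero: "x \<notin> {a<..<b} \<Longrightarrow> plateau a b n x = 0"
proof -
  assume "x \<notin> {a<..<b}"
  then have "\<not> 0 < real n * (x - a) \<or> \<not> 0 < real n * (b - x)"
    by (auto simp: zero_less_mult_iff)
  then show ?thesis by (auto simp: plateau_def bump_def algebra_simps)
qed

lemma plateau_bounds: "0 \<le> plateau a b n x" "plateau a b n x \<le> 1"
proof -
  have "0 \<le> bump 0 y" "bump 0 y \<le> 1" for y by (auto simp: bump_def)
  then show "0 \<le> plateau a b n x" "plateau a b n x \<le> 1"
    unfolding plateau_def by (auto intro: mult_le_one)
qed

lemma test_function_plateau:
  assumes "{a..b} \<subseteq> U" shows "test_function U (plateau a b n)"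
proof -
  have "bump_algebra (plateau a b n)" unfolding plateau_def[abs_def]
    by (intro bump_algebra.mult bump_algebra.base)
  moreover have sub: "closure {x. plateau a b n x \<noteq> 0} \<subseteq> {a..b}"
  proof (rule closure_minimal)
    show "{x. plateau a b n x \<noteq> 0} \<subseteq> {a..b}" 
    proof
      fix x assume "x \<in> {x. plateau a b n x \<noteq> 0}"
      then have "x \<in> {a<..<b}" using plateau_zero[of x a b n] by blast
      then show "x \<in> {a..b}" by simp
    qed
  qed simp
  moreover have "compact (closure {x. plateau a b n x \<noteq> 0})"
    using compact_Int_closed[OF compact_Icc closed_closure, of a b "{x. plateau a b n x \<noteq> 0}"] sub
    by (simp add: Int_absorb1)
  ultimately show ?thesis
    using assms bump_algebra_smooth unfolding test_function_def by blast
qed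

lemma plateau_tendsto: "(\<lambda>n. plateau a b n x) \<longlonglongrightarrow> indicator {a<..<b} x"
proof (cases "x \<in> {a<..<b}")
  case True
  have lim: "(\<lambda>n. bump 0 (real n * y)) \<longlonglongrightarrow> 1" if "0 < y" for y
  proof -
    have "(\<lambda>n. exp (- ((1 / y) * inverse (real n)))) \<longlonglongrightarrow> exp (- ((1 / y) * 0))"
      by (intro tendsto_intros lim_inverse_n)
    then have "(\<lambda>n. exp (- ((1 / y) * inverse (real n)))) \<longlonglongrightarrow> 1" by simp
    then show ?thesis
      by (rule Lim_transform_eventually)
        (use that in \<open>auto simp: bump_def field_simps intro!: eventually_sequentiallyI[of 1]\<close>)
  qed
  have "(\<lambda>n. bump 0 (real n * (x - a)) * bump 0 (real n * (b - x))) \<longlonglongrightarrow> 1 * 1"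
    by (intro tendsto_mult lim) (use True in auto)
  then show ?thesis using True by (simp add: plateau_def algebra_simps)
qed (simp add: plateau_zero)

lemma plateau_measurable [measurable]: "plateau a b n \<in> borel_measurable borel"
proof -
  have "continuous_on UNIV (bump 0)"
    using bump_has_derivative[of 0] by (intro DERIV_continuous_on) (auto intro: DERIV_subset)
  then have [measurable]: "bump 0 \<in> borel_measurable borel" by (rule borel_measurable_continuous_onI)
  show ?thesis unfolding plateau_def[abs_def] by measurable
qed

text \<open>The only form in which compactness of the support is used: outside one compact interval the test
  function and all its derivatives vanish.\<close>

lemma test_functionE:
  assumes "test_function {c<..<d} \<phi>" "c < d"
  obtains p q where "c < p" "p \<le> q" "q < d" "\<And>n x. x \<notin> {p..q} \<Longrightarrow> (deriv ^^ n) \<phi> x = 0"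
proof -
  define S where "S = closure {x. \<phi> x \<noteq> 0}"
  have S: "compact S" "S \<subseteq> {c<..<d}" using assms unfolding test_function_def S_def by auto
  have "\<exists>p q. c < p \<and> p \<le> q \<and> q < d \<and> S \<subseteq> {p..q}"
  proof (cases "S = {}")
    case True
    then show ?thesis using assms(2) by (intro exI[of _ "(c + d) / 2"]) auto
  next
    case False
    then obtain p q where "p \<in> S" "q \<in> S" "\<And>x. x \<in> S \<Longrightarrow> p \<le> x" "\<And>x. x \<in> S \<Longrightarrow> x \<le> q"
      using compact_attains_inf[OF S(1)] compact_attains_sup[OF S(1)] by metis
    moreover from this have "S \<subseteq> {p..q}" by auto
    ultimately show ?thesis using S(2) by (intro exI[of _ p] exI[of _ q]) auto
  qed
  then obtain p q where pq: "c < p" "p \<le> q" "q < d" "S \<subseteq> {p..q}" by blast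
  have "(deriv ^^ n) \<phi> x = 0" if "x \<notin> {p..q}" for n x
    using that
  proof (induction n arbitrary: x)
    case 0
    then show ?case using pq(4) closure_subset[of "{x. \<phi> x \<noteq> 0}"] unfolding S_def by auto
  next
    case (Suc n)
    have "((\<lambda>_. 0) has_real_derivative 0) (at x)" by simp
    then have "((deriv ^^ n) \<phi> has_real_derivative 0) (at x)"
      by (rule has_field_derivative_transform_within_open[of _ _ _ "- {p..q}"]) (use Suc in auto)
    then show ?case by (simp add: DERIV_imp_deriv)
  qed
  with pq show ?thesis using that by blast
qed

lemma test_function_derivative:
  assumes "test_function U \<phi>"
  shows "((deriv ^^ n) \<phi> has_real_derivative (deriv ^^ Suc n) \<phi> x) (at x)"
  using assms unfolding test_function_def by (simp add: DERIV_deriv_iff_field_differentiable)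

lemma test_function_continuous:
  assumes "test_function U \<phi>" shows "continuous_on S ((deriv ^^ n) \<phi>)"
  by (rule continuous_at_imp_continuous_on) (use test_function_derivative[OF assms] in \<open>blast intro: DERIV_isCont\<close>)

lemma test_function_abs_cont_on:
  assumes "test_function U \<phi>" shows "abs_cont_on a b ((deriv ^^ n) \<phi>) ((deriv ^^ Suc n) \<phi>)"
  by (rule abs_cont_on_C1)
    (use test_function_derivative[OF assms] test_function_continuous[OF assms, of _ "Suc n"] in
      \<open>auto intro: has_field_derivative_at_within\<close>)

lemma set_integral_restrict_support:
  fixes f :: "real \<Rightarrow> real"
  assumes "A \<subseteq> B" "\<And>x. x \<in> B \<Longrightarrow> x \<notin> A \<Longrightarrow> f x = 0"
  shows "(LBINT x:B. f x) = (LBINT x:A. f x)"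
  unfolding set_lebesgue_integral_def
  by (rule Bochner_Integration.integral_cong) (use assms in \<open>auto split: split_indicator\<close>)

lemma loc_integrableD:
  assumes "loc_integrable U f" "{a..b} \<subseteq> U" shows "set_integrable lborel {a..b} f"
  using assms unfolding loc_integrable_def by auto

lemma AE_Ioo_of_Icc:
  fixes c d :: real
  assumes "\<And>a b. c < a \<Longrightarrow> a \<le> b \<Longrightarrow> b < d \<Longrightarrow> AE x in lborel. x \<in> {a..b} \<longrightarrow> P x"
  shows "AE x in lborel. x \<in> {c<..<d} \<longrightarrow> P x"
proof -
  have "AE x in lborel. x \<in> {c + 1 / real (Suc n)..d - 1 / real (Suc n)} \<longrightarrow> P x" for n
    by (cases "c + 1 / real (Suc n) \<le> d - 1 / real (Suc n)") (rule assms, auto)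
  then have "AE x in lborel. \<forall>n. x \<in> {c + 1 / real (Suc n)..d - 1 / real (Suc n)} \<longrightarrow> P x"
    by (subst AE_all_countable) auto
  then show ?thesis
  proof eventually_elim
    case (elim x)
    show ?case
    proof
      assume x: "x \<in> {c<..<d}"
      then obtain n where "1 / real (Suc n) < min (x - c) (d - x)"
        using nat_approx_posE[of "min (x - c) (d - x)"] by auto
      then show "P x" using elim[rule_format, of n] by auto
    qed
  qed
qed

text \<open>Testing against plateaus and passing to the limit by dominated convergence shows that all integrals
  of \<open>f\<close> over compact subintervals vanish.\<close>

lemma test_function_separates:
  assumes f: "loc_integrable {c<..<d} f"
    and 0: "\<And>\<phi>. test_function {c<..<d} \<phi> \<Longrightarrow> (LBINT x:{c<..<d}. f x * \<phi> x) = 0"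
  shows "AE x in lborel. x \<in> {c<..<d} \<longrightarrow> f x = 0"
proof (rule AE_Ioo_of_Icc)
  fix a b assume ab: "c < a" "a \<le> b" "b < d"
  have "(LBINT t:{x..y}. f t) = 0" if xy: "a \<le> x" "y \<le> b" for x y
  proof -
    have xyU: "{x..y} \<subseteq> {c<..<d}" using that ab by auto
    have i: "integrable lborel (\<lambda>t. indicator {x..y} t *\<^sub>R f t)"
      using loc_integrableD[OF f xyU] by (simp add: set_integrable_def)
    define F where "F = (\<lambda>t. indicator {x..y} t *\<^sub>R f t)"
    have [measurable]: "F \<in> borel_measurable borel" using i by (auto simp: F_def)
    have "(\<lambda>n. \<integral>t. F t * plateau x y n t \<partial>lborel) \<longlonglongrightarrow> (\<integral>t. F t * indicator {x<..<y} t \<partial>lborel)"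
    proof (rule integral_dominated_convergence[where w="\<lambda>t. norm (F t)"])
      show "AE t in lborel. (\<lambda>n. F t * plateau x y n t) \<longlonglongrightarrow> F t * indicator {x<..<y} t"
        by (intro AE_I2 tendsto_mult plateau_tendsto tendsto_const)
      show "AE t in lborel. norm (F t * plateau x y n t) \<le> norm (F t)" for n
        using plateau_bounds[of x y n] by (auto simp: abs_mult intro!: AE_I2 mult_left_le)
      show "integrable lborel (\<lambda>t. norm (F t))" using i by (simp add: F_def)
    qed auto
    moreover have "(\<integral>t. F t * plateau x y n t \<partial>lborel) = 0" for n
    proof -
      have "(\<integral>t. F t * plateau x y n t \<partial>lborel) = (LBINT t:{c<..<d}. f t * plateau x y n t)"
        unfolding set_lebesgue_integral_def F_def
        by (rule Bochner_Integration.integral_cong)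
          (use xyU plateau_zero[of _ x y n] in \<open>auto split: split_indicator\<close>)
      also have "\<dots> = 0" by (rule 0[OF test_function_plateau[OF xyU]])
      finally show ?thesis .
    qed
    ultimately have "(\<integral>t. F t * indicator {x<..<y} t \<partial>lborel) = 0"
      by (simp add: LIMSEQ_const_iff)
    also have "(\<integral>t. F t * indicator {x<..<y} t \<partial>lborel) = (\<integral>t. F t \<partial>lborel)"
    proof (rule integral_cong_AE)
      show "AE t in lborel. F t * indicator {x<..<y} t = F t"
        using AE_lborel_singleton[of x] AE_lborel_singleton[of y]
        by eventually_elim (auto simp: F_def split: split_indicator)
    qed auto
    finally show ?thesis by (simp add: F_def set_lebesgue_integral_def)
  qed
  moreover have "set_integrable lborel {a..b} f" by (rule loc_integrableD[OF f]) (use ab in auto)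
  ultimately have "abs_cont_on a b (\<lambda>_. 0) f" unfolding abs_cont_on_def by simp
  from integral_zero_imp_AE_zero[OF this] show "AE x in lborel. x \<in> {a..b} \<longrightarrow> f x = 0" .
qed

section \<open>The distributional second derivative\<close>

lemma Lip_loc_imp_lipschitz:
  fixes f :: "real \<Rightarrow> real"
  assumes f: "Lip_loc {0..<1} f" and q: "q < 1"
  shows "\<exists>L. L-lipschitz_on {0..q} f"
proof -
  have "local_lipschitz {0::real} {0..q} (\<lambda>_. f)"
    unfolding local_lipschitz_def
  proof (intro ballI)
    fix x t assume "x \<in> {0..q}" "t \<in> {0::real}"
    then have "x \<in> {0..<1}" using q by auto
    then obtain u L where "u > 0" "L-lipschitz_on (cball x u \<inter> {0..<1}) f"
      using f unfolding Lip_loc_def by blast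
    then have "L-lipschitz_on (cball x u \<inter> {0..q}) f"
      using q by (auto elim!: lipschitz_on_subset)
    with \<open>u > 0\<close> show "\<exists>u>0. \<exists>L. \<forall>t\<in>cball t u \<inter> {0}. L-lipschitz_on (cball x u \<inter> {0..q}) f" by blast
  qed
  then obtain L where "\<And>t. t \<in> {0::real} \<Longrightarrow> L-lipschitz_on {0..q} f"
    by (rule local_lipschitz_compact_implies_lipschitz[OF _ compact_Icc finite_imp_compact]) auto
  then show ?thesis by auto
qed

text \<open>On each \<open>[0,q]\<close> with \<open>q < 1\<close> there is a bounded density. Densities on two such intervals agree almost
  everywhere on the smaller one, so countably many of them are glued along the endpoints
  \<open>1 - 1/(n+1)\<close>, which exhaust \<open>[0,1)\<close>.\<close>

lemma Lip_loc_density: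
  fixes f :: "real \<Rightarrow> real"
  assumes f: "Lip_loc {0..<1} f"
  shows "\<exists>g. g \<in> borel_measurable borel \<and>
    (\<forall>q<1. abs_cont_on 0 q f g \<and> (\<exists>B. \<forall>x\<in>{0..q}. \<bar>g x\<bar> \<le> B))"
proof -
  define qn where "qn = (\<lambda>n::nat. 1 - 1 / real (Suc n))"
  have "\<exists>g B. abs_cont_on 0 (qn n) f g \<and> g \<in> borel_measurable borel \<and> (\<forall>x. \<bar>g x\<bar> \<le> B)" for n
    using Lip_loc_imp_lipschitz[OF f, of "qn n"] lipschitz_imp_abs_cont_on[of _ 0 "qn n" f]
    by (auto simp: qn_def) blast
  then obtain g B where g: "\<And>n. abs_cont_on 0 (qn n) f (g n)"
    and gm[measurable]: "\<And>n. g n \<in> borel_measurable borel" and B: "\<And>n x. \<bar>g n x\<bar> \<le> B n"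
    by metis
  have Bn: "0 \<le> B n" for n using B[of n 0] by simp
  \<comment> \<open>The index is chosen so that \<open>x \<le> qn (N x)\<close>, and it is monotone, which keeps the glued density locally bounded.\<close>
  define N where "N = (\<lambda>x::real. nat \<lceil>1 / (1 - x)\<rceil>)"
  have [measurable]: "N \<in> measurable borel (count_space UNIV)" unfolding N_def by measurable
  have N: "x \<le> qn (N x)" if "x < 1" for x
  proof -
    have "1 / (1 - x) \<le> real (Suc (N x))"
      unfolding N_def by (rule order_trans[OF real_nat_ceiling_ge]) simp
    then have "1 / real (Suc (N x)) \<le> 1 - x" using that by (simp add: field_simps)
    then show ?thesis by (simp add: qn_def)
  qed
  have Nm: "N x \<le> N y" if "x \<le> y" "y < 1" for x y
    unfolding N_def using that by (intro nat_mono ceiling_mono divide_left_mono) auto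
  define G where "G = (\<lambda>x. g (N x) x)"
  have Gm[measurable]: "G \<in> borel_measurable borel"
    unfolding G_def by (rule measurable_compose_countable) auto
  have "AE x in lborel. x \<in> {0..min (qn n) (qn m)} \<longrightarrow> g n x = g m x" for n m
    by (rule abs_cont_on_unique[of _ _ f]) (rule abs_cont_on_subset[OF g], auto)+
  then have ae: "AE x in lborel. \<forall>n m. x \<in> {0..min (qn n) (qn m)} \<longrightarrow> g n x = g m x"
    by (simp add: AE_all_countable)
  have "abs_cont_on 0 q f G" if q: "q < 1" for q
  proof (rule abs_cont_on_cong_AE)
    show "abs_cont_on 0 q f (g (N q))" by (rule abs_cont_on_subset[OF g _ N[OF q]]) simp
    show "AE x in lborel. x \<in> {0..q} \<longrightarrow> g (N q) x = G x"
      using ae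
    proof eventually_elim
      case (elim x)
      show ?case
      proof
        assume x: "x \<in> {0..q}"
        then have "x \<le> qn (N q)" "x \<le> qn (N x)" using N[OF q] N[of x] q by auto
        then show "g (N q) x = G x" using elim[rule_format, of "N q" "N x"] x by (simp add: G_def)
      qed
    qed
  qed (simp add: set_borel_measurable_def)
  moreover have "\<exists>B. \<forall>x\<in>{0..q}. \<bar>G x\<bar> \<le> B" if q: "q < 1" for q
  proof (intro exI ballI)
    fix x assume "x \<in> {0..q}"
    then have "N x \<le> N q" using Nm q by auto
    then have "B (N x) \<le> (\<Sum>n\<le>N q. B n)" by (intro member_le_sum) (auto simp: Bn)
    then show "\<bar>G x\<bar> \<le> (\<Sum>n\<le>N q. B n)" using B[of "N x" x] by (simp add: G_def)
  qed
  ultimately show ?thesis using Gm by blast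
qed

lemma C1_01_has_derivative:
  assumes "C1_01 f" "s \<in> {0..<1}"
  shows "(f has_real_derivative deriv01 f s) (at s within {0..<1})"
  using assms vector_derivative_works[of f "at s within {0..<1}"]
  unfolding C1_01_def deriv01_def has_real_derivative_iff_has_vector_derivative by auto

lemma deriv01_eqI:
  assumes "(f has_real_derivative D) (at s within {0..<1})" "s \<in> {0..<1}"
  shows "deriv01 f s = D"
proof -
  have "at_right s \<le> at s within {0..<1}"
    using at_le[of "{s..(s + 1) / 2}" "{0..<1}" s] assms(2) by (simp add: at_within_Icc_at_right subset_eq)
  then have "at s within {0..<1} \<noteq> bot"
    using trivial_limit_at_right_real[of s] by (metis le_bot)
  then show ?thesis using assms unfolding deriv01_def
    by (intro vector_derivative_within) (auto simp: has_real_derivative_iff_has_vector_derivative)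
qed

lemma C1_01_abs_cont_on:
  assumes "C1_01 f" "q < 1"
  shows "abs_cont_on 0 q f (deriv01 f)"
proof (rule abs_cont_on_C1)
  fix x assume "x \<in> {0..q}"
  then show "(f has_real_derivative deriv01 f x) (at x within {0..q})"
    using C1_01_has_derivative[OF assms(1), of x] assms(2)
    by (auto elim!: DERIV_subset)
next
  show "continuous_on {0..q} (deriv01 f)"
    using assms unfolding C1_01_def by (auto elim: continuous_on_subset)
qed

lemma loc_integrable_Ioo_01I:
  assumes "\<And>q. q < 1 \<Longrightarrow> set_integrable lborel {0..q} f"
  shows "loc_integrable {0<..<1} f"
  unfolding loc_integrable_def
proof (intro allI impI, elim conjE)
  fix K :: "real set" assume K: "compact K" "K \<subseteq> {0<..<1}"
  show "set_integrable lborel K f"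
  proof (cases "K = {}")
    case False
    then obtain q where "q \<in> K" "\<And>x. x \<in> K \<Longrightarrow> x \<le> q"
      using compact_attains_sup[OF K(1)] by metis
    then have "K \<subseteq> {0..q}" "q < 1" using K(2) by auto
    then show ?thesis
      using set_integrable_subset[OF assms[of q], of K] K(1) by (simp add: borel_compact)
  qed simp
qed

lemma integral_test_function_by_parts:
  assumes \<phi>: "test_function {0<..<1} \<phi>" and f: "\<And>q. q < 1 \<Longrightarrow> abs_cont_on 0 q f g"
  shows "(LBINT x:{0<..<1}. f x * (deriv ^^ Suc n) \<phi> x) = - (LBINT x:{0<..<1}. g x * (deriv ^^ n) \<phi> x)"
proof -
  obtain p q where pq: "0 < p" "p \<le> q" "q < 1" and 0: "\<And>n x. x \<notin> {p..q} \<Longrightarrow> (deriv ^^ n) \<phi> x = 0"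
    using test_functionE[OF \<phi>] by auto
  define r where "r = (q + 1) / 2"
  have r: "q < r" "r < 1" using pq by (auto simp: r_def)
  have fi: "abs_cont_on 0 r f g" by (rule f[OF r(2)])
  have restr: "(LBINT x:{0<..<1}. k x * (deriv ^^ m) \<phi> x) = (LBINT x:{0..r}. k x * (deriv ^^ m) \<phi> x)" for k m
  proof -
    have "(LBINT x:{0<..<1}. k x * (deriv ^^ m) \<phi> x) = (LBINT x:{p..q}. k x * (deriv ^^ m) \<phi> x)"
      by (rule set_integral_restrict_support) (use pq 0 in auto)
    also have "\<dots> = (LBINT x:{0..r}. k x * (deriv ^^ m) \<phi> x)"
      by (rule set_integral_restrict_support[symmetric]) (use pq r 0 in auto)
    finally show ?thesis .
  qed
  have "(LBINT t:{0..r}. g t * (deriv ^^ n) \<phi> t + f t * (deriv ^^ Suc n) \<phi> t) =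
      f r * (deriv ^^ n) \<phi> r - f 0 * (deriv ^^ n) \<phi> 0"
    by (rule integral_product_by_parts[OF fi test_function_abs_cont_on[OF \<phi>]]) (use pq r in auto)
  also have "\<dots> = 0" using 0[of r n] 0[of 0 n] pq r by auto
  also have "(LBINT t:{0..r}. g t * (deriv ^^ n) \<phi> t + f t * (deriv ^^ Suc n) \<phi> t) =
      (LBINT t:{0..r}. g t * (deriv ^^ n) \<phi> t) + (LBINT t:{0..r}. f t * (deriv ^^ Suc n) \<phi> t)"
  proof (rule set_integral_add(2))
    show "set_integrable lborel {0..r} (\<lambda>t. g t * (deriv ^^ n) \<phi> t)"
      by (rule set_integrable_mult_continuous[OF abs_cont_on_integrable[OF fi] test_function_continuous[OF \<phi>]])
    show "set_integrable lborel {0..r} (\<lambda>t. f t * (deriv ^^ Suc n) \<phi> t)"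
      by (rule borel_integrable_atLeastAtMost')
        (rule continuous_on_mult[OF abs_cont_on_continuous[OF fi] test_function_continuous[OF \<phi>]])
  qed
  finally show ?thesis unfolding restr by linarith
qed

lemma abs_cont_on_distr_deriv:
  assumes f: "\<And>q. q < 1 \<Longrightarrow> abs_cont_on 0 q f g"
  shows "distr_deriv 1 {0<..<1} f g"
  unfolding distr_deriv_def
proof (intro conjI allI impI)
  show "loc_integrable {0<..<1} f"
    by (rule loc_integrable_Ioo_01I) (rule borel_integrable_atLeastAtMost'[OF abs_cont_on_continuous[OF f]])
  show "loc_integrable {0<..<1} g"
    by (rule loc_integrable_Ioo_01I) (rule abs_cont_on_integrable[OF f])
  fix \<phi> assume "test_function {0<..<1} \<phi>"
  from integral_test_function_by_parts[OF this f, of 0]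
  show "(LBINT x:{0<..<1}. f x * (deriv ^^ 1) \<phi> x) = (- 1) ^ 1 * (LBINT x:{0<..<1}. g x * \<phi> x)"
    by simp
qed

lemma abs_cont_on_distr_deriv2:
  assumes f: "\<And>q. q < 1 \<Longrightarrow> abs_cont_on 0 q f f'" and f': "\<And>q. q < 1 \<Longrightarrow> abs_cont_on 0 q f' g"
  shows "distr_deriv 2 {0<..<1} f g"
  unfolding distr_deriv_def
proof (intro conjI allI impI)
  show "loc_integrable {0<..<1} f"
    by (rule loc_integrable_Ioo_01I) (rule borel_integrable_atLeastAtMost'[OF abs_cont_on_continuous[OF f]])
  show "loc_integrable {0<..<1} g"
    by (rule loc_integrable_Ioo_01I) (rule abs_cont_on_integrable[OF f'])
  fix \<phi> assume \<phi>: "test_function {0<..<1} \<phi>"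
  show "(LBINT x:{0<..<1}. f x * (deriv ^^ 2) \<phi> x) = (- 1) ^ 2 * (LBINT x:{0<..<1}. g x * \<phi> x)"
    using integral_test_function_by_parts[OF \<phi> f, of 1] integral_test_function_by_parts[OF \<phi> f', of 0]
    by (simp add: numeral_2_eq_2)
qed

lemma distr_deriv_unique:
  assumes 1: "distr_deriv k {c<..<d} f g" and 2: "distr_deriv k {c<..<d} f g'"
  shows "AE x in lborel. x \<in> {c<..<d} \<longrightarrow> g x = g' x"
proof (cases "c < d")
  case True
  have li: "loc_integrable {c<..<d} g" "loc_integrable {c<..<d} g'"
    using 1 2 by (auto simp: distr_deriv_def)
  have "AE x in lborel. x \<in> {c<..<d} \<longrightarrow> g x - g' x = 0"
  proof (rule test_function_separates)
    show "loc_integrable {c<..<d} (\<lambda>x. g x - g' x)" using li unfolding loc_integrable_def by auto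
    fix \<phi> assume \<phi>: "test_function {c<..<d} \<phi>"
    obtain p q where pq: "c < p" "p \<le> q" "q < d" and 0: "\<And>n x. x \<notin> {p..q} \<Longrightarrow> (deriv ^^ n) \<phi> x = 0"
      using test_functionE[OF \<phi> True] by auto
    have restr: "(LBINT x:{c<..<d}. k x * \<phi> x) = (LBINT x:{p..q}. k x * \<phi> x)" for k
      by (rule set_integral_restrict_support) (use pq 0[of _ 0] in auto)
    have i: "set_integrable lborel {p..q} (\<lambda>x. k x * \<phi> x)" if "loc_integrable {c<..<d} k" for k
      by (rule set_integrable_mult_continuous[OF loc_integrableD[OF that] test_function_continuous[OF \<phi>, of _ 0, simplified]])
        (use pq in auto)
    have "(LBINT x:{c<..<d}. (g x - g' x) * \<phi> x) = (LBINT x:{c<..<d}. g x * \<phi> x) - (LBINT x:{c<..<d}. g' x * \<phi> x)"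
      using set_integral_diff(2)[OF i[OF li(1)] i[OF li(2)]] restr[of "\<lambda>x. g x - g' x"]
      by (simp add: restr left_diff_distrib)
    also have "\<dots> = 0" using 1 2 \<phi> unfolding distr_deriv_def by (metis (no_types, lifting) diff_self mult_left_cancel power_eq_0_iff zero_neq_neg_one)
    finally show "(LBINT x:{c<..<d}. (g x - g' x) * \<phi> x) = 0" .
  qed
  then show ?thesis by simp
qed simp

text \<open>The choice in \<^const>\<open>distr2\<close> is harmless: \<open>g\<close> is a legitimate candidate, and by uniqueness
  the chosen representative agrees with it almost everywhere, so it is a density of \<open>f'\<close> as well.\<close>

lemma distr2_eq:
  assumes f: "\<And>q. q < 1 \<Longrightarrow> abs_cont_on 0 q f f'" and f': "\<And>q. q < 1 \<Longrightarrow> abs_cont_on 0 q f' g"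
    and g: "g \<in> borel_measurable borel" "\<And>q. q < 1 \<Longrightarrow> \<exists>B. \<forall>x\<in>{0..q}. \<bar>g x\<bar> \<le> B"
  shows "AE x in lborel. x \<in> {0..<1} \<longrightarrow> distr2 f x = g x"
    and "\<And>q. q < 1 \<Longrightarrow> abs_cont_on 0 q f' (distr2 f)"
proof -
  have "L_infty_on {0..1 - \<delta>} g" if \<delta>: "\<delta> > 0" for \<delta>
  proof -
    obtain B where "\<forall>x\<in>{0..1 - \<delta>}. \<bar>g x\<bar> \<le> B" using g(2)[of "1 - \<delta>"] \<delta> by auto
    then have "AE x in lborel. x \<in> {0..1 - \<delta>} \<longrightarrow> \<bar>g x\<bar> \<le> B" by (intro AE_I2) blast
    then show ?thesis using g(1) unfolding L_infty_on_def set_borel_measurable_def by auto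
  qed
  then have *: "\<exists>g. distr_deriv 2 {0<..<1} f g \<and> (\<forall>\<delta>>0. L_infty_on {0..1 - \<delta>} g)"
    using abs_cont_on_distr_deriv2[OF f f'] by blast
  have d: "distr_deriv 2 {0<..<1} f (distr2 f)" and L: "\<And>\<delta>. \<delta> > 0 \<Longrightarrow> L_infty_on {0..1 - \<delta>} (distr2 f)"
    unfolding distr2_def using someI_ex[OF *] by blast+
  have "AE x in lborel. x \<in> {0<..<1} \<longrightarrow> distr2 f x = g x"
    by (rule distr_deriv_unique[OF d abs_cont_on_distr_deriv2[OF f f']])
  then show ae: "AE x in lborel. x \<in> {0..<1} \<longrightarrow> distr2 f x = g x"
    using AE_lborel_singleton[of 0] by eventually_elim auto
  fix q :: real assume q: "q < 1"
  show "abs_cont_on 0 q f' (distr2 f)"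
  proof (rule abs_cont_on_cong_AE[OF f'[OF q]])
    show "AE x in lborel. x \<in> {0..q} \<longrightarrow> g x = distr2 f x"
      using ae by eventually_elim (use q in auto)
    show "set_borel_measurable lborel {0..q} (distr2 f)"
      using L[of "1 - q"] q unfolding L_infty_on_def by simp
  qed
qed

lemma distr2_abs_cont_on:
  assumes "\<eta> \<in> X_space" "q < 1"
  shows "abs_cont_on 0 q (deriv01 \<eta>) (distr2 \<eta>)"
proof -
  have C: "C1_01 \<eta>" and Lp: "Lip_loc {0..<1} (deriv01 \<eta>)" using assms(1) by (auto simp: X_space_def)
  obtain g where g: "g \<in> borel_measurable borel" "\<And>q. q < 1 \<Longrightarrow> abs_cont_on 0 q (deriv01 \<eta>) g"
    "\<And>q. q < 1 \<Longrightarrow> \<exists>B. \<forall>x\<in>{0..q}. \<bar>g x\<bar> \<le> B"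
    using Lip_loc_density[OF Lp] by blast
  show ?thesis by (rule distr2_eq(2)[OF C1_01_abs_cont_on[OF C] g(2,1,3) assms(2)])
qed

section \<open>The functional in terms of distribution functions\<close>

text \<open>Probability measures on \<open>[0,1]\<close> are represented by their distribution functions on the whole line;
  an atom at \<open>0\<close> is a jump there. In this form convex combinations, truncations and limits of measures
  are elementary operations on functions.\<close>

definition cdf01 :: "(real \<Rightarrow> real) \<Rightarrow> bool" where
  "cdf01 F \<longleftrightarrow> mono F \<and> (\<forall>x. continuous (at_right x) F) \<and> (\<forall>x<0. F x = 0) \<and> (\<forall>x\<ge>1. F x = 1)"

definition Phi :: "(real \<Rightarrow> real) \<Rightarrow> real \<Rightarrow> real" where
  "Phi F t = (LBINT s:{t..1}. F s)"

lemma cdf01_range: assumes "cdf01 F" shows "0 \<le> F x" "F x \<le> 1"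
proof -
  have "F (min x (- 1)) \<le> F x" "F x \<le> F (max x 1)"
    using monoD[of F "min x (- 1)" x] monoD[of F x "max x 1"] assms unfolding cdf01_def by auto
  moreover have "F (min x (- 1)) = 0" "F (max x 1) = 1" using assms unfolding cdf01_def by auto
  ultimately show "0 \<le> F x" "F x \<le> 1" by simp_all
qed

lemma cdf01_mono: "cdf01 F \<Longrightarrow> x \<le> y \<Longrightarrow> F x \<le> F y"
  unfolding cdf01_def mono_def by auto

lemma cdf01_measurable: "cdf01 F \<Longrightarrow> F \<in> borel_measurable borel"
  unfolding cdf01_def by (auto intro: borel_measurable_mono)

lemma set_integrable_bounded_Icc:
  fixes f :: "real \<Rightarrow> real"
  assumes "f \<in> borel_measurable borel" "\<And>x. x \<in> {a..b} \<Longrightarrow> \<bar>f x\<bar> \<le> B"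
  shows "set_integrable lborel {a..b} f"
proof (rule set_integrable_bound[where f="\<lambda>_. B"])
  show "set_integrable lborel {a..b} (\<lambda>_. B)"
    by (rule borel_integrable_atLeastAtMost') simp
  show "AE x in lborel. x \<in> {a..b} \<longrightarrow> norm (f x) \<le> norm B" using assms(2) by (force intro!: AE_I2)
qed (use assms(1) in \<open>simp add: set_borel_measurable_def\<close>)

lemma cdf01_integrable:
  assumes F: "cdf01 F" shows "set_integrable lborel {a..b} F"
  by (rule set_integrable_bounded_Icc[OF cdf01_measurable[OF F], of _ _ 1])
    (use cdf01_range[OF F] in \<open>auto simp: abs_le_iff intro: order_trans[OF _ cdf01_range(1)[OF F]]\<close>)

lemma Phi_abs_cont_on:
  assumes F: "cdf01 F" and b: "b \<le> 1"
  shows "abs_cont_on a b (Phi F) (\<lambda>s. - F s)"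
  unfolding abs_cont_on_def
proof (intro conjI allI impI)
  show "set_integrable lborel {a..b} (\<lambda>s. - F s)"
    using cdf01_integrable[OF F] unfolding set_integrable_def by auto
  fix x y assume "a \<le> x \<and> x \<le> y \<and> y \<le> b"
  then have "(LBINT t:{x..1}. F t) = (LBINT t:{x..y}. F t) + (LBINT t:{y..1}. F t)"
    using set_integral_Icc_split[OF cdf01_integrable[OF F], of x y 1] b by simp
  then show "(LBINT t:{x..y}. - F t) = Phi F y - Phi F x"
    using cdf01_integrable[OF F] by (simp add: Phi_def set_integral_uminus)
qed

lemma Phi_one [simp]: "Phi F 1 = 0"
proof -
  have "(LBINT s. indicator {1::real} s *\<^sub>R F s) = (LBINT s::real. 0)"
    by (rule integral_eq_zero_AE[THEN trans])
      (use AE_lborel_singleton[of "1::real"] in \<open>auto elim!: eventually_mono\<close>)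
  then show ?thesis by (simp add: Phi_def set_lebesgue_integral_def)
qed

lemma integral_Icc_bounds:
  fixes f :: "real \<Rightarrow> real"
  assumes f: "set_integrable lborel {a..b} f" and ab: "a \<le> b"
    and "\<And>x. x \<in> {a..b} \<Longrightarrow> m \<le> f x" "\<And>x. x \<in> {a..b} \<Longrightarrow> f x \<le> M"
  shows "m * (b - a) \<le> (LBINT x:{a..b}. f x)" "(LBINT x:{a..b}. f x) \<le> M * (b - a)"
proof -
  have c: "(LBINT x:{a..b}. c) = c * (b - a)" "set_integrable lborel {a..b} (\<lambda>_. c)" for c :: real
    using ab by (auto simp: set_integral_const intro!: borel_integrable_atLeastAtMost')
  have "(LBINT x:{a..b}. m) \<le> (LBINT x:{a..b}. f x)" "(LBINT x:{a..b}. f x) \<le> (LBINT x:{a..b}. M)"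
    by (rule set_integral_mono; use assms c in auto)+
  then show "m * (b - a) \<le> (LBINT x:{a..b}. f x)" "(LBINT x:{a..b}. f x) \<le> M * (b - a)"
    unfolding c by auto
qed

lemma Phi_diff:
  assumes F: "cdf01 F" and xy: "x \<le> y" "y \<le> 1"
  shows "F x * (y - x) \<le> Phi F x - Phi F y" "Phi F x - Phi F y \<le> F y * (y - x)"
proof -
  have "(LBINT t:{x..y}. - F t) = Phi F y - Phi F x"
    by (rule abs_cont_on_integral[OF Phi_abs_cont_on[OF F xy(2)]]) (use xy in auto)
  then have "(LBINT t:{x..y}. F t) = Phi F x - Phi F y"
    using set_integral_uminus[OF cdf01_integrable[OF F], of x y] by simp
  then show "F x * (y - x) \<le> Phi F x - Phi F y" "Phi F x - Phi F y \<le> F y * (y - x)"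
    using integral_Icc_bounds[OF cdf01_integrable[OF F] xy(1), of "F x" "F y"] cdf01_mono[OF F] by auto
qed

lemma Phi_antimono: "cdf01 F \<Longrightarrow> x \<le> y \<Longrightarrow> y \<le> 1 \<Longrightarrow> Phi F y \<le> Phi F x"
  using Phi_diff(1)[of F x y] cdf01_range(1)[of F x] by (smt (verit) mult_nonneg_nonneg)

lemma Phi_bounds:
  assumes "cdf01 F" "x \<le> 1" shows "0 \<le> Phi F x" "Phi F x \<le> 1 - x"
  using Phi_antimono[OF assms(1) assms(2) order_refl] Phi_diff(2)[OF assms(1) assms(2) order_refl]
    cdf01_range(2)[OF assms(1), of 1] assms(1) unfolding cdf01_def by auto

lemma Phi_lipschitz:
  assumes F: "cdf01 F" and "x \<le> y" "y \<le> 1" shows "\<bar>Phi F y - Phi F x\<bar> \<le> y - x"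
  using Phi_diff(2)[OF assms] Phi_antimono[OF assms] cdf01_range(2)[OF F, of y] assms(2)
  by (smt (verit) mult_left_le_one_le cdf01_range(1)[OF F, of y])

lemma Phi_continuous: "cdf01 F \<Longrightarrow> continuous_on {a..1} (Phi F)"
  using abs_cont_on_continuous[OF Phi_abs_cont_on[of F 1 a]] by simp

text \<open>Integrands such as \<open>1 / Phi F s\<close> matter on \<open>[0,1)\<close> only; measurability is transported between
  the restricted space and extension by zero.\<close>

lemma measurable_01_iff:
  fixes f :: "real \<Rightarrow> real"
  shows "(\<lambda>s. indicator {0..<1} s * f s) \<in> borel_measurable borel \<longleftrightarrow>
    f \<in> borel_measurable (restrict_space borel {0..<1})"
  by (subst borel_measurable_restrict_space_iff) auto

lemma measurable_01_ident [measurable]: "(\<lambda>s::real. s) \<in> borel_measurable (restrict_space borel {0..<1})"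
  by (intro borel_measurable_continuous_on_restrict continuous_intros)

lemma Phi_measurable: "cdf01 F \<Longrightarrow> Phi F \<in> borel_measurable (restrict_space borel {0..<1})"
  by (intro borel_measurable_continuous_on_restrict continuous_on_subset[OF Phi_continuous[of F 0]]) auto

lemma Phi_eq_of_one:
  assumes F: "cdf01 F" and one: "\<forall>s\<ge>q. F s = 1" and s: "q \<le> s" "s \<le> 1"
  shows "Phi F s = 1 - s"
  using Phi_diff[OF F s(2) order_refl] one s by auto

lemma Phi_lower:
  assumes F: "cdf01 F" and one: "\<forall>s\<ge>q. F s = 1" and s: "s \<le> q" "q \<le> 1"
  shows "1 - q \<le> Phi F s"
  using Phi_antimono[OF F s] Phi_eq_of_one[OF F one, of q] s by auto

lemma Phi_pos_of_one:
  assumes F: "cdf01 F" and one: "\<forall>s\<ge>q. F s = 1" and "s < 1" "q < 1"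
  shows "0 < Phi F s"
  using Phi_lower[OF F one, of s] Phi_eq_of_one[OF F one, of s] assms(3,4) by (cases "s \<le> q") auto

text \<open>The distribution function of the Dirac mass at \<open>x\<close>.\<close>

definition step :: "real \<Rightarrow> real \<Rightarrow> real" where "step x s = (if s < x then 0 else 1)"

text \<open>The distribution function of the image measure under \<open>x \<mapsto> min x q\<close>.\<close>

definition trunc :: "real \<Rightarrow> (real \<Rightarrow> real) \<Rightarrow> real \<Rightarrow> real" where
  "trunc q F s = (if s < q then F s else 1)"

lemma cdf01_step: assumes "0 \<le> x" "x \<le> 1" shows "cdf01 (step x)"
  unfolding cdf01_def
proof (intro conjI allI impI)
  show "continuous (at_right y) (step x)" for y
  proof -
    have "\<forall>\<^sub>F s in at_right y. step x y = step x s"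
      unfolding eventually_at_right_field
      by (rule exI[of _ "if y < x then x else y + 1"]) (auto simp: step_def)
    then show ?thesis
      unfolding continuous_within by (rule Lim_transform_eventually[OF tendsto_const])
  qed
qed (use assms in \<open>auto simp: step_def mono_def\<close>)

lemma cdf01_trunc:
  assumes F: "cdf01 F" and q: "0 \<le> q" "q \<le> 1" shows "cdf01 (trunc q F)"
proof -
  have "trunc q F = (\<lambda>s. max (F s) (step q s))"
    using cdf01_range[OF F] by (auto simp: fun_eq_iff trunc_def step_def max_def intro: antisym)
  moreover have "cdf01 (\<lambda>s. max (F s) (step q s))"
    using F cdf01_step[OF q] unfolding cdf01_def mono_def
    by (auto intro!: continuous_max simp: max.coboundedI1 max.coboundedI2)
  ultimately show ?thesis by simp
qed

lemma cdf01_convex: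
  assumes "cdf01 F" "cdf01 G" "0 \<le> \<theta>" "\<theta> \<le> 1"
  shows "cdf01 (\<lambda>s. (1 - \<theta>) * F s + \<theta> * G s)"
  using assms unfolding cdf01_def mono_def
  by (auto intro!: continuous_intros add_mono mult_left_mono)

lemma Phi_convex:
  assumes "cdf01 F" "cdf01 G"
  shows "Phi (\<lambda>s. (1 - \<theta>) * F s + \<theta> * G s) t = (1 - \<theta>) * Phi F t + \<theta> * Phi G t"
  unfolding Phi_def using cdf01_integrable[OF assms(1)] cdf01_integrable[OF assms(2)] by simp

definition cost :: "(real \<Rightarrow> real) \<Rightarrow> real \<Rightarrow> (real \<Rightarrow> real) \<Rightarrow> ereal" where
  "cost k h F = ereal (1/2) *
     (ereal (LBINT s:{0..1}. k s * Phi F s)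
      + enn2ereal (\<integral>\<^sup>+ s\<in>{0..<1}. (1 / ennreal (Phi F s) - 1 / ennreal (1 - s)) \<partial>lborel)
      + ereal (h\<^sup>2 * Phi F 0))"

definition excess :: "(real \<Rightarrow> real) \<Rightarrow> real \<Rightarrow> real" where
  "excess F s = 1 / Phi F s - 1 / (1 - s)"

lemma excess_ennreal:
  assumes "cdf01 F" "s < 1" "0 < Phi F s"
  shows "1 / ennreal (Phi F s) - 1 / ennreal (1 - s) = ennreal (excess F s)" "0 \<le> excess F s"
proof -
  have "Phi F s \<le> 1 - s" using Phi_bounds[OF assms(1)] assms(2) by simp
  then have le: "1 / (1 - s) \<le> 1 / Phi F s" using assms by (intro divide_left_mono) auto
  have "1 / ennreal (Phi F s) = ennreal (1 / Phi F s)" "1 / ennreal (1 - s) = ennreal (1 / (1 - s))"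
    using assms divide_ennreal[of 1] by (auto simp flip: ennreal_1)
  then show "1 / ennreal (Phi F s) - 1 / ennreal (1 - s) = ennreal (excess F s)"
    using assms(2) by (simp add: excess_def ennreal_minus)
  show "0 \<le> excess F s" using le by (simp add: excess_def)
qed

lemma excess_measurable:
  assumes F: "cdf01 F" shows "(\<lambda>s. indicator {0..<1} s * excess F s) \<in> borel_measurable borel"
  unfolding measurable_01_iff excess_def using Phi_measurable[OF F] by measurable

lemma excess_nn_integral:
  assumes F: "cdf01 F" and pos: "\<And>s. 0 \<le> s \<Longrightarrow> s < 1 \<Longrightarrow> 0 < Phi F s"
  shows "(\<integral>\<^sup>+ s\<in>{0..<1}. (1 / ennreal (Phi F s) - 1 / ennreal (1 - s)) \<partial>lborel) =
    (\<integral>\<^sup>+ s. ennreal (indicator {0..<1} s * excess F s) \<partial>lborel)"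
  by (rule nn_integral_cong) (use excess_ennreal[OF F] pos in \<open>auto split: split_indicator\<close>)

lemma cost_real:
  assumes F: "cdf01 F" and pos: "\<And>s. 0 \<le> s \<Longrightarrow> s < 1 \<Longrightarrow> 0 < Phi F s"
    and i: "set_integrable lborel {0..<1} (excess F)"
  shows "cost k h F = ereal (1/2 * ((LBINT s:{0..1}. k s * Phi F s) + (LBINT s:{0..<1}. excess F s) + h\<^sup>2 * Phi F 0))"
proof -
  have "(\<integral>\<^sup>+ s. ennreal (indicator {0..<1} s * excess F s) \<partial>lborel) = ennreal (LBINT s:{0..<1}. excess F s)"
    unfolding set_lebesgue_integral_def real_scaleR_def
    by (rule nn_integral_eq_integral)
      (use i excess_ennreal(2)[OF F] pos in \<open>auto simp: set_integrable_def intro!: AE_I2 split: split_indicator\<close>)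
  moreover have "0 \<le> (LBINT s:{0..<1}. excess F s)"
    unfolding set_lebesgue_integral_def
    by (rule integral_nonneg_AE) (use excess_ennreal(2)[OF F] pos in \<open>auto intro!: AE_I2 split: split_indicator\<close>)
  ultimately show ?thesis unfolding cost_def using excess_nn_integral[OF F pos]
    by (simp add: enn2ereal_ennreal)
qed

text \<open>As \<^const>\<open>Phi\<close> is non-increasing, a zero at some \<open>s < 1\<close> would force it to vanish on \<open>[s,1]\<close>, where
  the second integrand of the functional would then be infinite.\<close>

lemma cost_finiteD:
  assumes F: "cdf01 F" and fin: "cost k h F < \<infinity>"
  shows "\<And>s. 0 \<le> s \<Longrightarrow> s < 1 \<Longrightarrow> 0 < Phi F s" "set_integrable lborel {0..<1} (excess F)"
proof -
  let ?I = "\<integral>\<^sup>+ s\<in>{0..<1}. (1 / ennreal (Phi F s) - 1 / ennreal (1 - s)) \<partial>lborel"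
  have I: "?I \<noteq> \<infinity>"
  proof
    assume "?I = \<infinity>"
    then have "cost k h F = \<infinity>" unfolding cost_def by simp
    then show False using fin by simp
  qed
  show pos: "0 < Phi F s" if "0 \<le> s" "s < 1" for s
  proof (rule ccontr)
    assume "\<not> 0 < Phi F s"
    then have 0: "Phi F t = 0" if "s \<le> t" "t \<le> 1" for t
      using Phi_antimono[OF F that] Phi_bounds(1)[OF F that(2)] by auto
    have "(\<integral>\<^sup>+ t. \<infinity> * indicator {s..<1} t \<partial>lborel) \<le> ?I"
    proof (rule nn_integral_mono)
      fix t
      have "1 / ennreal (1 - t) \<noteq> \<infinity>" if "t < 1"
        using that by (simp add: ennreal_divide_eq_top_iff)
      then show "\<infinity> * indicator {s..<1} t \<le> (1 / ennreal (Phi F t) - 1 / ennreal (1 - t)) * indicator {0..<1} t"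
        using 0[of t] that by (auto simp: ennreal_top_minus split: split_indicator)
    qed
    moreover have "(\<integral>\<^sup>+ t. \<infinity> * indicator {s..<1} t \<partial>lborel) = \<infinity>"
      using that by (subst nn_integral_cmult_indicator) (auto simp: ennreal_top_mult)
    ultimately show False using I by (simp add: top_unique)
  qed
  show "set_integrable lborel {0..<1} (excess F)"
    unfolding set_integrable_def real_scaleR_def
  proof (rule integrableI_nonneg)
    show "(\<integral>\<^sup>+ x. ennreal (indicat_real {0..<1} x * excess F x) \<partial>lborel) < \<infinity>"
      using I excess_nn_integral[OF F pos] by (simp add: less_top)
    show "AE x in lborel. 0 \<le> indicat_real {0..<1} x * excess F x"
      using excess_ennreal(2)[OF F] pos by (auto intro!: AE_I2 split: split_indicator)
  qed (use excess_measurable[OF F] in simp)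
qed

text \<open>If all mass lies in \<open>[0,q]\<close>, then \<open>Phi F s = 1 - s\<close> beyond \<open>q\<close>, so the excess vanishes there, while
  on \<open>[0,q]\<close> it is continuous.\<close>

lemma excess_truncated:
  assumes F: "cdf01 F" and one: "\<forall>s\<ge>q. F s = 1" and q: "0 \<le> q" "q < 1"
  shows "set_integrable lborel {0..<1} (excess F)" "(LBINT s:{0..<1}. excess F s) = (LBINT s:{0..q}. excess F s)"
    "set_integrable lborel {0..q} (excess F)"
proof -
  have z: "excess F s = 0" if "s \<in> {0..<1}" "s \<notin> {0..q}" for s
    using Phi_eq_of_one[OF F one, of s] that by (auto simp: excess_def)
  have "continuous_on {0..q} (excess F)"
    unfolding excess_def[abs_def]
    using Phi_pos_of_one[OF F one] q
    by (intro continuous_intros continuous_on_subset[OF Phi_continuous[OF F, of 0]]) (auto simp: less_le)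
  then show i: "set_integrable lborel {0..q} (excess F)" by (rule borel_integrable_atLeastAtMost')
  have "(\<lambda>s. indicator {0..<1} s *\<^sub>R excess F s) = (\<lambda>s. indicator {0..q} s *\<^sub>R excess F s)"
    using z q by (auto simp: fun_eq_iff split: split_indicator)
  then show "set_integrable lborel {0..<1} (excess F)" "(LBINT s:{0..<1}. excess F s) = (LBINT s:{0..q}. excess F s)"
    using i by (auto simp: set_integrable_def set_lebesgue_integral_def)
qed

lemma cost_truncated:
  assumes F: "cdf01 F" and one: "\<forall>s\<ge>q. F s = 1" and q: "0 \<le> q" "q < 1"
  shows "cost k h F = ereal (1/2 * ((LBINT s:{0..1}. k s * Phi F s) + (LBINT s:{0..q}. excess F s) + h\<^sup>2 * Phi F 0))"
  using cost_real[OF F _ excess_truncated(1)[OF assms]] Phi_pos_of_one[OF F one] q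
  unfolding excess_truncated(2)[OF assms] by auto

section \<open>Truncation and existence of minimizers\<close>

lemma set_integral_dominated_convergence_Icc:
  fixes f :: "nat \<Rightarrow> real \<Rightarrow> real"
  assumes f: "\<And>n. set_integrable lborel {a..b} (f n)" and g: "set_integrable lborel {a..b} g"
    and lim: "AE x in lborel. x \<in> {a..b} \<longrightarrow> (\<lambda>n. f n x) \<longlonglongrightarrow> g x"
    and bd: "\<And>n x. x \<in> {a..b} \<Longrightarrow> \<bar>f n x\<bar> \<le> B"
  shows "(\<lambda>n. LBINT x:{a..b}. f n x) \<longlonglongrightarrow> (LBINT x:{a..b}. g x)"
  unfolding set_lebesgue_integral_def
proof (rule integral_dominated_convergence[where w="\<lambda>x. indicator {a..b} x *\<^sub>R B"])
  show "integrable lborel (\<lambda>x. indicat_real {a..b} x *\<^sub>R B)"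
    using borel_integrable_atLeastAtMost'[of a b "\<lambda>_. B"] by (simp add: set_integrable_def)
  show "AE x in lborel. (\<lambda>n. indicat_real {a..b} x *\<^sub>R f n x) \<longlonglongrightarrow> indicat_real {a..b} x *\<^sub>R g x"
    using lim by eventually_elim (auto split: split_indicator)
  show "AE x in lborel. norm (indicat_real {a..b} x *\<^sub>R f n x) \<le> indicat_real {a..b} x *\<^sub>R B" for n
    using bd by (auto intro!: AE_I2 split: split_indicator)
  show "(\<lambda>x. indicat_real {a..b} x *\<^sub>R f n x) \<in> borel_measurable lborel" for n
    using f[of n] unfolding set_integrable_def by (rule borel_measurable_integrable)
  show "(\<lambda>x. indicat_real {a..b} x *\<^sub>R g x) \<in> borel_measurable lborel"
    using g unfolding set_integrable_def by (rule borel_measurable_integrable)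
qed

text \<open>What the variational argument uses of the mixture \<open>\<xi>\<close>: it is twice continuously differentiable
  and convex on \<open>[0,1]\<close>, with \<open>\<xi>'(0) = 0\<close>.\<close>

locale CS_setting =
  fixes \<xi> :: "real \<Rightarrow> real" and h :: real
  assumes xi_deriv: "\<And>s. s \<in> {0..1} \<Longrightarrow> (\<xi> has_real_derivative deriv \<xi> s) (at s)"
    and xi_deriv2: "\<And>s. s \<in> {0..1} \<Longrightarrow> (deriv \<xi> has_real_derivative deriv (deriv \<xi>) s) (at s)"
    and xi2_cont: "continuous_on {0..1} (deriv (deriv \<xi>))"
    and xi2_nonneg: "\<And>s. s \<in> {0..1} \<Longrightarrow> 0 \<le> deriv (deriv \<xi>) s"
    and xi_deriv_0: "deriv \<xi> 0 = 0"
begin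

abbreviation k :: "real \<Rightarrow> real" where "k \<equiv> deriv (deriv \<xi>)"

lemma xi1_abs_cont_on: "abs_cont_on 0 1 (deriv \<xi>) k"
  by (rule abs_cont_on_C1[OF _ xi2_cont]) (use xi_deriv2 in \<open>blast intro: has_field_derivative_at_within\<close>)

lemma integral_k: "(LBINT s:{0..1}. k s) = deriv \<xi> 1"
  using abs_cont_on_integral[OF xi1_abs_cont_on, of 0 1] xi_deriv_0 by simp

lemma xi1_one_nonneg: "0 \<le> deriv \<xi> 1"
  unfolding integral_k[symmetric] set_lebesgue_integral_def
  by (rule integral_nonneg_AE) (use xi2_nonneg in \<open>auto intro!: AE_I2 split: split_indicator\<close>)

text \<open>Chosen such that \<open>1/(1 - q0)\<close> exceeds \<open>\<xi>'(1) + h^2 + 1\<close> by one, which is the strict margin in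
  the comparison of a measure with its truncation.\<close>

definition q0 :: real where "q0 = 1 - 1 / (deriv \<xi> 1 + h\<^sup>2 + 2)"

lemma q0: "0 \<le> q0" "q0 < 1" "1 / (1 - q0) = deriv \<xi> 1 + h\<^sup>2 + 2"
proof -
  define S where "S = deriv \<xi> 1 + h\<^sup>2 + 2"
  have "2 \<le> S" using xi1_one_nonneg by (simp add: S_def)
  then show "0 \<le> q0" "q0 < 1" "1 / (1 - q0) = deriv \<xi> 1 + h\<^sup>2 + 2"
    unfolding q0_def S_def[symmetric] by auto
qed

definition truncated :: "(real \<Rightarrow> real) \<Rightarrow> bool" where
  "truncated F \<longleftrightarrow> cdf01 F \<and> (\<forall>s\<ge>q0. F s = 1)"

lemma k_Phi_integrable:
  assumes "cdf01 F" shows "set_integrable lborel {0..1} (\<lambda>s. k s * Phi F s)"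
  by (intro borel_integrable_atLeastAtMost' continuous_intros xi2_cont Phi_continuous assms)

text \<open>Pushing the mass beyond \<open>q0\<close> back to \<open>q0\<close> raises \<^const>\<open>Phi\<close> by a constant \<open>\<delta> > 0\<close> on \<open>[0,q0]\<close> and by at
  most \<open>\<delta>\<close> elsewhere. The terms with \<open>\<xi>''\<close> and \<open>h^2\<close> grow by at most \<open>\<delta> (\<xi>'(1) + h^2)\<close>. Since
  \<open>Phi F s \<le> 1 - s\<close> before and after, the excess drops by at least \<open>\<delta> \<integral> 1/(1 - s)^2\<close> over \<open>[0,q0]\<close>,
  that is, by \<open>\<delta> (1/(1 - q0) - 1) = \<delta> (\<xi>'(1) + h^2 + 1)\<close>.\<close>

lemma cost_trunc_less:
  assumes F: "cdf01 F" and s0: "q0 \<le> s0" "F s0 \<noteq> 1"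
  shows "cost k h (trunc q0 F) < cost k h F"
proof -
  define G where "G = trunc q0 F"
  have G: "cdf01 G" unfolding G_def by (rule cdf01_trunc[OF F]) (use q0 in auto)
  have oneG: "\<forall>s\<ge>q0. G s = 1" by (simp add: G_def trunc_def)
  note cG = cost_truncated[OF G oneG q0(1,2), of k h]
  have FG: "F s \<le> G s" for s using cdf01_range[OF F] by (simp add: G_def trunc_def)
  show ?thesis
  proof (cases "cost k h F < \<infinity>")
    case False
    then show ?thesis using cG by (simp add: G_def)
  next
    case True
    note posF = cost_finiteD(1)[OF F True] and iF = cost_finiteD(2)[OF F True]
    note cF = cost_real[OF F posF iF, of k h]
    define D where "D = (\<lambda>s. Phi G s - Phi F s)"
    have acD: "abs_cont_on 0 1 D (\<lambda>s. F s - G s)"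
      using abs_cont_on_diff[OF Phi_abs_cont_on[OF G order_refl] Phi_abs_cont_on[OF F order_refl], of 0]
      unfolding D_def by simp
    have D_anti: "D y \<le> D x" if "0 \<le> x" "x \<le> y" "y \<le> 1" for x y
    proof -
      have "(LBINT t:{x..y}. F t - G t) = D y - D x" by (rule abs_cont_on_integral[OF acD that])
      moreover have "0 \<le> (LBINT t. indicator {x..y} t *\<^sub>R (G t - F t))"
        by (rule integral_nonneg_AE) (use FG in \<open>auto intro!: AE_I2 split: split_indicator\<close>)
      moreover have "(LBINT t. indicator {x..y} t *\<^sub>R (G t - F t)) = - (LBINT t:{x..y}. F t - G t)"
        unfolding set_lebesgue_integral_def Bochner_Integration.integral_minus[symmetric]
        by (rule Bochner_Integration.integral_cong) (auto simp: algebra_simps)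
      ultimately show ?thesis by simp
    qed
    define \<delta> where "\<delta> = D q0"
    have D0: "D 0 = \<delta>"
    proof -
      have "(LBINT t:{0..q0}. F t - G t) = D q0 - D 0"
        by (rule abs_cont_on_integral[OF acD]) (use q0 in auto)
      moreover have "(LBINT t:{0..q0}. F t - G t) = 0"
        unfolding set_lebesgue_integral_def
        by (rule integral_eq_zero_AE) (use AE_lborel_singleton[of q0] in \<open>auto simp: G_def trunc_def elim!: eventually_mono\<close>)
      ultimately show ?thesis by (simp add: \<delta>_def)
    qed
    have s0': "s0 < 1" using s0(2) F unfolding cdf01_def by (meson not_less)
    \<comment> \<open>Right continuity moves the point where \<open>F < 1\<close> strictly beyond \<open>q0\<close>, so that mass is really displaced.\<close>
    have "\<exists>s1. q0 < s1 \<and> s1 < 1 \<and> F s1 < 1"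
    proof -
      have "F s0 < 1" using cdf01_range(2)[OF F, of s0] s0(2) by simp
      moreover have "(F \<longlongrightarrow> F s0) (at_right s0)" using F unfolding cdf01_def continuous_within by auto
      ultimately have "\<forall>\<^sub>F s in at_right s0. F s < 1" by (simp add: order_tendstoD(2))
      then obtain b where b: "b > s0" "\<forall>s>s0. s < b \<longrightarrow> F s < 1" unfolding eventually_at_right_field by auto
      define s1 where "s1 = (s0 + min b 1) / 2"
      have "s0 < s1" "s1 < b" "s1 < 1" using b(1) s0' by (auto simp: s1_def min_def field_simps)
      with b(2) s0(1) show ?thesis by (intro exI[of _ s1]) auto
    qed
    then obtain s1 where s1: "q0 < s1" "s1 < 1" "F s1 < 1" by blast
    have \<delta>: "0 < \<delta>"
    proof -
      have "Phi F q0 - Phi F s1 \<le> F s1 * (s1 - q0)" using Phi_diff(2)[OF F, of q0 s1] s1 by simp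
      also have "\<dots> < s1 - q0" using mult_strict_right_mono[of "F s1" 1 "s1 - q0"] s1 by simp
      finally have "Phi F q0 < 1 - q0" using Phi_bounds(2)[OF F, of s1] s1 by simp
      then show ?thesis using Phi_eq_of_one[OF G oneG, of q0] q0 by (simp add: \<delta>_def D_def)
    qed
    have A: "(LBINT s:{0..1}. k s * Phi G s) - (LBINT s:{0..1}. k s * Phi F s) \<le> \<delta> * deriv \<xi> 1"
    proof -
      have "(LBINT s:{0..1}. k s * Phi G s) - (LBINT s:{0..1}. k s * Phi F s) = (LBINT s:{0..1}. k s * Phi G s - k s * Phi F s)"
        by (rule set_integral_diff(2)[symmetric, OF k_Phi_integrable[OF G] k_Phi_integrable[OF F]])
      also have "\<dots> \<le> (LBINT s:{0..1}. \<delta> * k s)"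
      proof (rule set_integral_mono)
        show "set_integrable lborel {0..1} (\<lambda>s. k s * Phi G s - k s * Phi F s)"
          by (rule set_integral_diff(1)[OF k_Phi_integrable[OF G] k_Phi_integrable[OF F]])
        show "set_integrable lborel {0..1} (\<lambda>s. \<delta> * k s)"
          using abs_cont_on_integrable[OF xi1_abs_cont_on] by simp
        fix s :: real assume s: "s \<in> {0..1}"
        have "D s \<le> \<delta>" using D_anti[of 0 s] D0 s by simp
        then show "k s * Phi G s - k s * Phi F s \<le> \<delta> * k s"
          using mult_left_mono[of "D s" \<delta> "k s"] xi2_nonneg[OF s] by (simp add: D_def algebra_simps)
      qed
      also have "\<dots> = \<delta> * deriv \<xi> 1" by (simp add: integral_k)
      finally show ?thesis .
    qed
    have E: "\<delta> * (1 / (1 - q0) - 1) \<le> (LBINT s:{0..<1}. excess F s) - (LBINT s:{0..<1}. excess G s)"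
    proof -
      have ac: "abs_cont_on 0 q0 (\<lambda>s. \<delta> * (1 / (1 - s))) (\<lambda>s. \<delta> * (1 / (1 - s)\<^sup>2))"
        by (rule abs_cont_on_C1)
          (use q0 in \<open>auto intro!: derivative_eq_intros continuous_intros simp: power2_eq_square\<close>)
      have "(LBINT s:{0..q0}. \<delta> * (1 / (1 - s)\<^sup>2)) = \<delta> * (1 / (1 - q0)) - \<delta> * (1 / (1 - 0))"
        by (rule abs_cont_on_integral[OF ac]) (use q0 in auto)
      then have "\<delta> * (1 / (1 - q0) - 1) = (LBINT s:{0..q0}. \<delta> * (1 / (1 - s)\<^sup>2))"
        by (simp add: right_diff_distrib)
      also have "\<dots> \<le> (LBINT s:{0..<1}. excess F s - excess G s)"
        unfolding set_lebesgue_integral_def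
      proof (rule integral_mono)
        show "integrable lborel (\<lambda>s. indicator {0..q0} s *\<^sub>R (\<delta> * (1 / (1 - s)\<^sup>2)))"
          using abs_cont_on_integrable[OF ac] by (simp add: set_integrable_def)
        show "integrable lborel (\<lambda>s. indicator {0..<1} s *\<^sub>R (excess F s - excess G s))"
          using set_integral_diff(1)[OF iF excess_truncated(1)[OF G oneG q0(1,2)]] by (simp add: set_integrable_def)
        fix s
        show "indicator {0..q0} s *\<^sub>R (\<delta> * (1 / (1 - s)\<^sup>2)) \<le> indicator {0..<1} s *\<^sub>R (excess F s - excess G s)"
        proof (cases "s \<in> {0..<1}")
          case True
          then have p: "0 < Phi F s" "0 < Phi G s" using posF Phi_pos_of_one[OF G oneG] q0 by auto
          have b: "Phi G s \<le> 1 - s" "Phi F s \<le> 1 - s" using Phi_bounds(2)[OF G] Phi_bounds(2)[OF F] True by auto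
          have e: "excess F s - excess G s = D s * (1 / (Phi F s * Phi G s))"
            using p by (simp add: excess_def D_def field_simps)
          have D: "0 \<le> D s" using D_anti[of s 1] True by (simp add: D_def)
          have "1 / (1 - s)\<^sup>2 \<le> 1 / (Phi F s * Phi G s)"
            using p b True by (intro divide_left_mono) (auto simp: power2_eq_square intro!: mult_mono)
          then have le: "D s * (1 / (1 - s)\<^sup>2) \<le> excess F s - excess G s"
            unfolding e by (rule mult_left_mono[OF _ D])
          show ?thesis
          proof (cases "s \<le> q0")
            case s: True
            then have "\<delta> \<le> D s" using D_anti[of s q0] True q0 by (simp add: \<delta>_def)
            then have "\<delta> * (1 / (1 - s)\<^sup>2) \<le> D s * (1 / (1 - s)\<^sup>2)" by (intro mult_right_mono) auto
            then show ?thesis using le True s by simp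
          next
            case s: False
            have "0 \<le> D s * (1 / (1 - s)\<^sup>2)" using D by simp
            then show ?thesis using le True s by simp
          qed
        qed (use q0 in auto)
      qed
      also have "\<dots> = (LBINT s:{0..<1}. excess F s) - (LBINT s:{0..<1}. excess G s)"
        by (rule set_integral_diff(2)[OF iF excess_truncated(1)[OF G oneG q0(1,2)]])
      finally show ?thesis .
    qed
    have "h\<^sup>2 * Phi G 0 - h\<^sup>2 * Phi F 0 = h\<^sup>2 * \<delta>" using D0 by (simp add: D_def algebra_simps)
    moreover have "\<delta> * (1 / (1 - q0) - 1) = \<delta> * deriv \<xi> 1 + h\<^sup>2 * \<delta> + \<delta>"
      unfolding q0(3) by (simp add: algebra_simps)
    ultimately have "(LBINT s:{0..1}. k s * Phi G s) + (LBINT s:{0..<1}. excess G s) + h\<^sup>2 * Phi G 0 <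
       (LBINT s:{0..1}. k s * Phi F s) + (LBINT s:{0..<1}. excess F s) + h\<^sup>2 * Phi F 0"
      using A E \<delta> by linarith
    then show ?thesis using cF cG excess_truncated(2)[OF G oneG q0(1,2)] unfolding G_def[symmetric] by simp
  qed
qed

text \<open>Twice the functional on truncated measures, where every term is a proper integral over a compact
  interval.\<close>

definition rcost :: "(real \<Rightarrow> real) \<Rightarrow> real" where
  "rcost F = (LBINT s:{0..1}. k s * Phi F s) + (LBINT s:{0..q0}. excess F s) + h\<^sup>2 * Phi F 0"

lemma cost_rcost: "truncated F \<Longrightarrow> cost k h F = ereal (1/2 * rcost F)"
  unfolding truncated_def rcost_def using cost_truncated[of F q0 k h] q0(1,2) by blast

lemma rcost_nonneg: assumes "truncated F" shows "0 \<le> rcost F"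
proof -
  have F: "cdf01 F" "\<forall>s\<ge>q0. F s = 1" using assms by (auto simp: truncated_def)
  have "0 \<le> (LBINT s:{0..1}. k s * Phi F s)" unfolding set_lebesgue_integral_def
    by (rule integral_nonneg_AE) (use xi2_nonneg Phi_bounds[OF F(1)] in \<open>auto intro!: AE_I2 split: split_indicator\<close>)
  moreover have "0 \<le> (LBINT s:{0..q0}. excess F s)" unfolding set_lebesgue_integral_def
    by (rule integral_nonneg_AE) (use excess_ennreal(2)[OF F(1)] Phi_pos_of_one[OF F] q0 in 
     \<open>auto intro!: AE_I2 split: split_indicator\<close>)
  ultimately show ?thesis using Phi_bounds(1)[OF F(1), of 0] by (simp add: rcost_def)
qed

text \<open>A monotone function has countably many discontinuities, so the distribution functions converge almost
  everywhere. Truncation bounds \<^const>\<open>Phi\<close> below by \<open>1 - q0\<close> on \<open>[0,q0]\<close>, so dominated convergence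
  applies to \<open>1/Phi\<close> as well.\<close>

lemma rcost_tendsto:
  assumes Fn: "\<And>n. truncated (Fn n)" and F: "truncated F"
    and lim: "\<And>x. isCont F x \<Longrightarrow> (\<lambda>n. Fn n x) \<longlonglongrightarrow> F x"
  shows "(\<lambda>n. rcost (Fn n)) \<longlonglongrightarrow> rcost F"
proof -
  have c: "cdf01 (Fn n)" "\<forall>s\<ge>q0. Fn n s = 1" "cdf01 F" "\<forall>s\<ge>q0. F s = 1" for n
    using Fn F by (auto simp: truncated_def)
  have "mono F" using c(3) by (simp add: cdf01_def)
  then have "{x. \<not> isCont F x} \<in> null_sets lborel"
    by (intro countable_imp_null_set_lborel mono_ctble_discont)
  then have "AE x in lborel. x \<notin> {x. \<not> isCont F x}" by (rule AE_not_in)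
  then have ae: "AE x in lborel. (\<lambda>n. Fn n x) \<longlonglongrightarrow> F x" by eventually_elim (use lim in auto)
  have P: "(\<lambda>n. Phi (Fn n) t) \<longlonglongrightarrow> Phi F t" for t
    unfolding Phi_def
    by (rule set_integral_dominated_convergence_Icc[where B=1])
      (use c cdf01_integrable cdf01_range ae in \<open>auto elim: eventually_mono\<close>)
  have "(\<lambda>n. LBINT s:{0..1}. k s * Phi (Fn n) s) \<longlonglongrightarrow> (LBINT s:{0..1}. k s * Phi F s)"
  proof -
    have "bounded (k ` {0..1})"
      by (rule compact_imp_bounded[OF compact_continuous_image[OF xi2_cont compact_Icc]])
    then obtain B where "\<forall>y\<in>k ` {0..1}. norm y \<le> B" unfolding bounded_iff by blast
    then have B: "\<bar>k s\<bar> \<le> B" if "s \<in> {0..1}" for s using that by auto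
    show ?thesis
    proof (rule set_integral_dominated_convergence_Icc[where B=B])
      show "AE x in lborel. x \<in> {0..1} \<longrightarrow> (\<lambda>n. k x * Phi (Fn n) x) \<longlonglongrightarrow> k x * Phi F x"
        by (intro AE_I2 impI tendsto_mult P tendsto_const)
      fix n and x :: real assume x: "x \<in> {0..1}"
      have "\<bar>Phi (Fn n) x\<bar> \<le> 1" using Phi_bounds[OF c(1), of x n] x by auto
      then show "\<bar>k x * Phi (Fn n) x\<bar> \<le> B"
        using mult_mono[OF B[OF x], of "\<bar>Phi (Fn n) x\<bar>" 1] B[OF x] by (simp add: abs_mult)
    qed (use c k_Phi_integrable in auto)
  qed
  moreover have "(\<lambda>n. LBINT s:{0..q0}. excess (Fn n) s) \<longlonglongrightarrow> (LBINT s:{0..q0}. excess F s)"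
  proof (rule set_integral_dominated_convergence_Icc[where B="1 / (1 - q0) + 1 / (1 - q0)"])
    have pos: "1 - q0 \<le> Phi F s" "1 - q0 \<le> Phi (Fn n) s" if "s \<in> {0..q0}" for s n
      using Phi_lower[OF c(3,4), of s] Phi_lower[OF c(1,2), of s n] that q0 by auto
    show "AE x in lborel. x \<in> {0..q0} \<longrightarrow> (\<lambda>n. excess (Fn n) x) \<longlonglongrightarrow> excess F x"
    proof (intro AE_I2 impI)
      fix x assume x: "x \<in> {0..q0}"
      then have "Phi F x \<noteq> 0" using pos(1)[OF x] q0 by auto
      then show "(\<lambda>n. excess (Fn n) x) \<longlonglongrightarrow> excess F x"
        unfolding excess_def by (intro tendsto_intros P)
    qed
    fix n x assume x: "x \<in> {0..q0}"
    have "1 / Phi (Fn n) x \<le> 1 / (1 - q0)" "1 / (1 - x) \<le> 1 / (1 - q0)"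
      using pos(2)[OF x, of n] x q0(2) by (auto intro!: divide_left_mono mult_pos_pos)
    moreover have "0 \<le> 1 / Phi (Fn n) x" "0 \<le> 1 / (1 - x)" using pos(2)[OF x, of n] x q0 by auto
    ultimately show "\<bar>excess (Fn n) x\<bar> \<le> 1 / (1 - q0) + 1 / (1 - q0)"
      unfolding excess_def by linarith
  qed (use excess_truncated(3) c q0 in auto)
  ultimately show ?thesis unfolding rcost_def by (intro tendsto_intros P)
qed

text \<open>Convergence is known at continuity points only; these are dense, and monotonicity together with right
  continuity carries the values \<open>0\<close> and \<open>1\<close> over to the remaining points.\<close>

lemma cdf01_limit:
  assumes Fn: "\<And>n. truncated (Fn n)" and F: "mono F" "\<And>x. continuous (at_right x) F"
    and lim: "\<And>x. isCont F x \<Longrightarrow> (\<lambda>n. Fn n x) \<longlonglongrightarrow> F x"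
  shows "truncated F"
proof -
  have c: "cdf01 (Fn n)" "\<And>s. q0 \<le> s \<Longrightarrow> Fn n s = 1" for n
    using Fn by (auto simp: truncated_def)
  have ex: "\<exists>y. isCont F y \<and> a < y \<and> y < b" if "a < b" for a b
    using open_minus_countable[OF mono_ctble_discont[OF F(1)], of "{a<..<b}"] that by auto
  have z: "F x = v" if "isCont F x" "\<And>n. Fn n x = v" for x v
    using LIMSEQ_unique[OF lim[OF that(1)], of v] that(2) by simp
  have zero: "F x = 0" if x: "x < 0" for x
  proof -
    obtain y where y: "isCont F y" "x - 1 < y" "y < x" using ex[of "x - 1" x] by auto
    obtain y' where y': "isCont F y'" "x < y'" "y' < 0" using ex[of x 0] x by auto
    have "F y = 0" "F y' = 0" using z[OF y(1)] z[OF y'(1)] c(1) y y' x unfolding cdf01_def by auto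
    then show ?thesis using monoD[OF F(1), of y x] monoD[OF F(1), of x y'] y y' by simp
  qed
  have gt: "F x = 1" if x: "q0 < x" for x
  proof -
    obtain y where y: "isCont F y" "q0 < y" "y < x" using ex[of q0 x] x by auto
    obtain y' where y': "isCont F y'" "x < y'" "y' < x + 1" using ex[of x "x + 1"] by auto
    have "F y = 1" "F y' = 1" using z[OF y(1)] z[OF y'(1)] c(2) y y' x by auto
    then show ?thesis using monoD[OF F(1), of y x] monoD[OF F(1), of x y'] y y' by simp
  qed
  have "F q0 = 1"
  proof -
    have "(F \<longlongrightarrow> F q0) (at_right q0)" using F(2) unfolding continuous_within .
    moreover have "\<forall>\<^sub>F s in at_right q0. 1 = F s"
      unfolding eventually_at_right_field using gt by (auto intro!: exI[of _ "q0 + 1"])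
    then have "(F \<longlongrightarrow> 1) (at_right q0)" by (rule Lim_transform_eventually[OF tendsto_const])
    ultimately show ?thesis using tendsto_unique[of "at_right q0" F] by auto
  qed
  then have one: "F x = 1" if "q0 \<le> x" for x using gt that by (cases "x = q0") auto
  show ?thesis unfolding truncated_def cdf01_def using F zero one q0 by auto
qed

lemma minimizer_truncated:
  assumes "cdf01 F" "\<And>G. cdf01 G \<Longrightarrow> cost k h F \<le> cost k h G"
  shows "truncated F"
proof (rule ccontr)
  assume "\<not> truncated F"
  then obtain s where "q0 \<le> s" "F s \<noteq> 1" using assms(1) by (auto simp: truncated_def)
  from cost_trunc_less[OF assms(1) this] assms(2)[OF cdf01_trunc[OF assms(1), of q0]] q0
  show False by auto
qed

text \<open>The direct method: Helly selection applied to a minimizing sequence of truncated measures. By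
  truncation the infimum over these is the infimum over all measures.\<close>

theorem minimizer_exists: "\<exists>F. cdf01 F \<and> (\<forall>G. cdf01 G \<longrightarrow> cost k h F \<le> cost k h G)"
proof -
  define m where "m = Inf (rcost ` {F. truncated F})"
  have tr: "truncated (trunc q0 F)" if "cdf01 F" for F
    using cdf01_trunc[OF that, of q0] q0 by (simp add: truncated_def trunc_def)
  have ne: "rcost ` {F. truncated F} \<noteq> {}" using tr[OF cdf01_step[of 0]] by auto
  have bb: "bdd_below (rcost ` {F. truncated F})" using rcost_nonneg by (auto intro!: bdd_belowI)
  have "\<exists>F. truncated F \<and> rcost F < m + 1 / real (Suc n)" for n
  proof -
    have "m < m + 1 / real (Suc n)" by simp
    then obtain y where "y \<in> rcost ` {F. truncated F}" "y < m + 1 / real (Suc n)"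
      using cInf_lessD[OF ne] unfolding m_def by blast
    then show ?thesis by auto
  qed
  then obtain Fn where Fn: "\<And>n. truncated (Fn n)" "\<And>n. rcost (Fn n) < m + 1 / real (Suc n)" by metis
  have m: "m \<le> rcost F" if "truncated F" for F
    unfolding m_def by (rule cInf_lower[OF _ bb]) (use that in auto)
  have c: "cdf01 (Fn n)" for n using Fn(1) by (auto simp: truncated_def)
  have "\<exists>s. strict_mono (s::nat \<Rightarrow> nat) \<and> (\<exists>F. (\<forall>x. continuous (at_right x) F) \<and> mono F \<and> (\<forall>x. \<bar>F x\<bar> \<le> 1) \<and>
    (\<forall>x. continuous (at x) F \<longrightarrow> (\<lambda>n. Fn (s n) x) \<longlonglongrightarrow> F x))"
    by (rule Helly_selection) (use c cdf01_range[OF c] in \<open>auto simp: cdf01_def\<close>)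
  then obtain s F where s: "strict_mono (s::nat \<Rightarrow> nat)" and F: "\<And>x. continuous (at_right x) F" "mono F"
    and lim: "\<And>x. isCont F x \<Longrightarrow> (\<lambda>n. Fn (s n) x) \<longlonglongrightarrow> F x" by blast
  have T: "truncated F" by (rule cdf01_limit[OF Fn(1) F(2,1) lim])
  have "(\<lambda>n. rcost (Fn n)) \<longlonglongrightarrow> m"
  proof (rule tendsto_sandwich[where f="\<lambda>_. m" and h="\<lambda>n. m + 1 / real (Suc n)"])
    have "(\<lambda>n. m + 1 / real (Suc n)) \<longlonglongrightarrow> m + 0"
      by (intro tendsto_add tendsto_const LIMSEQ_Suc[OF lim_1_over_n])
    then show "(\<lambda>n. m + 1 / real (Suc n)) \<longlonglongrightarrow> m" by simp
  qed (use m Fn in \<open>auto intro!: always_eventually less_imp_le\<close>)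
  then have "(\<lambda>n. rcost (Fn (s n))) \<longlonglongrightarrow> m"
    using LIMSEQ_subseq_LIMSEQ[OF _ s] by (auto simp: o_def)
  then have "rcost F = m"
    using rcost_tendsto[OF Fn(1) T lim] LIMSEQ_unique by blast
  then have min: "cost k h F \<le> cost k h G" if "truncated G" for G
    using m[OF that] cost_rcost[OF T] cost_rcost[OF that] by simp
  have "cost k h F \<le> cost k h G" if G: "cdf01 G" for G
  proof (cases "truncated G")
    case False
    then obtain s where "q0 \<le> s" "G s \<noteq> 1" using G by (auto simp: truncated_def)
    from cost_trunc_less[OF G this] min[OF tr[OF G]] show ?thesis by simp
  qed (use min in auto)
  then show ?thesis using T by (auto simp: truncated_def)
qed

end

section \<open>Measures and their distribution functions\<close>

text \<open>Elements of \<^const>\<open>Pr01\<close> live on the subspace \<open>[0,1]\<close>; their image on the line has a distribution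
  function in the usual sense.\<close>

definition real_law :: "real measure \<Rightarrow> real measure" where
  "real_law \<mu> = distr \<mu> borel (\<lambda>x. x)"

lemma Pr01_facts:
  assumes "\<mu> \<in> Pr01"
  shows "prob_space \<mu>" "space \<mu> = {0..1}" "(\<lambda>x. x) \<in> measurable \<mu> borel"
    "real_distribution (real_law \<mu>)"
proof -
  have p: "prob_space \<mu>" and s: "sets \<mu> = sets (restrict_space borel {0..1})"
    using assms by (auto simp: Pr01_def)
  show "prob_space \<mu>" by (rule p)
  show "space \<mu> = {0..1}" using sets_eq_imp_space_eq[OF s] by (simp add: space_restrict_space)
  have "(\<lambda>x. x) \<in> measurable (restrict_space borel {0..1}) (borel :: real measure)"
    by (rule measurable_restrict_space1) simp
  then show m: "(\<lambda>x. x) \<in> measurable \<mu> borel"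
    using measurable_cong_sets[OF s refl] by blast
  show "real_distribution (real_law \<mu>)"
    unfolding real_law_def by (rule prob_space.real_distribution_distr[OF p m])
qed

lemma emeasure_real_law:
  assumes "\<mu> \<in> Pr01" "A \<in> sets borel"
  shows "emeasure (real_law \<mu>) A = emeasure \<mu> (A \<inter> {0..1})" "measure (real_law \<mu>) A = measure \<mu> (A \<inter> {0..1})"
  unfolding real_law_def using assms Pr01_facts(2,3)[OF assms(1)]
  by (auto simp: emeasure_distr measure_distr)

lemma cdf01_real_law:
  assumes "\<mu> \<in> Pr01" shows "cdf01 (cdf (real_law \<mu>))"
proof -
  interpret M: real_distribution "real_law \<mu>" by (rule Pr01_facts(4)[OF assms])
  interpret m: prob_space \<mu> by (rule Pr01_facts(1)[OF assms])
  have e: "cdf (real_law \<mu>) x = measure \<mu> ({..x} \<inter> {0..1})" for x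
    unfolding cdf_def by (rule emeasure_real_law[OF assms]) simp
  show ?thesis unfolding cdf01_def
  proof (intro conjI allI impI)
    show "mono (cdf (real_law \<mu>))" by (auto simp: mono_def M.cdf_nondecreasing)
    show "continuous (at_right x) (cdf (real_law \<mu>))" for x by (rule M.cdf_is_right_cont)
    show "cdf (real_law \<mu>) x = 0" if "x < 0" for x
    proof -
      have "{..x} \<inter> {0..1} = {}" using that by auto
      then show ?thesis by (simp add: e)
    qed
    show "cdf (real_law \<mu>) x = 1" if "1 \<le> x" for x
    proof -
      have "{..x} \<inter> {0..1} = space \<mu>" using that Pr01_facts(2)[OF assms] by auto
      then show ?thesis by (simp add: e m.prob_space)
    qed
  qed
qed

lemma phi_eq_Phi:
  assumes "\<mu> \<in> Pr01" "0 \<le> t" shows "phi \<mu> t = Phi (cdf (real_law \<mu>)) t"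
  unfolding phi_def Phi_def
proof (rule set_lebesgue_integral_cong)
  show "\<forall>s. s \<in> {t..1} \<longrightarrow> measure \<mu> {0..s} = cdf (real_law \<mu>) s"
  proof (intro allI impI)
    fix s assume "s \<in> {t..1}"
    then have "{..s} \<inter> {0..1} = {0..s}" using assms(2) by auto
    moreover have "cdf (real_law \<mu>) s = measure \<mu> ({..s} \<inter> {0..1})"
      unfolding cdf_def by (rule emeasure_real_law(2)[OF assms(1)]) simp
    ultimately show "measure \<mu> {0..s} = cdf (real_law \<mu>) s" by metis
  qed
qed simp

lemma CS_functional_eq_cost:
  assumes "\<mu> \<in> Pr01"
  shows "CS_functional \<xi> h \<mu> = cost (deriv (deriv \<xi>)) h (cdf (real_law \<mu>))"
proof -
  have "(LBINT s:{0..1}. deriv (deriv \<xi>) s * phi \<mu> s) =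
    (LBINT s:{0..1}. deriv (deriv \<xi>) s * Phi (cdf (real_law \<mu>)) s)"
    by (rule set_lebesgue_integral_cong) (use phi_eq_Phi[OF assms] in auto)
  moreover have "(\<integral>\<^sup>+ s\<in>{0..<1}. (1 / ennreal (phi \<mu> s) - 1 / ennreal (1 - s)) \<partial>lborel) =
    (\<integral>\<^sup>+ s\<in>{0..<1}. (1 / ennreal (Phi (cdf (real_law \<mu>)) s) - 1 / ennreal (1 - s)) \<partial>lborel)"
    by (rule nn_integral_cong) (use phi_eq_Phi[OF assms] in \<open>auto split: split_indicator\<close>)
  ultimately show ?thesis
    unfolding CS_functional_def cost_def using phi_eq_Phi[OF assms, of 0] by simp
qed

text \<open>The Stieltjes measure of \<open>F\<close> gives no mass to the complement of \<open>[0,1]\<close>, so restricting it to the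
  interval loses nothing.\<close>

lemma cdf01_imp_Pr01:
  assumes F: "cdf01 F"
  shows "\<exists>\<mu>\<in>Pr01. cdf (real_law \<mu>) = F"
proof -
  have mono: "\<And>x y. x \<le> y \<Longrightarrow> F x \<le> F y" and rc: "\<And>a. continuous (at_right a) F"
    using F unfolding cdf01_def mono_def by auto
  have "\<forall>\<^sub>F x in at_bot. 0 = F x"
    using eventually_le_at_bot[of "-1::real"] by eventually_elim (use F in \<open>auto simp: cdf01_def\<close>)
  then have bot: "(F \<longlongrightarrow> 0) at_bot" by (rule Lim_transform_eventually[OF tendsto_const])
  have "\<forall>\<^sub>F x in at_top. 1 = F x"
    using eventually_ge_at_top[of "1::real"] by eventually_elim (use F in \<open>auto simp: cdf01_def\<close>)
  then have top: "(F \<longlongrightarrow> 1) at_top" by (rule Lim_transform_eventually[OF tendsto_const])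
  define M where "M = interval_measure F"
  interpret M: real_distribution M
    unfolding M_def by (rule real_distribution_interval_measure[OF mono rc bot top])
  have c: "cdf M = F" unfolding M_def by (rule cdf_interval_measure[OF mono rc bot])
  have out: "M.prob {0..1} = 1"
  proof -
    have "M.prob {..<0} = 0"
    proof -
      have "(F \<longlongrightarrow> M.prob {..<0}) (at_left 0)" using M.cdf_at_left[of 0] c by simp
      moreover have "\<forall>\<^sub>F s in at_left 0. 0 = F s"
        unfolding eventually_at_left_field using F by (auto simp: cdf01_def intro!: exI[of _ "- 1"])
      then have "(F \<longlongrightarrow> 0) (at_left 0)" by (rule Lim_transform_eventually[OF tendsto_const])
      ultimately show ?thesis using tendsto_unique[of "at_left 0" F] by auto
    qed
    moreover have "M.prob {..1} = 1" using c F by (auto simp: cdf_def cdf01_def fun_eq_iff)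
    moreover have "{..1} = {..<0} \<union> {0..1::real}" by auto
    then have "M.prob {..1} = M.prob {..<0} + M.prob {0..1}" by (simp add: M.finite_measure_Union disjoint_iff)
    ultimately show ?thesis by simp
  qed
  define \<mu> where "\<mu> = restrict_space M {0..1}"
  have em: "emeasure \<mu> A = emeasure M A" if "A \<in> sets borel" "A \<subseteq> {0..1}" for A
    unfolding \<mu>_def by (rule emeasure_restrict_space) (use that in auto)
  have "prob_space \<mu>"
  proof
    show "emeasure \<mu> (space \<mu>) = 1"
      using em[of "{0..1}"] out by (simp add: \<mu>_def space_restrict_space M.emeasure_eq_measure)
  qed
  then have P: "\<mu> \<in> Pr01"
    unfolding Pr01_def \<mu>_def by (auto simp: sets_restrict_space)
  have "cdf (real_law \<mu>) x = F x" for x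
  proof -
    have "AE t in M. t \<in> {0..1}" using out by (simp add: M.prob_eq_1)
    then have "M.prob ({..x} \<inter> {0..1}) = M.prob {..x}"
      by (intro M.finite_measure_eq_AE) auto
    then show ?thesis
      unfolding c[symmetric] cdf_def using emeasure_real_law(2)[OF P, of "{..x}"] em[of "{..x} \<inter> {0..1}"]
      by (simp add: measure_def)
  qed
  then show ?thesis using P by (intro bexI[of _ \<mu>]) auto
qed

text \<open>Writing \<open>F s\<close> as the mass of \<open>{..s}\<close> and exchanging the integrals turns the left-hand side into the
  average over \<open>x\<close> of \<open>f q - f x\<close>. The indicator makes the mean independent of the values of \<open>f\<close>
  outside \<open>[0,q]\<close>.\<close>

lemma integral_cdf_by_parts:
  fixes f f' :: "real \<Rightarrow> real"
  assumes \<mu>: "\<mu> \<in> Pr01" and f: "abs_cont_on 0 q f f'" and q: "0 \<le> q"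
    and one: "cdf (real_law \<mu>) q = 1"
  shows "(LBINT s:{0..q}. f' s * cdf (real_law \<mu>) s) = f q - (LINT x|real_law \<mu>. indicator {0..q} x * f x)"
    and "integrable (real_law \<mu>) (\<lambda>x. indicator {0..q} x * f x)"
proof -
  interpret M: real_distribution "real_law \<mu>" by (rule Pr01_facts(4)[OF \<mu>])
  let ?M = "real_law \<mu>"
  define A where "A = (\<lambda>x. indicator {0..q} x :: real)"
  define B where "B = (\<lambda>t. indicator {0..q} t * f' t)"
  have iA: "integrable ?M A" unfolding A_def by (rule M.integrable_const_bound[of _ 1]) auto
  have iB: "integrable lborel B" using f unfolding B_def abs_cont_on_def set_integrable_def by simp
  define S where "S = {p::real\<times>real. fst p \<le> snd p}"
  have S[measurable]: "S \<in> sets (borel \<Otimes>\<^sub>M borel)"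
  proof -
    have "closed S" unfolding S_def by (intro closed_Collect_le continuous_intros)
    then show ?thesis by (subst borel_prod) (rule borel_closed)
  qed
  have neg: "measure ?M {..<0} = 0"
  proof -
    have "{..<0} \<inter> {0..1::real} = {}" by auto
    then show ?thesis by (simp add: emeasure_real_law(2)[OF \<mu>])
  qed
  have m0: "measure ?M ({0..q} \<inter> {..y}) = cdf ?M y" if "y \<in> {0..q}" for y
  proof -
    define C where "C = {0..q} \<inter> {..y}"
    have "{..y} = {..<0} \<union> C" "{..<0} \<inter> C = {}" "C \<in> sets borel" using that by (auto simp: C_def)
    then have "cdf ?M y = measure ?M {..<0} + measure ?M C"
      unfolding cdf_def using M.finite_measure_Union[of "{..<0}" C] by auto
    then show ?thesis using neg by (simp add: C_def)
  qed
  have "(\<integral>y. (\<integral>x. A x * B y * indicator S (x, y) \<partial>?M) \<partial>lborel) =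
         (\<integral>x. (\<integral>y. A x * B y * indicator S (x, y) \<partial>lborel) \<partial>?M)"
    by (rule integrable_triangle(2)[OF _ _ iA iB S]) (auto intro: M.sigma_finite_measure_axioms)
  also have "(\<lambda>y. \<integral>x. A x * B y * indicator S (x, y) \<partial>?M) = (\<lambda>y. indicator {0..q} y *\<^sub>R (f' y * cdf ?M y))"
  proof
    fix y
    have "(\<integral>x. A x * B y * indicator S (x, y) \<partial>?M) = (\<integral>x. B y * indicator ({0..q} \<inter> {..y}) x \<partial>?M)"
      by (rule Bochner_Integration.integral_cong) (auto simp: A_def S_def split: split_indicator)
    also have "\<dots> = B y * measure ?M ({0..q} \<inter> {..y})" by simp
    finally show "(\<integral>x. A x * B y * indicator S (x, y) \<partial>?M) = indicator {0..q} y *\<^sub>R (f' y * cdf ?M y)"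
      using m0[of y] by (auto simp: B_def split: split_indicator)
  qed
  also have "(\<lambda>x. \<integral>y. A x * B y * indicator S (x, y) \<partial>lborel) = (\<lambda>x. f q * A x - A x * f x)"
  proof
    fix x
    have "(\<integral>y. A x * B y * indicator S (x, y) \<partial>lborel) = A x * (LBINT y:{x..q}. f' y)"
      unfolding set_lebesgue_integral_def Bochner_Integration.integral_mult_right_zero[symmetric]
      by (rule Bochner_Integration.integral_cong) (auto simp: A_def B_def S_def split: split_indicator)
    also have "\<dots> = f q * A x - A x * f x"
      using abs_cont_on_integral[OF f, of x q] by (auto simp: A_def split: split_indicator)
    finally show "(\<integral>y. A x * B y * indicator S (x, y) \<partial>lborel) = f q * A x - A x * f x" .
  qed
  finally have eq: "(LBINT s:{0..q}. f' s * cdf ?M s) = (\<integral>x. f q * A x - A x * f x \<partial>?M)"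
    unfolding set_lebesgue_integral_def .
  have "set_borel_measurable lborel {0..q} f"
    using borel_integrable_atLeastAtMost'[OF abs_cont_on_continuous[OF f]]
    unfolding set_integrable_def set_borel_measurable_def by (rule borel_measurable_integrable)
  then have [measurable]: "(\<lambda>x. A x * f x) \<in> borel_measurable borel"
    unfolding set_borel_measurable_def A_def by simp
  have "bounded (f ` {0..q})"
    by (rule compact_imp_bounded[OF compact_continuous_image[OF abs_cont_on_continuous[OF f] compact_Icc]])
  then obtain b where b: "\<forall>y\<in>f ` {0..q}. norm y \<le> b" unfolding bounded_iff by blast
  have b0: "0 \<le> b" using b q by (force intro: order_trans[OF norm_ge_zero])
  have i: "integrable ?M (\<lambda>x. A x * f x)"
  proof (rule M.integrable_const_bound[of _ b])
    show "AE x in ?M. norm (A x * f x) \<le> b"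
      using b b0 by (auto simp: A_def split: split_indicator)
  qed simp
  then show "integrable (real_law \<mu>) (\<lambda>x. indicator {0..q} x * f x)" by (simp add: A_def)
  have "(\<integral>x. A x \<partial>?M) = 1"
    using m0[of q] q one by (simp add: A_def Int_absorb2)
  then show "(LBINT s:{0..q}. f' s * cdf ?M s) = f q - (\<integral>x. indicator {0..q} x * f x \<partial>?M)"
    unfolding eq using iA i by (simp add: A_def)
qed

section \<open>The first variation at a minimizer\<close>

lemma LBINT_point: "(LBINT t:{a..a::real}. f t) = (0::real)"
  unfolding set_lebesgue_integral_def
  by (intro integral_eq_zero_AE) (use AE_lborel_singleton[of a] in \<open>auto elim!: eventually_mono\<close>)

lemma integral_has_derivative_01:
  fixes f g :: "real \<Rightarrow> real"
  assumes g: "continuous_on {0..<1} g" and f: "\<And>x. x \<in> {0..<1} \<Longrightarrow> f x = c + (LBINT t:{0..x}. g t)"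
    and s: "s \<in> {0..<1}"
  shows "(f has_real_derivative g s) (at s within {0..<1})"
proof -
  define q where "q = (s + 1) / 2"
  have q: "s < q" "q < 1" "0 \<le> s" using s by (auto simp: q_def)
  have gq: "continuous_on {0..q} g" by (rule continuous_on_subset[OF g]) (use q in auto)
  have eq: "f x = c + integral {0..x} g" if "x \<in> {0..q}" for x
  proof -
    have "set_integrable lborel {0..x} g"
      by (rule borel_integrable_atLeastAtMost') (rule continuous_on_subset[OF gq], use that in auto)
    then show ?thesis using f[of x] set_borel_integral_eq_integral(2) that q by auto
  qed
  have "((\<lambda>x. c + integral {0..x} g) has_real_derivative 0 + g s) (at s within {0..q})"
    by (intro derivative_intros integral_has_real_derivative[OF gq]) (use q in auto)
  then have "(f has_real_derivative g s) (at s within {0..q})"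
    using has_field_derivative_transform_within[of "\<lambda>x. c + integral {0..x} g" "g s" s "{0..q}" 1 f] eq q by auto
  moreover have "at s within {0..<1} = at s within {0..q}"
    by (rule at_within_nhd[of _ "{..<q}"]) (use q in auto)
  ultimately show ?thesis by simp
qed

lemma integral_abs_cont_on_01:
  fixes f g :: "real \<Rightarrow> real"
  assumes g: "continuous_on {0..<1} g" and f: "\<And>x. x \<in> {0..<1} \<Longrightarrow> f x = c + (LBINT t:{0..x}. g t)"
    and q: "q < 1"
  shows "abs_cont_on 0 q f g"
proof (rule abs_cont_onI)
  show "set_integrable lborel {0..q} g"
    by (rule borel_integrable_atLeastAtMost', rule continuous_on_subset[OF g]) (use q in auto)
  show "f x = c + (LBINT t:{0..x}. g t)" if "x \<in> {0..q}" for x using f[of x] that q by auto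
qed

locale CS_minimizer = CS_setting +
  fixes \<mu> :: "real measure"
  assumes mu: "\<mu> \<in> Pr01"
    and min: "\<And>G. cdf01 G \<Longrightarrow> cost k h (cdf (real_law \<mu>)) \<le> cost k h G"
begin

abbreviation M :: "real measure" where "M \<equiv> real_law \<mu>"
abbreviation F :: "real \<Rightarrow> real" where "F \<equiv> cdf M"
abbreviation \<phi> :: "real \<Rightarrow> real" where "\<phi> \<equiv> Phi F"

lemma F: "cdf01 F" "\<forall>s\<ge>q0. F s = 1"
  using minimizer_truncated[OF cdf01_real_law[OF mu] min] unfolding truncated_def by auto

lemma phi_pos: "s < 1 \<Longrightarrow> 0 < \<phi> s"
  by (rule Phi_pos_of_one[OF F]) (use q0 in auto)

lemma phi_le: "s \<le> 1 \<Longrightarrow> \<phi> s \<le> 1 - s"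
  using Phi_bounds(2)[OF F(1)] .

lemma phi_eq: "q0 \<le> s \<Longrightarrow> s \<le> 1 \<Longrightarrow> \<phi> s = 1 - s"
  by (rule Phi_eq_of_one[OF F])

lemma phi_ge: assumes "0 \<le> s" "s < 1" shows "(1 - q0) * (1 - s) \<le> \<phi> s"
proof (cases "s \<le> q0")
  case True
  have "(1 - q0) * (1 - s) \<le> (1 - q0) * 1" using assms q0 by (intro mult_left_mono) auto
  then show ?thesis using Phi_lower[OF F True less_imp_le[OF q0(2)]] by (metis mult.right_neutral order_trans)
next
  case False
  then show ?thesis using phi_eq[of s] assms q0 mult_right_mono[of "1 - q0" 1 "1 - s"] by simp
qed

text \<open>The second derivative of the dual optimizer.\<close>

definition curv :: "real \<Rightarrow> real" where "curv s = 1 / (\<phi> s)\<^sup>2"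

lemma curv_pos: "s < 1 \<Longrightarrow> 0 < curv s"
  using phi_pos[of s] by (simp add: curv_def)

lemma curv_lower: "s < 1 \<Longrightarrow> 1 / (1 - s)\<^sup>2 \<le> curv s"
  unfolding curv_def using phi_pos[of s] phi_le[of s]
  by (intro divide_left_mono power_mono mult_pos_pos zero_less_power) auto

lemma curv_upper: assumes "0 \<le> s" "s < 1" shows "curv s \<le> (1 / (1 - q0))\<^sup>2 / (1 - s)\<^sup>2"
proof -
  have "((1 - q0) * (1 - s))\<^sup>2 \<le> (\<phi> s)\<^sup>2"
    using phi_ge[OF assms] q0 assms by (intro power_mono) auto
  moreover have "0 < ((1 - q0) * (1 - s))\<^sup>2" using q0 assms by simp
  ultimately have "curv s \<le> 1 / ((1 - q0) * (1 - s))\<^sup>2"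
    unfolding curv_def using phi_pos[of s] assms by (intro divide_left_mono mult_pos_pos) auto
  also have "\<dots> = (1 / (1 - q0))\<^sup>2 / (1 - s)\<^sup>2" by (simp add: power_mult_distrib power_divide)
  finally show ?thesis .
qed

lemma curv_eq: "q0 \<le> s \<Longrightarrow> s < 1 \<Longrightarrow> curv s = 1 / (1 - s)\<^sup>2"
  by (simp add: curv_def phi_eq)

lemma curv_continuous: "continuous_on {0..<1} curv"
  unfolding curv_def[abs_def]
  by (intro continuous_intros continuous_on_subset[OF Phi_continuous[OF F(1), of 0]])
    (use phi_pos in \<open>auto simp: less_le\<close>)

lemma curv_bounded: assumes "q < 1" shows "\<exists>B. \<forall>s\<in>{0..q}. \<bar>curv s\<bar> \<le> B"
proof -
  have "continuous_on {0..q} curv" by (rule continuous_on_subset[OF curv_continuous]) (use assms in auto)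
  then have "bounded (curv ` {0..q})" by (intro compact_imp_bounded compact_continuous_image compact_Icc)
  then show ?thesis unfolding bounded_iff by auto
qed

definition eta1 :: "real \<Rightarrow> real" where "eta1 s = - h\<^sup>2 + (LBINT t:{0..s}. curv t)"

lemma eta1_abs_cont_on: "q < 1 \<Longrightarrow> abs_cont_on 0 q eta1 curv"
  by (rule integral_abs_cont_on_01[OF curv_continuous]) (auto simp: eta1_def)

lemma eta1_derivative: "s \<in> {0..<1} \<Longrightarrow> (eta1 has_real_derivative curv s) (at s within {0..<1})"
  by (rule integral_has_derivative_01[OF curv_continuous eta1_def])

lemma eta1_0: "eta1 0 = - h\<^sup>2" by (simp add: eta1_def LBINT_point del: atLeastAtMost_singleton)

lemma eta1_continuous: "continuous_on {0..<1} eta1"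
  using eta1_derivative by (rule DERIV_continuous_on)

definition eta_base :: "real \<Rightarrow> real" where "eta_base s = (LBINT t:{0..s}. eta1 t)"

text \<open>The integral of \<open>f\<close> against \<open>\<mu>\<close>; the cut-off at \<open>q0\<close> removes a null set and spares any assumption
  on the behaviour of \<open>f\<close> near \<open>1\<close>.\<close>

definition mean :: "(real \<Rightarrow> real) \<Rightarrow> real" where "mean f = (LINT x|M. indicator {0..q0} x * f x)"

text \<open>The additive constant is the one for which \<open>eta0 - \<xi>\<close> has mean zero under \<open>\<mu>\<close>.\<close>

definition eta0 :: "real \<Rightarrow> real" where
  "eta0 s = (mean \<xi> - mean eta_base) + (LBINT t:{0..s}. eta1 t)"

lemma eta0_derivative: "s \<in> {0..<1} \<Longrightarrow> (eta0 has_real_derivative eta1 s) (at s within {0..<1})"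
  by (rule integral_has_derivative_01[OF eta1_continuous eta0_def])

lemma eta0_abs_cont_on: "q < 1 \<Longrightarrow> abs_cont_on 0 q eta0 eta1"
  by (rule integral_abs_cont_on_01[OF eta1_continuous eta0_def])

lemma eta_base_abs_cont_on: "q < 1 \<Longrightarrow> abs_cont_on 0 q eta_base eta1"
  by (rule integral_abs_cont_on_01[OF eta1_continuous, of _ 0]) (auto simp: eta_base_def)

lemma xi_abs_cont_on: "abs_cont_on 0 1 \<xi> (deriv \<xi>)"
  by (rule abs_cont_on_C1[OF _ abs_cont_on_continuous[OF xi1_abs_cont_on]])
    (use xi_deriv in \<open>blast intro: has_field_derivative_at_within\<close>)

lemma M_real_distribution: "real_distribution M" by (rule Pr01_facts(4)[OF mu])

lemma mean_integrable:
  assumes "abs_cont_on 0 q0 f f'" shows "integrable M (\<lambda>x. indicator {0..q0} x * f x)"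
  by (rule integral_cdf_by_parts(2)[OF mu assms]) (use F q0 in auto)

lemma mean_diff:
  assumes "abs_cont_on 0 q0 f f'" "abs_cont_on 0 q0 g g'"
  shows "mean (\<lambda>x. f x - g x) = mean f - mean g"
  unfolding mean_def right_diff_distrib
  by (rule Bochner_Integration.integral_diff[OF mean_integrable[OF assms(1)] mean_integrable[OF assms(2)]])

lemma AE_M: "AE x in M. x \<in> {0..q0}"
proof -
  interpret M: real_distribution M by (rule M_real_distribution)
  have 1: "AE x in M. x \<in> {..q0}"
    using F q0 by (intro M.AE_prob_1) (auto simp: cdf_def)
  have "{..<0} \<inter> {0..1::real} = {}" by auto
  then have "measure M {..<0} = 0" by (simp add: emeasure_real_law(2)[OF mu])
  then have "AE x in M. x \<notin> {..<0}" by (simp add: M.prob_eq_0)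
  with 1 show ?thesis by eventually_elim auto
qed

lemma mean_const: "mean (\<lambda>_. c) = c"
proof -
  interpret M: real_distribution M by (rule M_real_distribution)
  have "mean (\<lambda>_. c) = (\<integral>x. c \<partial>M)"
    unfolding mean_def
  proof (rule integral_cong_AE)
    show "AE x in M. indicat_real {0..q0} x * c = c" using AE_M by eventually_elim simp
  qed auto
  then show ?thesis using M.prob_space by simp
qed

definition u :: "real \<Rightarrow> real" where "u s = eta0 s - \<xi> s"
definition u1 :: "real \<Rightarrow> real" where "u1 s = eta1 s - deriv \<xi> s"

lemma u_abs_cont_on: "q < 1 \<Longrightarrow> abs_cont_on 0 q u u1"
  unfolding u_def[abs_def] u1_def[abs_def]
  by (intro abs_cont_on_diff eta0_abs_cont_on abs_cont_on_subset[OF xi_abs_cont_on]) auto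

lemma u1_abs_cont_on: "q < 1 \<Longrightarrow> abs_cont_on 0 q u1 (\<lambda>s. curv s - k s)"
  unfolding u1_def[abs_def]
  by (intro abs_cont_on_diff eta1_abs_cont_on abs_cont_on_subset[OF xi1_abs_cont_on]) auto

lemma u1_0: "u1 0 = - h\<^sup>2" by (simp add: u1_def eta1_0 xi_deriv_0)

lemma mean_u: "mean u = 0"
proof -
  have e: "eta0 = (\<lambda>s. (mean \<xi> - mean eta_base) + eta_base s)"
    by (simp add: eta0_def eta_base_def fun_eq_iff)
  have b: "abs_cont_on 0 q0 eta_base eta1" "abs_cont_on 0 q0 \<xi> (deriv \<xi>)"
    using eta_base_abs_cont_on q0 abs_cont_on_subset[OF xi_abs_cont_on, of 0 q0] by auto
  have "u = (\<lambda>s. (mean \<xi> - mean eta_base) - (\<xi> s - eta_base s))" by (auto simp: u_def e)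
  then have "mean u = mean (\<lambda>_. mean \<xi> - mean eta_base) - mean (\<lambda>s. \<xi> s - eta_base s)"
    using mean_diff[OF abs_cont_on_const abs_cont_on_diff[OF b(2,1)]] by simp
  then show ?thesis using mean_diff[OF b(2,1)] by (simp add: mean_const)
qed

text \<open>Minimality is compared along the segment from \<open>F\<close> to \<open>G\<close>, where \<^const>\<open>Phi\<close> is affine. On \<open>[0,q]\<close> all
  values of \<^const>\<open>Phi\<close> are at least \<open>1 - q\<close>, so the second-order remainder of \<open>1/\<phi>\<close> is at most
  \<open>\<theta>^2/(1 - q)^3\<close>; dividing by \<open>\<theta>\<close> and letting \<open>\<theta>\<close> tend to zero leaves the linear term.\<close>

lemma first_variation:
  assumes G: "cdf01 G" "\<forall>s\<ge>q. G s = 1" and q: "q0 \<le> q" "q < 1"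
  shows "0 \<le> (LBINT s:{0..1}. k s * (Phi G s - \<phi> s)) - (LBINT s:{0..q}. (Phi G s - \<phi> s) * curv s)
     + h\<^sup>2 * (Phi G 0 - \<phi> 0)"
proof -
  define \<psi> where "\<psi> = (\<lambda>s. Phi G s - \<phi> s)"
  have q': "0 \<le> q" using q q0 by auto
  have Fq: "\<forall>s\<ge>q. F s = 1" using F(2) q by auto
  define A where "A = (LBINT s:{0..1}. k s * \<psi> s) - (LBINT s:{0..q}. \<psi> s * curv s) + h\<^sup>2 * \<psi> 0"
  define K where "K = 1 / (1 - q) ^ 3"
  have K: "0 < K" using q by (simp add: K_def)
  have c\<psi>: "continuous_on {0..1} \<psi>" unfolding \<psi>_def
    by (intro continuous_intros Phi_continuous F G)
  have ik: "set_integrable lborel {0..1} (\<lambda>s. k s * \<psi> s)"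
    by (intro borel_integrable_atLeastAtMost' continuous_intros xi2_cont c\<psi>)
  have ic: "set_integrable lborel {0..q} (\<lambda>s. \<psi> s * curv s)"
    by (intro borel_integrable_atLeastAtMost' continuous_intros continuous_on_subset[OF c\<psi>]
      continuous_on_subset[OF curv_continuous]) (use q in auto)
  have *: "0 \<le> \<theta> * A + \<theta>\<^sup>2 * K * q" if \<theta>: "0 < \<theta>" "\<theta> \<le> 1" for \<theta>
  proof -
    define H where "H = (\<lambda>s. (1 - \<theta>) * F s + \<theta> * G s)"
    have H: "cdf01 H" "\<forall>s\<ge>q. H s = 1"
      unfolding H_def using cdf01_convex[OF F(1) G(1)] \<theta> Fq G(2) by auto
    have PH: "Phi H s = \<phi> s + \<theta> * \<psi> s" for s
      unfolding H_def Phi_convex[OF F(1) G(1)] by (simp add: \<psi>_def algebra_simps)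
    have "cost k h F \<le> cost k h H" by (rule min[OF H(1)])
    then have "(LBINT s:{0..1}. k s * \<phi> s) + (LBINT s:{0..q}. excess F s) + h\<^sup>2 * \<phi> 0
        \<le> (LBINT s:{0..1}. k s * Phi H s) + (LBINT s:{0..q}. excess H s) + h\<^sup>2 * Phi H 0"
      unfolding cost_truncated[OF F(1) Fq q' q(2)] cost_truncated[OF H q' q(2)] by simp
    moreover have "(LBINT s:{0..1}. k s * Phi H s) = (LBINT s:{0..1}. k s * \<phi> s) + \<theta> * (LBINT s:{0..1}. k s * \<psi> s)"
    proof -
      have "(LBINT s:{0..1}. k s * Phi H s) = (LBINT s:{0..1}. k s * \<phi> s + \<theta> * (k s * \<psi> s))"
        unfolding PH by (simp add: algebra_simps)
      then show ?thesis using k_Phi_integrable[OF F(1)] ik by simp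
    qed
    moreover have "(LBINT s:{0..q}. excess H s) \<le> (LBINT s:{0..q}. excess F s) - \<theta> * (LBINT s:{0..q}. \<psi> s * curv s) + \<theta>\<^sup>2 * K * q"
    proof -
      have "(LBINT s:{0..q}. excess H s) \<le> (LBINT s:{0..q}. excess F s - \<theta> * (\<psi> s * curv s) + \<theta>\<^sup>2 * K)"
      proof (rule set_integral_mono)
        show "set_integrable lborel {0..q} (excess H)" by (rule excess_truncated(3)[OF H q' q(2)])
        show "set_integrable lborel {0..q} (\<lambda>s. excess F s - \<theta> * (\<psi> s * curv s) + \<theta>\<^sup>2 * K)"
          using excess_truncated(3)[OF F(1) Fq q' q(2)] ic borel_integrable_atLeastAtMost'[of 0 q "\<lambda>_. \<theta>\<^sup>2 * K"] by simp
        fix s assume s: "s \<in> {0..q}"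
        define a b where "a = \<phi> s" and "b = Phi H s"
        have ab: "1 - q \<le> a" "1 - q \<le> b" "b = a + \<theta> * \<psi> s"
          using Phi_lower[OF F(1) Fq] Phi_lower[OF H] s q PH by (auto simp: a_def b_def)
        have pos: "0 < a" "0 < b" using ab q by auto
        have "1 / b - 1 / a = - ((b - a) * (1 / a\<^sup>2)) + (b - a)\<^sup>2 * (1 / (a\<^sup>2 * b))"
          using pos by (simp add: field_simps power2_eq_square)
        also have "b - a = \<theta> * \<psi> s" using ab(3) by simp
        finally have "1 / b - 1 / a = - (\<theta> * (\<psi> s * (1 / a\<^sup>2))) + \<theta>\<^sup>2 * ((\<psi> s)\<^sup>2 * (1 / (a\<^sup>2 * b)))"
          by (simp add: power_mult_distrib)
        moreover have "(\<psi> s)\<^sup>2 * (1 / (a\<^sup>2 * b)) \<le> 1 * K"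
        proof (rule mult_mono)
          have "\<bar>\<psi> s\<bar> \<le> 1" using Phi_bounds[OF F(1), of s] Phi_bounds[OF G(1), of s] s q by (auto simp: \<psi>_def)
          then show "(\<psi> s)\<^sup>2 \<le> 1" by (simp add: abs_square_le_1)
          have "(1 - q) ^ 3 \<le> a\<^sup>2 * b"
            unfolding power3_eq_cube power2_eq_square by (intro mult_mono ab) (use q pos in auto)
          then show "1 / (a\<^sup>2 * b) \<le> K" unfolding K_def using q pos by (intro divide_left_mono) auto
        qed (use pos in auto)
        then have "\<theta>\<^sup>2 * ((\<psi> s)\<^sup>2 * (1 / (a\<^sup>2 * b))) \<le> \<theta>\<^sup>2 * K" by (intro mult_left_mono) auto
        ultimately show "excess H s \<le> excess F s - \<theta> * (\<psi> s * curv s) + \<theta>\<^sup>2 * K"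
          unfolding excess_def curv_def a_def[symmetric] b_def[symmetric] by linarith
      qed
      also have "\<dots> = (LBINT s:{0..q}. excess F s) - \<theta> * (LBINT s:{0..q}. \<psi> s * curv s) + \<theta>\<^sup>2 * K * q"
        using excess_truncated(3)[OF F(1) Fq q' q(2)] ic borel_integrable_atLeastAtMost'[of 0 q "\<lambda>_. \<theta>\<^sup>2 * K"] q'
        by (simp add: set_integral_const)
      finally show ?thesis .
    qed
    ultimately show ?thesis unfolding A_def PH by (simp add: algebra_simps)
  qed
  have "0 \<le> A"
  proof (rule ccontr)
    assume "\<not> 0 \<le> A"
    then have A: "A < 0" by simp
    \<comment> \<open>So small that the remainder cannot compensate half of the negative linear term.\<close>
    define \<theta> where "\<theta> = Min {1, - A / (2 * (K * q + 1))}"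
    have Kq: "0 \<le> K * q" using K q' by simp
    then have p: "0 < - A / (2 * (K * q + 1))" using A by (intro divide_pos_pos) (simp_all add: add_nonneg_pos)
    then have \<theta>: "0 < \<theta>" "\<theta> \<le> 1" "\<theta> \<le> - A / (2 * (K * q + 1))" unfolding \<theta>_def by auto
    have "\<theta> * (K * q + 1) \<le> - A / (2 * (K * q + 1)) * (K * q + 1)" using \<theta>(3) Kq by (intro mult_right_mono) auto
    also have "\<dots> = - A / 2" using Kq by (simp add: field_simps)
    finally have "\<theta> * (K * q + 1) \<le> - A / 2" .
    then have "A + \<theta> * (K * q) < 0" using A \<theta>(1) by (simp add: algebra_simps)
    then have "\<theta> * (A + \<theta> * (K * q)) < 0" using \<theta>(1) by (rule mult_pos_neg[rotated])
    then show False using *[OF \<theta>(1,2)] by (simp add: algebra_simps power2_eq_square)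
  qed
  then show ?thesis by (simp add: A_def \<psi>_def)
qed

text \<open>With the Dirac mass at \<open>x\<close> as competitor, two integrations by parts turn the first variation into
  \<open>u x\<close> minus the mean of \<open>u\<close>, and the latter is zero by the choice of the constant in \<^term>\<open>eta0\<close>.\<close>

lemma u_nonneg: assumes x: "x \<in> {0..<1}" shows "0 \<le> u x"
proof -
  \<comment> \<open>Both \<open>\<mu>\<close> and the Dirac mass at \<open>x\<close> live on \<open>[0,q]\<close>, so the variation of \<open>Phi\<close> vanishes beyond \<open>q\<close>.\<close>
  define q where "q = max q0 x"
  define G where "G = step x"
  have q: "q0 \<le> q" "q < 1" "x \<le> q" "0 \<le> q" "0 \<le> x" using x q0 by (auto simp: q_def)
  have G: "cdf01 G" "\<forall>s\<ge>q. G s = 1"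
    using cdf01_step[of x] x q by (auto simp: G_def step_def)
  have Fq: "\<forall>s\<ge>q. F s = 1" using F(2) q by auto
  define \<psi> where "\<psi> = (\<lambda>s. Phi G s - \<phi> s)"
  have acpsi: "abs_cont_on 0 q \<psi> (\<lambda>s. F s - G s)"
  proof -
    have "abs_cont_on 0 q \<psi> (\<lambda>s. - G s - - F s)"
      unfolding \<psi>_def by (intro abs_cont_on_diff Phi_abs_cont_on F G) (use q in auto)
    then show ?thesis by simp
  qed
  have z: "\<psi> s = 0" if "q \<le> s" "s \<le> 1" for s
    using Phi_eq_of_one[OF G that] Phi_eq_of_one[OF F(1) Fq that] by (simp add: \<psi>_def)
  have 1: "0 \<le> (LBINT s:{0..1}. k s * \<psi> s) - (LBINT s:{0..q}. \<psi> s * curv s) + h\<^sup>2 * \<psi> 0"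
    using first_variation[OF G q(1,2)] by (simp add: \<psi>_def)
  have 2: "(LBINT s:{0..1}. k s * \<psi> s) = (LBINT s:{0..q}. k s * \<psi> s)"
    by (rule set_integral_restrict_support) (use z q in auto)
  have ac1: "abs_cont_on 0 q u1 (\<lambda>s. curv s - k s)" by (rule u1_abs_cont_on[OF q(2)])
  have cpsi: "continuous_on {0..q} \<psi>" by (rule abs_cont_on_continuous[OF acpsi])
  have cu1: "continuous_on {0..q} u1" by (rule abs_cont_on_continuous[OF ac1])
  have kq: "continuous_on {0..q} k" by (rule continuous_on_subset[OF xi2_cont]) (use q in auto)
  have cq: "continuous_on {0..q} curv" by (rule continuous_on_subset[OF curv_continuous]) (use q in auto)
  have i1: "set_integrable lborel {0..q} (\<lambda>s. k s * \<psi> s)"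
    by (intro borel_integrable_atLeastAtMost' continuous_intros kq cpsi)
  have i2: "set_integrable lborel {0..q} (\<lambda>s. \<psi> s * curv s)"
    by (intro borel_integrable_atLeastAtMost' continuous_intros cq cpsi)
  have i3: "set_integrable lborel {0..q} (\<lambda>s. u1 s * F s)" "set_integrable lborel {0..q} (\<lambda>s. u1 s * G s)"
    using set_integrable_mult_continuous[OF cdf01_integrable[OF F(1)] cu1]
      set_integrable_mult_continuous[OF cdf01_integrable[OF G(1)] cu1] by (simp_all add: mult.commute)
  have "(LBINT t:{0..q}. (curv t - k t) * \<psi> t + u1 t * (F t - G t)) = u1 q * \<psi> q - u1 0 * \<psi> 0"
    by (rule integral_product_by_parts[OF ac1 acpsi q(4)])
  also have "\<dots> = h\<^sup>2 * \<psi> 0" using z[of q] q u1_0 by simp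
  also have "(LBINT t:{0..q}. (curv t - k t) * \<psi> t + u1 t * (F t - G t)) =
      (LBINT t:{0..q}. (\<psi> t * curv t - k t * \<psi> t) + (u1 t * F t - u1 t * G t))"
    by (simp add: algebra_simps)
  also have "\<dots> = (LBINT s:{0..q}. \<psi> s * curv s) - (LBINT s:{0..q}. k s * \<psi> s) +
      ((LBINT s:{0..q}. u1 s * F s) - (LBINT s:{0..q}. u1 s * G s))"
    using i1 i2 i3 by simp
  finally have 3: "0 \<le> (LBINT s:{0..q}. u1 s * F s) - (LBINT s:{0..q}. u1 s * G s)"
    using 1 2 by simp
  have acu: "abs_cont_on 0 q u u1" by (rule u_abs_cont_on[OF q(2)])
  have "(LBINT s:{0..q}. u1 s * G s) = (LBINT s:{x..q}. u1 s)"
    unfolding set_lebesgue_integral_def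
    by (rule Bochner_Integration.integral_cong) (use q in \<open>auto simp: G_def step_def split: split_indicator\<close>)
  also have "\<dots> = u q - u x" by (rule abs_cont_on_integral[OF acu]) (use q in auto)
  finally have 4: "(LBINT s:{0..q}. u1 s * G s) = u q - u x" .
  have "(LINT x|M. indicator {0..q} x * u x) = mean u"
    unfolding mean_def
  proof (rule integral_cong_AE)
    show "AE x in M. indicat_real {0..q} x * u x = indicat_real {0..q0} x * u x"
      using AE_M by eventually_elim (use q in auto)
    show "(\<lambda>x. indicat_real {0..q} x * u x) \<in> borel_measurable M"
      by (rule borel_measurable_integrable, rule integral_cdf_by_parts(2)[OF mu acu q(4)]) (use Fq in auto)
    show "(\<lambda>x. indicat_real {0..q0} x * u x) \<in> borel_measurable M"
      by (rule borel_measurable_integrable, rule mean_integrable[OF u_abs_cont_on[OF q0(2)]])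
  qed
  then have "(LBINT s:{0..q}. u1 s * F s) = u q"
    using integral_cdf_by_parts(1)[OF mu acu q(4)] Fq mean_u by simp
  then show ?thesis using 3 4 by simp
qed

lemma AE_u_zero: "AE x in M. u x = 0"
proof -
  have "AE x in M. indicator {0..q0} x * u x = 0"
  proof (subst integral_nonneg_eq_0_iff_AE[symmetric])
    show "integrable M (\<lambda>x. indicat_real {0..q0} x * u x)"
      by (rule mean_integrable[OF u_abs_cont_on[OF q0(2)]])
    show "AE x in M. 0 \<le> indicat_real {0..q0} x * u x"
      using u_nonneg q0 by (auto intro!: AE_I2 split: split_indicator)
    show "(LINT x|M. indicat_real {0..q0} x * u x) = 0" using mean_u by (simp add: mean_def)
  qed
  then show ?thesis using AE_M by eventually_elim auto
qed

lemma support_subset: "measure_support \<mu> \<subseteq> {s \<in> {0..<1}. u s = 0}"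
proof
  fix x assume x: "x \<in> measure_support \<mu>"
  then have sp: "x \<in> {0..1}" and pos: "\<And>U. open U \<Longrightarrow> x \<in> U \<Longrightarrow> 0 < emeasure M U"
    using emeasure_real_law(1)[OF mu] Pr01_facts(2)[OF mu] by (auto simp: measure_support_def)
  have ae: "AE y in M. y \<in> {0..q0} \<and> u y = 0" using AE_M AE_u_zero by eventually_elim auto
  have ex: "\<exists>y\<in>U. y \<in> {0..q0} \<and> u y = 0" if U: "open U" "x \<in> U" for U
  proof (rule ccontr)
    assume "\<not> ?thesis"
    then have no: "y \<notin> U" if "y \<in> {0..q0} \<and> u y = 0" for y using that by blast
    have "AE y in M. y \<notin> U" using ae by (rule eventually_mono) (rule no)
    moreover have "U \<in> sets M" using U by (auto simp: real_law_def)
    ultimately have "emeasure M U = 0" by (simp add: AE_iff_measurable[of U M "\<lambda>y. y \<notin> U"] real_law_def)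
    then show False using pos[OF U] by simp
  qed
  have "x \<in> closure {y \<in> {0..q0}. u y = 0}"
    unfolding closure_iff_nhds_not_empty using ex by blast
  moreover have "closed {y \<in> {0..q0}. u y = 0}"
    by (rule continuous_closed_preimage_constant[OF abs_cont_on_continuous[OF u_abs_cont_on[OF q0(2)]]]) simp
  ultimately have "x \<in> {y \<in> {0..q0}. u y = 0}" by (simp add: closure_closed)
  then show "x \<in> {s \<in> {0..<1}. u s = 0}" using q0 by auto
qed

end

section \<open>Duality and uniqueness of the dual optimizer\<close>

lemma abs_cont_on_measurable_01:
  assumes "\<And>q. q < 1 \<Longrightarrow> abs_cont_on 0 q f g"
  shows "g \<in> borel_measurable (restrict_space borel {0..<1})"
  unfolding measurable_01_iff[symmetric]
proof (rule borel_measurable_LIMSEQ_real)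
  fix s
  show "(\<lambda>n. indicator {0..1 - 1 / real (Suc n)} s * g s) \<longlonglongrightarrow> indicator {0..<1} s * g s"
  proof (cases "s \<in> {0..<1}")
    case True
    then obtain N where N: "1 / real (Suc N) < 1 - s" using nat_approx_posE[of "1 - s"] by auto
    have "\<forall>\<^sub>F n in sequentially. indicator {0..<1} s * g s = indicator {0..1 - 1 / real (Suc n)} s * g s"
    proof (rule eventually_sequentiallyI[of N])
      fix n assume "N \<le> n"
      then have "1 / real (Suc n) \<le> 1 / real (Suc N)" by (intro divide_left_mono) auto
      then have "s \<le> 1 - 1 / real (Suc n)" using N by linarith
      then show "indicator {0..<1} s * g s = indicator {0..1 - 1 / real (Suc n)} s * g s" using True by simp
    qed
    then show ?thesis by (rule Lim_transform_eventually[OF tendsto_const])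
  next
    case False
    then have "s \<notin> {0..1 - 1 / real (Suc n)}" for n
    proof -
      have "0 < 1 / real (Suc n)" by simp
      moreover have "s < 0 \<or> 1 \<le> s" using False by auto
      ultimately show ?thesis unfolding atLeastAtMost_iff by linarith
    qed
    then show ?thesis using False by simp
  qed
next
  fix n
  show "(\<lambda>s. indicator {0..1 - 1 / real (Suc n)} s * g s) \<in> borel_measurable borel"
    using abs_cont_on_integrable[OF assms[of "1 - 1 / real (Suc n)"]]
    unfolding set_integrable_def by (auto dest: borel_measurable_integrable)
qed

context CS_minimizer
begin

lemma deriv01_eta0: "s \<in> {0..<1} \<Longrightarrow> deriv01 eta0 s = eta1 s"
  by (rule deriv01_eqI[OF eta0_derivative])

lemma eta1_Lip_loc: "Lip_loc {0..<1} eta1"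
  unfolding Lip_loc_def
proof
  fix x :: real assume x: "x \<in> {0..<1}"
  define q where "q = (x + 1) / 2"
  have q: "q < 1" using x by (simp add: q_def)
  obtain B where B: "\<forall>s\<in>{0..q}. \<bar>curv s\<bar> \<le> B" using curv_bounded[OF q] by blast
  have B0: "0 \<le> B" using B[rule_format, of 0] x by (auto simp: q_def)
  have le: "\<bar>eta1 z - eta1 y\<bar> \<le> B * (z - y)" if "0 \<le> y" "y \<le> z" "z \<le> q" for y z
  proof -
    note ac = eta1_abs_cont_on[OF q]
    have "set_integrable lborel {y..z} curv"
      by (rule set_integrable_subset[OF abs_cont_on_integrable[OF ac]]) (use that in auto)
    moreover have "- B \<le> curv x" "curv x \<le> B" if "x \<in> {y..z}" for x
      using B[rule_format, of x] that \<open>0 \<le> y\<close> \<open>z \<le> q\<close> by (auto simp: abs_le_iff)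
    ultimately have "- B * (z - y) \<le> (LBINT t:{y..z}. curv t)" "(LBINT t:{y..z}. curv t) \<le> B * (z - y)"
      using integral_Icc_bounds[of y z curv "- B" B] that by auto
    then show ?thesis using abs_cont_on_integral[OF ac that] by (simp add: abs_le_iff)
  qed
  have "B-lipschitz_on (cball x ((1 - x) / 2) \<inter> {0..<1}) eta1"
  proof (rule lipschitz_onI[OF _ B0])
    have in_q: "0 \<le> y" "y \<le> q" if "y \<in> cball x ((1 - x) / 2) \<inter> {0..<1}" for y
      using that abs_ge_minus_self[of "x - y"] by (auto simp: q_def dist_real_def field_simps)
    fix y z assume "y \<in> cball x ((1 - x) / 2) \<inter> {0..<1}" "z \<in> cball x ((1 - x) / 2) \<inter> {0..<1}"
    then have "0 \<le> y" "y \<le> q" "0 \<le> z" "z \<le> q" by (auto intro: in_q)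
    then show "dist (eta1 y) (eta1 z) \<le> B * dist y z"
      using le[of y z] le[of z y] by (cases "y \<le> z") (auto simp: dist_real_def abs_minus_commute)
  qed
  then show "\<exists>u>0. \<exists>L. L-lipschitz_on (cball x u \<inter> {0..<1}) eta1"
    using x by (intro exI[of _ "(1 - x) / 2"]) auto
qed

lemma eta0_C1: "C1_01 eta0"
  unfolding C1_01_def
proof
  show "\<forall>s\<in>{0..<1}. eta0 differentiable (at s within {0..<1})"
    using eta0_derivative real_differentiable_def by blast
  show "continuous_on {0..<1} (deriv01 eta0)"
    by (rule continuous_on_eq[OF eta1_continuous]) (simp add: deriv01_eta0)
qed

lemma eta0_X: "eta0 \<in> X_space"
proof -
  have "Lip_loc {0..<1} (deriv01 eta0)"
    unfolding Lip_loc_def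
  proof
    fix x :: real assume "x \<in> {0..<1}"
    then obtain r L where "r > 0" "L-lipschitz_on (cball x r \<inter> {0..<1}) eta1"
      using eta1_Lip_loc unfolding Lip_loc_def by blast
    then have "L-lipschitz_on (cball x r \<inter> {0..<1}) (deriv01 eta0)"
      by (simp add: lipschitz_on_def deriv01_eta0)
    with \<open>r > 0\<close> show "\<exists>u>0. \<exists>L. L-lipschitz_on (cball x u \<inter> {0..<1}) (deriv01 eta0)" by blast
  qed
  then show ?thesis using eta0_C1 by (simp add: X_space_def)
qed

lemma curv_measurable: "(\<lambda>s. indicator {0..<1} s * curv s) \<in> borel_measurable borel"
  unfolding measurable_01_iff by (rule abs_cont_on_measurable_01[OF eta1_abs_cont_on])

lemma phi_measurable [measurable]: "\<phi> \<in> borel_measurable (restrict_space borel {0..<1})"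
  by (rule Phi_measurable[OF F(1)])

lemma distr2_eta0: "AE s in lborel. s \<in> {0..<1} \<longrightarrow> distr2 eta0 s = curv s"
proof -
  have "AE s in lborel. s \<in> {0..<1} \<longrightarrow> distr2 eta0 s = indicator {0..<1} s * curv s"
  proof (rule distr2_eq(1)[OF eta0_abs_cont_on _ curv_measurable])
    show "abs_cont_on 0 q eta1 (\<lambda>s. indicator {0..<1} s * curv s)" if "q < 1" for q
      by (rule abs_cont_on_cong[OF eta1_abs_cont_on[OF that]]) (use that in auto)
    show "\<exists>B. \<forall>s\<in>{0..q}. \<bar>indicator {0..<1} s * curv s\<bar> \<le> B" if "q < 1" for q
      using curv_bounded[OF that] that by auto
  qed
  then show ?thesis by eventually_elim auto
qed

lemma eta0_Lambda: "eta0 \<in> Lambda_set \<xi> h"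
proof -
  have "AE s in lborel. s \<in> {0..<1} \<longrightarrow> 0 \<le> distr2 eta0 s"
    using distr2_eta0 by eventually_elim (use curv_pos in \<open>auto intro: less_imp_le\<close>)
  moreover have "\<xi> s \<le> eta0 s" if "s \<in> {0..<1}" for s using u_nonneg[OF that] by (simp add: u_def)
  ultimately show ?thesis using eta0_X deriv01_eta0[of 0] eta1_0 by (simp add: Lambda_set_def)
qed

definition gap :: "(real \<Rightarrow> real) \<Rightarrow> ennreal" where
  "gap \<zeta> = (\<integral>\<^sup>+ s\<in>{0..<1}.
          ennreal (- (2 * sqrt (distr2 \<zeta> s) - distr2 \<zeta> s * (1 - s) - 1 / (1 - s))) \<partial>lborel)"

text \<open>The loss in the arithmetic-geometric mean inequality \<open>2 sqrt g \<le> g \<phi> + 1/\<phi>\<close>, which is the square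
  below and vanishes iff \<open>g = 1/\<phi>^2\<close>.\<close>

definition defect :: "(real \<Rightarrow> real) \<Rightarrow> ennreal" where
  "defect \<zeta> = (\<integral>\<^sup>+ s\<in>{0..<1}. ennreal (\<phi> s * (sqrt (distr2 \<zeta> s) - 1 / \<phi> s)\<^sup>2) \<partial>lborel)"

abbreviation E :: real where "E \<equiv> (LBINT s:{0..q0}. excess F s)"

definition deficit :: "real \<Rightarrow> real" where "deficit s = 1 - s - \<phi> s"

lemma deficit_abs_cont_on: "abs_cont_on 0 q0 deficit (\<lambda>s. F s - 1)"
proof -
  have 1: "abs_cont_on 0 q0 (\<lambda>s. 1 - s) (\<lambda>_. - 1)"
    by (rule abs_cont_on_C1) (auto intro!: derivative_eq_intros)
  have "abs_cont_on 0 q0 \<phi> (\<lambda>s. - F s)"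
    using Phi_abs_cont_on[OF F(1)] q0 by auto
  from abs_cont_on_diff[OF 1 this] show ?thesis by (simp add: deficit_def[abs_def])
qed

text \<open>One integration by parts moves a derivative from \<open>\<zeta>'\<close> to \<^term>\<open>deficit\<close>, which vanishes at \<open>q0\<close>; as the
  derivative of \<^term>\<open>deficit\<close> is \<open>F - 1\<close>, a second one produces the mean of \<open>\<zeta>\<close>.\<close>

lemma pairing:
  assumes \<zeta>: "\<zeta> \<in> Lambda_set \<xi> h"
  shows "(LBINT s:{0..q0}. distr2 \<zeta> s * deficit s) = h\<^sup>2 * deficit 0 - \<zeta> 0 + mean \<zeta>"
    and "set_integrable lborel {0..q0} (\<lambda>s. distr2 \<zeta> s * deficit s)"
proof -
  have X: "\<zeta> \<in> X_space" and z0: "deriv01 \<zeta> 0 = - h\<^sup>2" using \<zeta> by (auto simp: Lambda_set_def)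
  have ac2: "abs_cont_on 0 q0 (deriv01 \<zeta>) (distr2 \<zeta>)" by (rule distr2_abs_cont_on[OF X q0(2)])
  have ac1: "abs_cont_on 0 q0 \<zeta> (deriv01 \<zeta>)"
    by (rule C1_01_abs_cont_on[OF _ q0(2)]) (use X in \<open>simp add: X_space_def\<close>)
  show i1: "set_integrable lborel {0..q0} (\<lambda>s. distr2 \<zeta> s * deficit s)"
    by (rule set_integrable_mult_continuous[OF abs_cont_on_integrable[OF ac2] abs_cont_on_continuous[OF deficit_abs_cont_on]])
  have i2: "set_integrable lborel {0..q0} (\<lambda>s. deriv01 \<zeta> s * F s)"
    using set_integrable_mult_continuous[OF cdf01_integrable[OF F(1)] abs_cont_on_continuous[OF ac2]]
    by (simp add: mult.commute)
  have i3: "set_integrable lborel {0..q0} (deriv01 \<zeta>)" by (rule abs_cont_on_integrable[OF ac1])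
  have "(LBINT t:{0..q0}. distr2 \<zeta> t * deficit t + deriv01 \<zeta> t * (F t - 1)) = deriv01 \<zeta> q0 * deficit q0 - deriv01 \<zeta> 0 * deficit 0"
    by (rule integral_product_by_parts[OF ac2 deficit_abs_cont_on q0(1)])
  also have "\<dots> = h\<^sup>2 * deficit 0" using phi_eq[of q0] q0 z0 by (simp add: deficit_def)
  also have "(LBINT t:{0..q0}. distr2 \<zeta> t * deficit t + deriv01 \<zeta> t * (F t - 1)) =
     (LBINT t:{0..q0}. distr2 \<zeta> t * deficit t + (deriv01 \<zeta> t * F t - deriv01 \<zeta> t))"
    by (simp add: algebra_simps)
  also have "\<dots> = (LBINT t:{0..q0}. distr2 \<zeta> t * deficit t) + ((LBINT t:{0..q0}. deriv01 \<zeta> t * F t) - (LBINT t:{0..q0}. deriv01 \<zeta> t))"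
    using i1 i2 i3 by simp
  also have "(LBINT t:{0..q0}. deriv01 \<zeta> t) = \<zeta> q0 - \<zeta> 0"
    by (rule abs_cont_on_integral[OF ac1]) (use q0 in auto)
  also have "(LBINT t:{0..q0}. deriv01 \<zeta> t * F t) = \<zeta> q0 - mean \<zeta>"
    unfolding mean_def by (rule integral_cdf_by_parts(1)[OF mu ac1 q0(1)]) (use F q0 in auto)
  finally show "(LBINT s:{0..q0}. distr2 \<zeta> s * deficit s) = h\<^sup>2 * deficit 0 - \<zeta> 0 + mean \<zeta>" by simp
qed

lemma nn_integral_restrict_q0:
  assumes f: "set_integrable lborel {0..q0} f" and nn: "AE s in lborel. s \<in> {0..<1} \<longrightarrow> 0 \<le> f s"
    and z: "\<And>s. q0 < s \<Longrightarrow> s < 1 \<Longrightarrow> f s = 0"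
  shows "(\<integral>\<^sup>+ s. ennreal (indicator {0..<1} s * f s) \<partial>lborel) = ennreal (LBINT s:{0..q0}. f s)"
    and "0 \<le> (LBINT s:{0..q0}. f s)"
    and "(\<lambda>s. indicator {0..<1} s * f s) \<in> borel_measurable borel"
proof -
  have e: "indicator {0..<1} s * f s = indicator {0..q0} s *\<^sub>R f s" for s
    using z q0 by (auto split: split_indicator)
  have ae: "AE s in lborel. 0 \<le> indicator {0..q0} s *\<^sub>R f s"
    using nn by eventually_elim (use q0 in \<open>auto split: split_indicator\<close>)
  have i: "integrable lborel (\<lambda>s. indicator {0..q0} s *\<^sub>R f s)" using f by (simp add: set_integrable_def)
  show "(\<integral>\<^sup>+ s. ennreal (indicator {0..<1} s * f s) \<partial>lborel) = ennreal (LBINT s:{0..q0}. f s)"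
    unfolding e set_lebesgue_integral_def by (rule nn_integral_eq_integral[OF i ae])
  show "0 \<le> (LBINT s:{0..q0}. f s)"
    unfolding set_lebesgue_integral_def by (rule integral_nonneg_AE[OF ae])
  show "(\<lambda>s. indicator {0..<1} s * f s) \<in> borel_measurable borel"
    unfolding e using i by (auto dest: borel_measurable_integrable)
qed

text \<open>The identity is stated between non-negative extended integrals, because \<open>gap \<zeta>\<close> and \<open>defect \<zeta>\<close> may be
  infinite for an arbitrary competitor.\<close>

lemma gap_identity:
  assumes \<zeta>: "\<zeta> \<in> Lambda_set \<xi> h"
  shows "gap \<zeta> + ennreal E = ennreal (h\<^sup>2 * deficit 0 - \<zeta> 0 + mean \<zeta>) + defect \<zeta>"
    and "0 \<le> E" "0 \<le> h\<^sup>2 * deficit 0 - \<zeta> 0 + mean \<zeta>"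
proof -
  let ?g = "distr2 \<zeta>"
  let ?I = "\<lambda>s. indicator {0..<1} s :: real"
  have X: "\<zeta> \<in> X_space" using \<zeta> by (auto simp: Lambda_set_def)
  have gm[measurable]: "?g \<in> borel_measurable (restrict_space borel {0..<1})"
    by (rule abs_cont_on_measurable_01[OF distr2_abs_cont_on[OF X]])
  have nn: "AE s in lborel. s \<in> {0..<1} \<longrightarrow> 0 \<le> ?g s" using \<zeta> by (auto simp: Lambda_set_def)
  have deficit_0: "deficit s = 0" if "q0 < s" "s < 1" for s using phi_eq[of s] that by (simp add: deficit_def)
  have deficit_nonneg: "0 \<le> deficit s" if "s < 1" for s using phi_le[of s] that by (simp add: deficit_def)
  note r1 = nn_integral_restrict_q0[OF pairing(2)[OF \<zeta>]]
  have nn1: "AE s in lborel. s \<in> {0..<1} \<longrightarrow> 0 \<le> ?g s * deficit s"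
    using nn by eventually_elim (use deficit_nonneg in auto)
  have a1: "(\<integral>\<^sup>+ s. ennreal (?I s * (?g s * deficit s)) \<partial>lborel) = ennreal (h\<^sup>2 * deficit 0 - \<zeta> 0 + mean \<zeta>)"
    using r1(1)[OF nn1] deficit_0 pairing(1)[OF \<zeta>] by simp
  show "0 \<le> h\<^sup>2 * deficit 0 - \<zeta> 0 + mean \<zeta>"
    using r1(2)[OF nn1] deficit_0 pairing(1)[OF \<zeta>] by simp
  note m1[measurable] = r1(3)[OF nn1]
  have deficit_meas[measurable]: "(\<lambda>s. ?I s * (?g s * deficit s)) \<in> borel_measurable borel"
    using m1 deficit_0 by simp
  note r2 = nn_integral_restrict_q0[OF excess_truncated(3)[OF F q0(1,2)]]
  have nn2: "AE s in lborel. s \<in> {0..<1} \<longrightarrow> 0 \<le> excess F s"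
    using excess_ennreal(2)[OF F(1)] phi_pos by auto
  have ex0: "excess F s = 0" if "q0 < s" "s < 1" for s using phi_eq[of s] that by (simp add: excess_def)
  have a2: "(\<integral>\<^sup>+ s. ennreal (?I s * excess F s) \<partial>lborel) = ennreal E" using r2(1)[OF nn2 ex0] by simp
  show "0 \<le> E" using r2(2)[OF nn2 ex0] by simp
  have ex_meas[measurable]: "(\<lambda>s. ?I s * excess F s) \<in> borel_measurable borel" by (rule excess_measurable[OF F(1)])
  define K where "K = (\<lambda>s. - (2 * sqrt (?g s) - ?g s * (1 - s) - 1 / (1 - s)))"
  define D where "D = (\<lambda>s. \<phi> s * (sqrt (?g s) - 1 / \<phi> s)\<^sup>2)"
  have Km[measurable]: "(\<lambda>s. ?I s * K s) \<in> borel_measurable borel"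
    and Dm[measurable]: "(\<lambda>s. ?I s * D s) \<in> borel_measurable borel"
    unfolding measurable_01_iff K_def D_def by measurable
  have g: "gap \<zeta> = (\<integral>\<^sup>+ s. ennreal (?I s * K s) \<partial>lborel)"
    unfolding gap_def K_def by (rule nn_integral_cong) (auto split: split_indicator)
  have d: "defect \<zeta> = (\<integral>\<^sup>+ s. ennreal (?I s * D s) \<partial>lborel)"
    unfolding defect_def D_def by (rule nn_integral_cong) (auto split: split_indicator)
  \<comment> \<open>Completing the square, pointwise, in the variable \<open>r = sqrt g\<close>.\<close>
  have pw: "K s + excess F s = ?g s * deficit s + D s \<and> 0 \<le> K s \<and> 0 \<le> D s" if "s \<in> {0..<1}" "0 \<le> ?g s" for s
  proof -
    have p: "0 < \<phi> s" using phi_pos that by auto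
    define r where "r = sqrt (?g s)"
    have r: "?g s = r\<^sup>2" using that by (simp add: r_def)
    have K1: "K s = - (2 * r - r\<^sup>2 * (1 - s) - 1 / (1 - s))"
      unfolding K_def r_def[symmetric] by (simp add: r)
    also have "\<dots> = (1 - s) * (r - 1 / (1 - s))\<^sup>2"
    proof -
      have "- (2 * r - r\<^sup>2 * v - 1 / v) = v * (r - 1 / v)\<^sup>2" if "0 < v" for v
        using that by (simp add: field_simps power2_eq_square)
      then show ?thesis using that by simp
    qed
    finally have K: "K s = (1 - s) * (r - 1 / (1 - s))\<^sup>2" .
    have D1: "D s = \<phi> s * (r - 1 / \<phi> s)\<^sup>2"
      unfolding D_def r_def[symmetric] ..
    have "K s + excess F s = r\<^sup>2 * (1 - s) - 2 * r + 1 / \<phi> s"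
      unfolding K1 excess_def by simp
    also have "\<dots> = r\<^sup>2 * deficit s + D s"
      unfolding D1 deficit_def using p by (simp add: field_simps power2_eq_square)
    finally show ?thesis using K D1 p that by (simp add: r)
  qed
  have "gap \<zeta> + ennreal E = (\<integral>\<^sup>+ s. ennreal (?I s * K s) + ennreal (?I s * excess F s) \<partial>lborel)"
    unfolding g a2[symmetric] by (rule nn_integral_add[symmetric]) auto
  also have "\<dots> = (\<integral>\<^sup>+ s. ennreal (?I s * (?g s * deficit s)) + ennreal (?I s * D s) \<partial>lborel)"
  proof (rule nn_integral_cong_AE)
    show "AE s in lborel. ennreal (?I s * K s) + ennreal (?I s * excess F s) = ennreal (?I s * (?g s * deficit s)) + ennreal (?I s * D s)"
      using nn
    proof eventually_elim
      case (elim s)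
      show ?case
      proof (cases "s \<in> {0..<1}")
        case True
        then have "0 \<le> excess F s" "0 \<le> ?g s * deficit s" "0 \<le> ?g s"
          using excess_ennreal(2)[OF F(1), of s] phi_pos[of s] deficit_nonneg[of s] elim by auto
        then show ?thesis using pw[of s] True by (simp flip: ennreal_plus)
      qed simp
    qed
  qed
  also have "\<dots> = ennreal (h\<^sup>2 * deficit 0 - \<zeta> 0 + mean \<zeta>) + defect \<zeta>"
    unfolding d a1[symmetric] by (rule nn_integral_add) auto
  finally show "gap \<zeta> + ennreal E = ennreal (h\<^sup>2 * deficit 0 - \<zeta> 0 + mean \<zeta>) + defect \<zeta>" .
qed

lemma dual_eq: "dual_functional \<xi> h \<zeta> = ereal (1/2) * (- enn2ereal (gap \<zeta>) + ereal (- \<zeta> 0 + h\<^sup>2 + \<xi> 1))"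
  by (simp add: dual_functional_def gap_def)

text \<open>Twice the maximum of the dual problem, attained at \<^term>\<open>eta0\<close>. Integrating \<open>\<xi>''\<close> by parts
  shows that it is also twice the value of the primal functional at \<open>\<mu>\<close>.\<close>

definition V :: real where "V = h\<^sup>2 * \<phi> 0 + E + \<xi> 1 - mean \<xi>"

lemma defect_eta0: "defect eta0 = 0"
proof -
  have "defect eta0 = (\<integral>\<^sup>+ s. 0 \<partial>(lborel :: real measure))"
    unfolding defect_def
  proof (rule nn_integral_cong_AE)
    show "AE s in lborel. ennreal (\<phi> s * (sqrt (distr2 eta0 s) - 1 / \<phi> s)\<^sup>2) * indicator {0..<1} s = 0"
      using distr2_eta0
    proof eventually_elim
      case (elim s)
      show ?case
      proof (cases "s \<in> {0..<1}")
        case True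
        then have "sqrt (distr2 eta0 s) = 1 / \<phi> s"
          using elim phi_pos[of s] by (simp add: curv_def real_sqrt_divide)
        then show ?thesis by simp
      qed simp
    qed
  qed
  then show ?thesis by simp
qed

lemma mean_eta0: "mean eta0 = mean \<xi>"
  using mean_u mean_diff[OF eta0_abs_cont_on[OF q0(2)] abs_cont_on_subset[OF xi_abs_cont_on, of 0 q0]] q0
  by (simp add: u_def[abs_def])

lemma dual_value:
  assumes \<zeta>: "\<zeta> \<in> Lambda_set \<xi> h" and d: "defect \<zeta> = ennreal d" "0 \<le> d"
  shows "dual_functional \<xi> h \<zeta> = ereal (1/2 * (V - d - (mean \<zeta> - mean \<xi>)))"
proof -
  define G where "G = h\<^sup>2 * deficit 0 - \<zeta> 0 + mean \<zeta>"
  note gi = gap_identity[OF \<zeta>, folded G_def]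
  have e: "gap \<zeta> + ennreal E = ennreal (G + d)" using gi(1,3) d by (simp add: ennreal_plus)
  then have "gap \<zeta> \<noteq> \<top>" by (auto simp: top_unique)
  then obtain n where n: "0 \<le> n" "gap \<zeta> = ennreal n" by (cases "gap \<zeta>") auto
  have "n + E = G + d" using e n gi d by (simp flip: ennreal_plus)
  then have "- n + (- \<zeta> 0 + h\<^sup>2 + \<xi> 1) = V - d - (mean \<zeta> - mean \<xi>)"
    by (simp add: V_def G_def deficit_def algebra_simps)
  then show ?thesis unfolding dual_eq n(2) using n(1) by (simp add: enn2ereal_ennreal)
qed

lemma dual_eta0: "dual_functional \<xi> h eta0 = ereal (1/2 * V)"
  using dual_value[OF eta0_Lambda, of 0] defect_eta0 mean_eta0 by simp

text \<open>A maximizer does at least as well as \<^term>\<open>eta0\<close>, so its defect and its mean distance to the obstacle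
  vanish. The first determines \<open>\<zeta>''\<close>, hence \<open>\<zeta>'\<close> by the condition at \<open>0\<close>, and the second fixes the
  constant of integration.\<close>

lemma maximizer_eq_eta0:
  assumes max: "is_arg_max (dual_functional \<xi> h) (\<lambda>\<zeta>. \<zeta> \<in> Lambda_set \<xi> h) \<zeta>"
  shows "\<And>s. s \<in> {0..<1} \<Longrightarrow> \<zeta> s = eta0 s"
    and "AE s in lborel. s \<in> {0..<1} \<longrightarrow> distr2 \<zeta> s = curv s"
    and "\<And>s. s \<in> {0..<1} \<Longrightarrow> deriv01 \<zeta> s = eta1 s"
proof -
  have \<zeta>: "\<zeta> \<in> Lambda_set \<xi> h" and ge: "\<not> dual_functional \<xi> h \<zeta> < dual_functional \<xi> h eta0"
    using max eta0_Lambda unfolding is_arg_max_def by auto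
  have X: "\<zeta> \<in> X_space" and z0: "deriv01 \<zeta> 0 = - h\<^sup>2" and obst: "\<And>s. s \<in> {0..<1} \<Longrightarrow> \<xi> s \<le> \<zeta> s"
    and nn: "AE s in lborel. s \<in> {0..<1} \<longrightarrow> 0 \<le> distr2 \<zeta> s"
    using \<zeta> by (auto simp: Lambda_set_def)
  have C: "C1_01 \<zeta>" using X by (simp add: X_space_def)
  have acz: "abs_cont_on 0 q0 \<zeta> (deriv01 \<zeta>)" by (rule C1_01_abs_cont_on[OF C q0(2)])
  have acx: "abs_cont_on 0 q0 \<xi> (deriv \<xi>)" by (rule abs_cont_on_subset[OF xi_abs_cont_on]) (use q0 in auto)
  have m: "mean \<xi> \<le> mean \<zeta>"
    unfolding mean_def
    by (rule integral_mono[OF mean_integrable[OF acx] mean_integrable[OF acz]])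
      (use obst q0 in \<open>auto split: split_indicator\<close>)
  have "gap \<zeta> \<noteq> \<top>"
  proof
    assume "gap \<zeta> = \<top>"
    then have "dual_functional \<xi> h \<zeta> = -\<infinity>" unfolding dual_eq by simp
    then show False using ge dual_eta0 by simp
  qed
  then have "defect \<zeta> \<noteq> \<top>" using gap_identity(1)[OF \<zeta>] by (auto simp: add_top)
  then obtain d where d: "0 \<le> d" "defect \<zeta> = ennreal d" by (cases "defect \<zeta>") auto
  have "V \<le> V - d - (mean \<zeta> - mean \<xi>)"
    using ge dual_value[OF \<zeta> d(2,1)] dual_eta0 by simp
  then have d0: "d = 0" and mz: "mean \<zeta> = mean \<xi>" using m d by auto
  have gm[measurable]: "distr2 \<zeta> \<in> borel_measurable (restrict_space borel {0..<1})"
    by (rule abs_cont_on_measurable_01[OF distr2_abs_cont_on[OF X]])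
  have "(\<lambda>s. ennreal (\<phi> s * (sqrt (distr2 \<zeta> s) - 1 / \<phi> s)\<^sup>2) * indicator {0..<1} s) \<in> borel_measurable lborel"
    by (subst measurable_lborel2, subst borel_measurable_restrict_space_iff_ennreal[symmetric]) (simp, measurable)
  then have "AE s in lborel. ennreal (\<phi> s * (sqrt (distr2 \<zeta> s) - 1 / \<phi> s)\<^sup>2) * indicator {0..<1} s = 0"
    using d d0 by (simp add: defect_def nn_integral_0_iff_AE)
  with nn show ae: "AE s in lborel. s \<in> {0..<1} \<longrightarrow> distr2 \<zeta> s = curv s"
  proof eventually_elim
    case (elim s)
    show ?case
    proof
      assume s: "s \<in> {0..<1}"
      then have p: "0 < \<phi> s" using phi_pos by auto
      have "\<phi> s * (sqrt (distr2 \<zeta> s) - 1 / \<phi> s)\<^sup>2 \<le> 0" using elim(2) s by (simp add: ennreal_eq_0_iff)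
      then have "sqrt (distr2 \<zeta> s) = 1 / \<phi> s" using p by (simp add: mult_le_0_iff)
      then have "(sqrt (distr2 \<zeta> s))\<^sup>2 = (1 / \<phi> s)\<^sup>2" by simp
      then show "distr2 \<zeta> s = curv s" using elim(1) s by (simp add: curv_def power_divide)
    qed
  qed
  show d1: "deriv01 \<zeta> s = eta1 s" if s: "s \<in> {0..<1}" for s
  proof -
    have s1: "s < 1" "0 \<le> s" using s by auto
    have cm: "set_borel_measurable lborel {0..s} curv"
      using abs_cont_on_integrable[OF eta1_abs_cont_on[OF s1(1)]]
      unfolding set_integrable_def set_borel_measurable_def by (rule borel_measurable_integrable)
    have "abs_cont_on 0 s (deriv01 \<zeta>) curv"
      by (rule abs_cont_on_cong_AE[OF distr2_abs_cont_on[OF X s1(1)] _ cm])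
        (use ae s1 in \<open>auto elim!: eventually_mono\<close>)
    from abs_cont_on_integral[OF this _ s1(2)] abs_cont_on_integral[OF eta1_abs_cont_on[OF s1(1)] _ s1(2)] z0 eta1_0
    show ?thesis by simp
  qed
  define c where "c = \<zeta> 0 - eta0 0"
  have diff: "\<zeta> s = eta0 s + c" if s: "s \<in> {0..<1}" for s
  proof -
    have s1: "s < 1" "0 \<le> s" using s by auto
    have "abs_cont_on 0 s \<zeta> eta1"
      by (rule abs_cont_on_cong[OF C1_01_abs_cont_on[OF C s1(1)]]) (use d1 s1 in auto)
    from abs_cont_on_integral[OF this _ s1(2)] abs_cont_on_integral[OF eta0_abs_cont_on[OF s1(1)] _ s1(2)]
    show ?thesis by (simp add: c_def)
  qed
  have "mean \<zeta> - mean eta0 = mean (\<lambda>s. \<zeta> s - eta0 s)"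
    by (rule mean_diff[OF acz eta0_abs_cont_on[OF q0(2)], symmetric])
  also have "\<dots> = mean (\<lambda>_. c)"
    unfolding mean_def by (rule Bochner_Integration.integral_cong) (use diff q0 in \<open>auto split: split_indicator\<close>)
  also have "\<dots> = c" by (rule mean_const)
  finally have "c = 0" using mz mean_eta0 by simp
  then show "\<zeta> s = eta0 s" if "s \<in> {0..<1}" for s using diff[OF that] by simp
qed

end

section \<open>Regularity and consistency\<close>

text \<open>Layer-cake decomposition: \<open>f\<close> is the integral over \<open>t \<in> [0,B]\<close> of the indicators of \<open>{t < f}\<close>.
  By monotonicity each of these sets is an interval with right endpoint \<open>b\<close>, over which \<open>\<phi>'\<close> integrates
  to minus a value of \<open>\<phi>\<close>, so the total is at most \<open>B\<close>.\<close>

lemma mono_imp_BV_on: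
  fixes f :: "real \<Rightarrow> real"
  assumes mono: "\<And>x y. a < x \<Longrightarrow> x \<le> y \<Longrightarrow> y < b \<Longrightarrow> f x \<le> f y"
    and bd: "\<And>x. a < x \<Longrightarrow> x < b \<Longrightarrow> 0 \<le> f x \<and> f x \<le> B"
    and i: "set_integrable lborel {a<..<b} f"
  shows "BV_on {a<..<b} f"
  unfolding BV_on_def
proof (intro conjI i bdd_aboveI[where M="max B 0"], clarify)
  fix \<phi> assume \<phi>: "test_function {a<..<b} \<phi>" "\<forall>x. \<bar>\<phi> x\<bar> \<le> 1"
  show "(LBINT x:{a<..<b}. f x * deriv \<phi> x) \<le> max B 0"
  proof (cases "a < b")
    case False
    then show ?thesis by (simp add: set_lebesgue_integral_def)
  next
    case True
    have B: "0 \<le> B" using bd[of "(a + b) / 2"] True by auto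
    obtain p q where pq: "a < p" "p \<le> q" "q < b" and 0: "\<And>n x. x \<notin> {p..q} \<Longrightarrow> (deriv ^^ n) \<phi> x = 0"
      using test_functionE[OF \<phi>(1) True] by auto
    have ac: "abs_cont_on c d \<phi> (deriv \<phi>)" for c d
      using test_function_abs_cont_on[OF \<phi>(1), of c d 0] by simp
    define F where "F = (\<lambda>x. indicator {a<..<b} x * f x)"
    define A where "A = (\<lambda>x. indicator {a<..<b} x * deriv \<phi> x)"
    define C where "C = (\<lambda>t. indicator {0..B} t :: real)"
    have [measurable]: "F \<in> borel_measurable borel"
      using i unfolding F_def set_integrable_def by (auto dest: borel_measurable_integrable)
    have iA: "integrable lborel A"
      using set_integrable_subset[OF abs_cont_on_integrable[OF ac[of a b]], of "{a<..<b}"]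
      by (simp add: A_def set_integrable_def greaterThanLessThan_subseteq_atLeastAtMost_iff)
    have iC: "integrable lborel C"
      using borel_integrable_atLeastAtMost'[of 0 B "\<lambda>_. 1::real"] by (simp add: C_def set_integrable_def)
    define S where "S = {z::real\<times>real. snd z < F (fst z)}"
    have S: "S \<in> sets (borel \<Otimes>\<^sub>M borel)"
    proof -
      have "{z \<in> space (borel \<Otimes>\<^sub>M borel). snd z < F (fst z)} \<in> sets (borel \<Otimes>\<^sub>M borel)" by measurable
      then show ?thesis by (simp add: S_def space_pair_measure)
    qed
    have Frange: "0 \<le> F x" "F x \<le> B" for x using bd B by (auto simp: F_def split: split_indicator)
    have J: "\<bar>\<integral>x. A x * C t * indicator S (x, t) \<partial>lborel\<bar> \<le> C t" for t
    proof (cases "t \<in> {0..B} \<and> (\<exists>x. a < x \<and> x < b \<and> t < f x)")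
      case False
      have "(\<lambda>x. A x * C t * indicator S (x, t)) = (\<lambda>x. 0)"
        using False by (auto simp: fun_eq_iff A_def C_def S_def F_def split: split_indicator)
      then show ?thesis by (simp add: C_def)
    next
      case t: True
      define U where "U = {x. a < x \<and> x < b \<and> t < f x}"
      have U: "U \<noteq> {}" "bdd_below U" using t by (auto simp: U_def intro!: bdd_belowI[of _ a])
      define c where "c = Inf U"
      have c: "a \<le> c" "c < b"
      proof -
        show "a \<le> c" unfolding c_def by (rule cInf_greatest[OF U(1)]) (auto simp: U_def)
        obtain x where "x \<in> U" using U by auto
        then show "c < b" using cInf_lower[OF _ U(2), of x] by (auto simp: c_def U_def)
      qed
      have up: "x \<in> U" if cx: "c < x" "x < b" for x
      proof -
        obtain y where "y \<in> U" "y < x" using cInf_lessD[OF U(1), of x] cx(1) unfolding c_def by blast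
        then show ?thesis using mono[of y x] cx by (auto simp: U_def)
      qed
      have lo: "c \<le> x" if "x \<in> U" for x unfolding c_def by (rule cInf_lower[OF that U(2)])
      have "(\<integral>x. A x * C t * indicator S (x, t) \<partial>lborel) = (LBINT x:{c..b}. deriv \<phi> x)"
        unfolding set_lebesgue_integral_def
      proof (rule integral_cong_AE)
        show "AE x in lborel. A x * C t * indicator S (x, t) = indicator {c..b} x *\<^sub>R deriv \<phi> x"
          using AE_lborel_singleton[of c] AE_lborel_singleton[of b]
        proof eventually_elim
          case (elim x)
          have "x \<in> U \<longleftrightarrow> x \<in> {a<..<b} \<and> (x, t) \<in> S" by (auto simp: U_def S_def F_def)
          moreover have "x \<in> U \<longleftrightarrow> x \<in> {c..b}" using up[of x] lo[of x] elim by (auto simp: U_def)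
          ultimately show ?case using t by (auto simp: A_def C_def split: split_indicator)
        qed
        show "(\<lambda>x. A x * C t * indicator S (x, t)) \<in> borel_measurable lborel"
        proof -
          have [measurable]: "A \<in> borel_measurable borel" using iA by auto
          have "(\<lambda>x. indicator S (x, t) :: real) = (\<lambda>x. if t < F x then 1 else 0)"
            by (auto simp: S_def fun_eq_iff)
          then have [measurable]: "(\<lambda>x. indicator S (x, t) :: real) \<in> borel_measurable borel" by simp
          show ?thesis by simp
        qed
        show "(\<lambda>x. indicat_real {c..b} x *\<^sub>R deriv \<phi> x) \<in> borel_measurable lborel"
          using abs_cont_on_integrable[OF ac[of c b]] unfolding set_integrable_def by (rule borel_measurable_integrable)
      qed
      also have "\<dots> = \<phi> b - \<phi> c" by (rule abs_cont_on_integral[OF ac]) (use c in auto)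
      also have "\<dots> = - \<phi> c" using 0[of b 0] pq by auto
      finally show ?thesis using \<phi>(2) t by (simp add: C_def)
    qed
    have "(LBINT x:{a<..<b}. f x * deriv \<phi> x) = (\<integral>x. A x * F x \<partial>lborel)"
      unfolding set_lebesgue_integral_def
      by (rule Bochner_Integration.integral_cong) (auto simp: A_def F_def split: split_indicator)
    also have "(\<lambda>x. A x * F x) = (\<lambda>x. \<integral>t. A x * C t * indicator S (x, t) \<partial>lborel)"
    proof
      fix x
      have "(\<integral>t. A x * C t * indicator S (x, t) \<partial>lborel) = A x * (\<integral>t. indicator {0..<F x} t \<partial>lborel)"
        unfolding Bochner_Integration.integral_mult_right_zero[symmetric]
        by (rule Bochner_Integration.integral_cong)
          (use Frange(2)[of x] in \<open>auto simp: C_def S_def split: split_indicator\<close>)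
      then show "A x * F x = (\<integral>t. A x * C t * indicator S (x, t) \<partial>lborel)"
        using Frange(1)[of x] by simp
    qed
    also have "(\<integral>x. (\<integral>t. A x * C t * indicator S (x, t) \<partial>lborel) \<partial>lborel) =
        (\<integral>t. (\<integral>x. A x * C t * indicator S (x, t) \<partial>lborel) \<partial>lborel)"
      by (rule integrable_triangle(2)[OF _ _ iA iC S, symmetric]) (auto intro: lborel.sigma_finite_measure_axioms)
    also have "\<dots> \<le> (\<integral>t. C t \<partial>lborel)"
    proof (cases "integrable lborel (\<lambda>t. \<integral>x. A x * C t * indicator S (x, t) \<partial>lborel)")
      case True
      then show ?thesis by (rule integral_mono[OF _ iC]) (use J in \<open>auto simp: abs_le_iff\<close>)
    next
      case False
      then show ?thesis by (simp add: not_integrable_integral_eq C_def)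
    qed
    also have "\<dots> = B" using B by (simp add: C_def)
    finally show ?thesis by simp
  qed
qed

context CS_minimizer
begin

text \<open>Formally the derivative of \<open>1/\<phi>^2\<close>, as \<open>\<phi>' = -F\<close>.\<close>

definition third :: "real \<Rightarrow> real" where "third s = 2 * F s / \<phi> s ^ 3"

lemma third_mono: assumes "x \<le> y" "y < 1" shows "third x \<le> third y"
proof -
  have "\<phi> y \<le> \<phi> x" using Phi_antimono[OF F(1)] assms by auto
  then have "\<phi> y ^ 3 \<le> \<phi> x ^ 3" using phi_pos[of y] assms by (intro power_mono) auto
  then show ?thesis
    unfolding third_def using cdf01_mono[OF F(1) assms(1)] cdf01_range(1)[OF F(1), of x] phi_pos[of x] phi_pos[of y] assms
    by (intro frac_le) auto
qed

lemma third_nonneg: "x < 1 \<Longrightarrow> 0 \<le> third x"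
  unfolding third_def using cdf01_range(1)[OF F(1), of x] phi_pos[of x] by simp

lemma curv_lipschitz: assumes q: "q < 1" shows "(2 / \<phi> q ^ 3)-lipschitz_on {0..q} curv"
proof -
  define m where "m = \<phi> q"
  have m: "0 < m" using phi_pos[OF q] by (simp add: m_def)
  have le: "\<bar>curv y - curv x\<bar> \<le> 2 / m ^ 3 * (y - x)" if "0 \<le> x" "x \<le> y" "y \<le> q" for x y
  proof -
    have a: "m \<le> \<phi> y" "\<phi> y \<le> \<phi> x" using Phi_antimono[OF F(1)] that q by (auto simp: m_def)
    have d: "\<phi> x - \<phi> y \<le> y - x" using Phi_lipschitz[OF F(1) that(2)] that q a by auto
    have p: "0 < \<phi> y" "0 < \<phi> x" using a m by auto
    have "curv y - curv x = (\<phi> x - \<phi> y) * (1 / (\<phi> x * (\<phi> y * \<phi> y)) + 1 / (\<phi> x * (\<phi> x * \<phi> y)))"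
      unfolding curv_def using p by (simp add: field_simps power2_eq_square)
    moreover have "1 / (\<phi> x * (\<phi> y * \<phi> y)) \<le> 1 / m ^ 3" "1 / (\<phi> x * (\<phi> x * \<phi> y)) \<le> 1 / m ^ 3"
      using a m p unfolding power3_eq_cube mult.assoc
      by (auto intro!: divide_left_mono mult_mono mult_pos_pos)
    moreover have "0 \<le> 1 / (\<phi> x * (\<phi> y * \<phi> y)) + 1 / (\<phi> x * (\<phi> x * \<phi> y))" using p by simp
    ultimately have "curv y - curv x \<le> (y - x) * (2 / m ^ 3)" "0 \<le> curv y - curv x"
      using mult_mono[OF d, of "1 / (\<phi> x * (\<phi> y * \<phi> y)) + 1 / (\<phi> x * (\<phi> x * \<phi> y))" "2 / m ^ 3"] a that by auto
    then show ?thesis by (simp add: mult.commute)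
  qed
  show ?thesis unfolding m_def[symmetric]
  proof (rule lipschitz_onI)
    fix x y assume "x \<in> {0..q}" "y \<in> {0..q}"
    then show "dist (curv x) (curv y) \<le> 2 / m ^ 3 * dist x y"
      using le[of x y] le[of y x] by (cases "x \<le> y") (auto simp: dist_real_def abs_minus_commute)
  qed (use m in auto)
qed

text \<open>The Lipschitz function \<^term>\<open>curv\<close> has some density; the product rule applied to \<open>curv * \<phi> * \<phi> = 1\<close>
  identifies it, without differentiating \<open>\<phi>\<close> pointwise at the jumps of \<open>F\<close>.\<close>

lemma curv_abs_cont_on: assumes q: "q < 1" shows "abs_cont_on 0 q curv third"
proof -
  obtain g where g: "abs_cont_on 0 q curv g"
    using lipschitz_imp_abs_cont_on[OF curv_lipschitz[OF q]] by blast
  have ph: "abs_cont_on 0 q \<phi> (\<lambda>s. - F s)" using Phi_abs_cont_on[OF F(1)] q by auto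
  have "abs_cont_on 0 q (\<lambda>s. curv s * (\<phi> s * \<phi> s)) (\<lambda>s. g s * (\<phi> s * \<phi> s) + curv s * (- F s * \<phi> s + \<phi> s * - F s))"
    by (rule abs_cont_on_mult[OF g abs_cont_on_mult[OF ph ph]])
  then have "abs_cont_on 0 q (\<lambda>_. 1) (\<lambda>s. g s * (\<phi> s * \<phi> s) + curv s * (- F s * \<phi> s + \<phi> s * - F s))"
  proof (rule abs_cont_on_cong)
    fix x assume "x \<in> {0..q}"
    then have "0 < \<phi> x" using phi_pos q by auto
    then show "curv x * (\<phi> x * \<phi> x) = 1" by (simp add: curv_def power2_eq_square)
  qed simp
  from integral_zero_imp_AE_zero[OF this]
  have "AE x in lborel. x \<in> {0..q} \<longrightarrow> g x = third x"
  proof eventually_elim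
    case (elim x)
    show ?case
    proof
      assume x: "x \<in> {0..q}"
      then have p: "0 < \<phi> x" using phi_pos q by auto
      have "g x * (\<phi> x * \<phi> x) = 2 * F x / \<phi> x"
        using elim x p by (simp add: curv_def power2_eq_square field_simps)
      then show "g x = third x" using p by (simp add: third_def power3_eq_cube field_simps)
    qed
  qed
  moreover have "set_borel_measurable lborel {0..q} third"
  proof -
    have [measurable]: "\<phi> \<in> borel_measurable (restrict_space borel {0..q})"
      by (rule borel_measurable_continuous_on_restrict[OF abs_cont_on_continuous[OF ph]])
    have [measurable]: "F \<in> borel_measurable (restrict_space borel {0..q})"
      by (rule measurable_restrict_space1[OF cdf01_measurable[OF F(1)]])
    have "third \<in> borel_measurable (restrict_space borel {0..q})"
      unfolding third_def by measurable
    then show ?thesis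
      by (simp add: set_borel_measurable_def borel_measurable_restrict_space_iff)
  qed
  ultimately show ?thesis by (rule abs_cont_on_cong_AE[OF g])
qed

lemma third_BV:
  assumes "\<delta> \<in> {0<..<1}"
  shows "BV_on {0<..<1 - \<delta>} third" "L_infty_on {0<..<1 - \<delta>} third"
proof -
  have d: "1 - \<delta> < 1" using assms by auto
  have i: "set_integrable lborel {0<..<1 - \<delta>} third"
    by (rule set_integrable_subset[OF abs_cont_on_integrable[OF curv_abs_cont_on[OF d]]]) auto
  have b: "0 \<le> third x \<and> third x \<le> third (1 - \<delta>)" if "0 < x" "x < 1 - \<delta>" for x
    using third_nonneg[of x] third_mono[of x "1 - \<delta>"] that d by auto
  show "BV_on {0<..<1 - \<delta>} third"
    by (rule mono_imp_BV_on[OF _ b i]) (use third_mono d in auto)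
  have "set_borel_measurable lborel {0<..<1 - \<delta>} third"
    using i unfolding set_integrable_def set_borel_measurable_def by (rule borel_measurable_integrable)
  moreover have "AE x in lborel. x \<in> {0<..<1 - \<delta>} \<longrightarrow> \<bar>third x\<bar> \<le> third (1 - \<delta>)"
    using b by (intro AE_I2) auto
  ultimately show "L_infty_on {0<..<1 - \<delta>} third" unfolding L_infty_on_def by blast
qed

lemma u_derivative: "s \<in> {0..<1} \<Longrightarrow> (u has_real_derivative u1 s) (at s within {0..<1})"
  unfolding u_def[abs_def] u1_def
  using eta0_derivative[of s] has_field_derivative_at_within[OF xi_deriv[of s]] by (auto intro!: DERIV_diff)

lemma u1_derivative: "s \<in> {0..<1} \<Longrightarrow> (u1 has_real_derivative curv s - k s) (at s within {0..<1})"
  unfolding u1_def[abs_def]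
  using eta1_derivative[of s] has_field_derivative_at_within[OF xi_deriv2[of s]] by (auto intro!: DERIV_diff)

text \<open>The non-negative function \<open>u\<close> has a minimum at \<open>s\<close>. At an interior point the first derivative vanishes;
  at \<open>0\<close> it is \<open>-h^2\<close>, so that a minimum there forces \<open>h = 0\<close>. A negative second derivative would make
  \<open>u\<close> negative immediately to the right of \<open>s\<close>.\<close>

lemma consistency:
  assumes s: "s \<in> {0..<1}" and 0: "u s = 0"
  shows "u1 s = 0" "k s \<le> curv s"
proof -
  show u1: "u1 s = 0"
  proof (rule antisym)
    show "0 \<le> u1 s"
    proof (rule ccontr)
      assume "\<not> 0 \<le> u1 s"
      then obtain d where d: "d > 0" "\<And>r. 0 < r \<Longrightarrow> s + r \<in> {0..<1} \<Longrightarrow> r < d \<Longrightarrow> u (s + r) < u s"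
        using has_real_derivative_neg_dec_right[OF u_derivative[OF s]] by auto
      define r where "r = min (d / 2) ((1 - s) / 2)"
      have r: "0 < r" "r < d" "r < 1 - s" using d(1) s by (auto simp: r_def min_def field_simps)
      then have "s + r \<in> {0..<1}" using s by auto
      then show False using d(2)[OF r(1) _ r(2)] u_nonneg[of "s + r"] 0 by auto
    qed
    show "u1 s \<le> 0"
    proof (cases "s = 0")
      case True
      then show ?thesis using u1_0 by simp
    next
      case False
      show ?thesis
      proof (rule ccontr)
        assume "\<not> u1 s \<le> 0"
        then obtain d where d: "d > 0" "\<And>r. 0 < r \<Longrightarrow> s - r \<in> {0..<1} \<Longrightarrow> r < d \<Longrightarrow> u (s - r) < u s"
          using has_real_derivative_pos_inc_left[OF u_derivative[OF s]] by auto
        define r where "r = min (d / 2) s"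
        have r: "0 < r" "r < d" "r \<le> s" using d(1) s False by (auto simp: r_def)
        then have "s - r \<in> {0..<1}" using s by auto
        then show False using d(2)[OF r(1) _ r(2)] u_nonneg[of "s - r"] 0 by auto
      qed
    qed
  qed
  show "k s \<le> curv s"
  proof (rule ccontr)
    assume "\<not> k s \<le> curv s"
    then have "curv s - k s < 0" by simp
    from has_real_derivative_neg_dec_right[OF u1_derivative[OF s] this]
    obtain d where d: "d > 0" "\<And>r. 0 < r \<Longrightarrow> s + r \<in> {0..<1} \<Longrightarrow> r < d \<Longrightarrow> u1 (s + r) < u1 s" by auto
    define r where "r = min (d / 2) ((1 - s) / 2)"
    have r: "0 < r" "r < d" "r < 1 - s" using d(1) s by (auto simp: r_def min_def field_simps)
    have der: "(u has_real_derivative u1 x) (at x)" if "s < x" "x < s + r" for x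
    proof -
      have "at x within {0..<1} = at x"
        by (rule at_within_interior) (use that s r in \<open>auto intro!: interiorI[of "{0<..<1}"]\<close>)
      then show ?thesis using u_derivative[of x] that s r by auto
    qed
    have "continuous_on {s..s + r} u"
      by (rule continuous_on_subset[OF abs_cont_on_continuous[OF u_abs_cont_on[of "s + r"]]]) (use s r in auto)
    then obtain l z where z: "s < z" "z < s + r" "DERIV u z :> l" "u (s + r) - u s = (s + r - s) * l"
      using MVT[of s "s + r" u] der r(1) by (auto simp: real_differentiable_def)
    have "l = u1 z" using DERIV_unique[OF z(3) der[OF z(1,2)]] .
    moreover have "u1 (s + (z - s)) < u1 s" by (rule d(2)) (use z r s in auto)
    ultimately have "l < 0" using u1 by simp
    then have "u (s + r) < 0" using z(4) r(1) 0 by (simp add: mult_pos_neg)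
    then show False using u_nonneg[of "s + r"] s r by auto
  qed
qed

text \<open>Almost everywhere \<open>1 / sqrt g\<close> is \<open>\<phi>\<close>, whose first distributional derivative is \<open>-F\<close>, and \<open>F\<close> in turn
  is a distributional primitive of \<open>\<mu>\<close>.\<close>

lemma euler_lagrange:
  assumes g: "AE s in lborel. s \<in> {0..<1} \<longrightarrow> g s = curv s"
    and gm[measurable]: "g \<in> borel_measurable (restrict_space borel {0..<1})"
  shows "distr_deriv2_eq_neg_measure {0<..<1} (\<lambda>s. 1 / sqrt (g s)) \<mu>"
proof -
  let ?f = "\<lambda>s. 1 / sqrt (g s)"
  have fm: "(\<lambda>s. indicator {0..<1} s * ?f s) \<in> borel_measurable borel"
    unfolding measurable_01_iff by measurable
  have ae: "AE s in lborel. s \<in> {0..<1} \<longrightarrow> ?f s = \<phi> s"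
    using g
  proof eventually_elim
    case (elim s)
    show ?case
    proof
      assume "s \<in> {0..<1}"
      then show "?f s = \<phi> s" using elim phi_pos[of s] by (simp add: curv_def real_sqrt_divide)
    qed
  qed
  have i\<phi>: "set_integrable lborel {0..q} \<phi>" if q: "q < 1" for q
    by (rule borel_integrable_atLeastAtMost', rule continuous_on_subset[OF Phi_continuous[OF F(1), of 0]])
      (use q in auto)
  have fi: "set_integrable lborel {0..q} ?f" if q: "q < 1" for q
  proof (rule set_integrable_bound[OF i\<phi>[OF q]])
    show "AE x in lborel. x \<in> {0..q} \<longrightarrow> norm (?f x) \<le> norm (\<phi> x)"
      using ae by eventually_elim (use q in auto)
    have "set_borel_measurable lborel {0..<1} ?f"
      using fm by (simp add: set_borel_measurable_def)
    then show "set_borel_measurable lborel {0..q} ?f"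
      by (rule set_borel_measurable_subset) (use q in auto)
  qed
  show ?thesis unfolding distr_deriv2_eq_neg_measure_def
  proof (intro conjI allI impI)
    show "loc_integrable {0<..<1} ?f" by (rule loc_integrable_Ioo_01I[OF fi])
    fix \<psi> assume \<psi>: "test_function {0<..<1} \<psi>"
    obtain p q where pq: "0 < p" "p \<le> q" "q < 1" and 0: "\<And>n x. x \<notin> {p..q} \<Longrightarrow> (deriv ^^ n) \<psi> x = 0"
      using test_functionE[OF \<psi>] by auto
    have restr: "(LBINT x:{0<..<1}. w x * (deriv ^^ 2) \<psi> x) = (LBINT x:{p..q}. w x * (deriv ^^ 2) \<psi> x)" for w
      by (rule set_integral_restrict_support) (use pq 0 in auto)
    have "(LBINT x:{p..q}. ?f x * (deriv ^^ 2) \<psi> x) = (LBINT x:{p..q}. \<phi> x * (deriv ^^ 2) \<psi> x)"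
    proof (rule set_integral_cong_AE_integrable)
      have i: "set_integrable lborel {p..q} ?f" "set_integrable lborel {p..q} \<phi>"
        using set_integrable_subset[OF fi[OF pq(3)]] set_integrable_subset[OF i\<phi>[OF pq(3)]] pq by auto
      show "set_integrable lborel {p..q} (\<lambda>x. ?f x * (deriv ^^ 2) \<psi> x)"
        "set_integrable lborel {p..q} (\<lambda>x. \<phi> x * (deriv ^^ 2) \<psi> x)"
        by (rule set_integrable_mult_continuous[OF i(1) test_function_continuous[OF \<psi>]]
            set_integrable_mult_continuous[OF i(2) test_function_continuous[OF \<psi>]])+
      show "AE x in lborel. x \<in> {p..q} \<longrightarrow> ?f x * (deriv ^^ 2) \<psi> x = \<phi> x * (deriv ^^ 2) \<psi> x"
        using ae
      proof eventually_elim
        case (elim x)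
        show ?case
        proof
          assume "x \<in> {p..q}"
          then have "?f x = \<phi> x" using elim pq by simp
          then show "?f x * (deriv ^^ 2) \<psi> x = \<phi> x * (deriv ^^ 2) \<psi> x" by (simp only:)
        qed
      qed
    qed
    then have "(LBINT x:{0<..<1}. ?f x * (deriv ^^ 2) \<psi> x) = (LBINT x:{0<..<1}. \<phi> x * (deriv ^^ 2) \<psi> x)"
      unfolding restr .
    also have "\<dots> = - (LBINT x:{0<..<1}. - F x * (deriv ^^ 1) \<psi> x)"
    proof -
      have "abs_cont_on 0 q \<phi> (\<lambda>s. - F s)" if "q < 1" for q using Phi_abs_cont_on[OF F(1)] that by auto
      from integral_test_function_by_parts[OF \<psi> this, of 1] show ?thesis by (simp add: numeral_2_eq_2)
    qed
    also have "\<dots> = (LBINT x:{0<..<1}. deriv \<psi> x * F x)"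
      unfolding set_lebesgue_integral_def Bochner_Integration.integral_minus[symmetric]
      by (rule Bochner_Integration.integral_cong) auto
    also have "\<dots> = (LBINT x:{0..1}. deriv \<psi> x * F x)"
      by (rule set_integral_restrict_support[symmetric]) (use 0[of _ 1] pq in auto)
    also have "\<dots> = \<psi> 1 - (LINT x|M. indicator {0..1} x * \<psi> x)"
      by (rule integral_cdf_by_parts(1)[OF mu])
        (use test_function_abs_cont_on[OF \<psi>, of 0 1 0] F q0 in auto)
    also have "\<psi> 1 = 0" using 0[of 1 0] pq by auto
    also have "(LINT x|M. indicator {0..1} x * \<psi> x) = (LINT x|M. \<psi> x)"
      by (rule Bochner_Integration.integral_cong) (use 0[of _ 0] pq in \<open>auto split: split_indicator\<close>)
    also have "\<dots> = (LINT x|\<mu>. \<psi> x)"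
    proof -
      have "continuous_on UNIV \<psi>" using test_function_continuous[OF \<psi>, of _ 0] by simp
      then have "\<psi> \<in> borel_measurable borel" by (rule borel_measurable_continuous_onI)
      then show ?thesis unfolding real_law_def using Pr01_facts(3)[OF mu] by (intro integral_distr)
    qed
    finally show "(LBINT x:{0<..<1}. ?f x * (deriv ^^ 2) \<psi> x) = - (LINT x|\<mu>. \<psi> x)" by simp
  qed
qed

lemma maximizer_second_derivative:
  assumes max: "is_arg_max (dual_functional \<xi> h) (\<lambda>\<zeta>. \<zeta> \<in> Lambda_set \<xi> h) \<eta>"
  shows "\<And>s. s \<in> {0..<1} \<Longrightarrow> (deriv01 \<eta> has_real_derivative curv s) (at s within {0..<1})"
    and "\<And>s. s \<in> {0..<1} \<Longrightarrow> deriv01 (deriv01 \<eta>) s = curv s"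
proof -
  show d: "(deriv01 \<eta> has_real_derivative curv s) (at s within {0..<1})" if s: "s \<in> {0..<1}" for s
    by (rule has_field_derivative_transform_within[OF eta1_derivative[OF s], of 1])
      (use s maximizer_eq_eta0(3)[OF max] in auto)
  show "deriv01 (deriv01 \<eta>) s = curv s" if s: "s \<in> {0..<1}" for s
    by (rule deriv01_eqI[OF d[OF s] s])
qed

end

text \<open>The series converges beyond \<open>1\<close>, so it may be differentiated termwise on a neighbourhood of \<open>[0,1]\<close>;
  its coefficients are non-negative and start in degree two. If \<open>\<beta> = 0\<close>, the series in \<^const>\<open>mixture\<close>
  may diverge, but the factor in front of it is zero.\<close>

lemma mixture_CS_setting:
  fixes \<beta> h :: real and b :: "nat \<Rightarrow> real"
  assumes fin: "\<exists>\<epsilon>>0. summable (\<lambda>p. \<beta>\<^sup>2 * (b (p + 2))\<^sup>2 * (1 + \<epsilon>) ^ (p + 2))"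
  shows "CS_setting (mixture \<beta> b)"
proof -
  obtain \<epsilon> where \<epsilon>: "\<epsilon> > 0" "summable (\<lambda>p. \<beta>\<^sup>2 * (b (p + 2))\<^sup>2 * (1 + \<epsilon>) ^ (p + 2))" using fin by blast
  define K where "K = 1 + \<epsilon>"
  define c where "c = (\<lambda>n. if n < 2 then 0 else \<beta>\<^sup>2 * (b n)\<^sup>2)"
  have c0: "0 \<le> c n" for n by (simp add: c_def)
  have "summable (\<lambda>n. c (n + 2) * K ^ (n + 2))" using \<epsilon>(2) by (simp add: c_def K_def)
  then have sK: "summable (\<lambda>n. c n * K ^ n)" by (subst (asm) summable_iff_shift)
  have s: "summable (\<lambda>n. c n * x ^ n)" if "norm x < K" for x
    using powser_inside[OF sK, of x] that \<epsilon>(1) by (simp add: K_def)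
  have s1: "summable (\<lambda>n. diffs c n * x ^ n)" if "norm x < K" for x
    by (rule termdiff_converges[OF that s])
  have s2: "summable (\<lambda>n. diffs (diffs c) n * x ^ n)" if "norm x < K" for x
    by (rule termdiff_converges[OF that s1])
  define f1 f2 where "f1 = (\<lambda>x. \<Sum>n. diffs c n * x ^ n)" and "f2 = (\<lambda>x. \<Sum>n. diffs (diffs c) n * x ^ n)"
  have mix: "mixture \<beta> b x = (\<Sum>n. c n * x ^ n)" if "norm x < K" for x
  proof -
    have "(\<Sum>n. c n * x ^ n) = (\<Sum>n. c (n + 2) * x ^ (n + 2)) + (\<Sum>n<2. c n * x ^ n)"
      by (rule suminf_split_initial_segment[OF s[OF that]])
    also have "(\<Sum>n<2. c n * x ^ n) = 0" by (simp add: c_def)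
    also have "(\<Sum>n. c (n + 2) * x ^ (n + 2)) = (\<Sum>n. \<beta>\<^sup>2 * ((b (n + 2))\<^sup>2 * x ^ (n + 2)))"
      by (simp add: c_def mult.assoc)
    also have "\<dots> = \<beta>\<^sup>2 * (\<Sum>n. (b (n + 2))\<^sup>2 * x ^ (n + 2))"
    proof (cases "\<beta> = 0")
      case False
      have "summable (\<lambda>n. c (n + 2) * x ^ (n + 2))" using s[OF that] by (subst summable_iff_shift)
      then have "summable (\<lambda>n. \<beta>\<^sup>2 * ((b (n + 2))\<^sup>2 * x ^ (n + 2)))" by (simp add: c_def mult.assoc)
      then have "summable (\<lambda>n. (b (n + 2))\<^sup>2 * x ^ (n + 2))" using False by (subst (asm) summable_cmult_iff) auto
      then show ?thesis by (rule suminf_mult)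
    qed simp
    finally show ?thesis by (simp add: mixture_def)
  qed
  have d0: "(mixture \<beta> b has_real_derivative f1 x) (at x)" if x: "norm x < K" for x
  proof -
    have "((\<lambda>x. \<Sum>n. c n * x ^ n) has_real_derivative f1 x) (at x)"
      unfolding f1_def by (rule termdiffs_strong'[OF s x])
    then show ?thesis
      by (rule has_field_derivative_transform_within_open[of _ _ _ "ball 0 K"]) (use x mix in auto)
  qed
  have e1: "deriv (mixture \<beta> b) x = f1 x" if "norm x < K" for x using d0[OF that] by (rule DERIV_imp_deriv)
  have d1: "(deriv (mixture \<beta> b) has_real_derivative f2 x) (at x)" if x: "norm x < K" for x
  proof -
    have "(f1 has_real_derivative f2 x) (at x)"
      unfolding f1_def f2_def by (rule termdiffs_strong'[OF s1 x])
    then show ?thesis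
      by (rule has_field_derivative_transform_within_open[of _ _ _ "ball 0 K"]) (use x e1 in auto)
  qed
  have e2: "deriv (deriv (mixture \<beta> b)) x = f2 x" if "norm x < K" for x using d1[OF that] by (rule DERIV_imp_deriv)
  have nK: "norm x < K" if "x \<in> {0..1}" for x :: real using that \<epsilon>(1) by (auto simp: K_def)
  have "continuous_on {0..1} f2"
  proof (rule continuous_at_imp_continuous_on, rule ballI)
    fix x :: real assume "x \<in> {0..1}"
    from termdiffs_strong'[OF s2 nK[OF this]] show "isCont f2 x" unfolding f2_def by (rule DERIV_isCont)
  qed
  show ?thesis
  proof
    show "(mixture \<beta> b has_real_derivative deriv (mixture \<beta> b) x) (at x)" if "x \<in> {0..1}" for x
      using d0[OF nK[OF that]] e1[OF nK[OF that]] by simp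
    show "(deriv (mixture \<beta> b) has_real_derivative deriv (deriv (mixture \<beta> b)) x) (at x)" if "x \<in> {0..1}" for x
      using d1[OF nK[OF that]] e2[OF nK[OF that]] by simp
    show "continuous_on {0..1} (deriv (deriv (mixture \<beta> b)))"
      by (rule continuous_on_eq[OF \<open>continuous_on {0..1} f2\<close>]) (use e2 nK in auto)
    show "0 \<le> deriv (deriv (mixture \<beta> b)) x" if "x \<in> {0..1}" for x
    proof -
      have "0 \<le> diffs (diffs c) n * x ^ n" for n using c0 that by (simp add: diffs_def)
      then have "0 \<le> f2 x" unfolding f2_def by (intro suminf_nonneg s2 nK that)
      then show ?thesis using e2[OF nK[OF that]] by simp
    qed
    have "f1 0 = diffs c 0" unfolding f1_def by (rule powser_zero)
    then show "deriv (mixture \<beta> b) 0 = 0" using e1[of 0] \<epsilon>(1) by (simp add: K_def diffs_def c_def)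
  qed
qed

lemma (in CS_setting) CS_minimizerI:
  assumes "is_arg_min (CS_functional \<xi> h) (\<lambda>\<nu>. \<nu> \<in> Pr01) \<mu>"
  shows "CS_minimizer \<xi> h \<mu>"
proof
  show mu: "\<mu> \<in> Pr01" using assms by (simp add: is_arg_min_def)
  fix G assume "cdf01 G"
  then obtain \<nu> where \<nu>: "\<nu> \<in> Pr01" "cdf (real_law \<nu>) = G" using cdf01_imp_Pr01 by blast
  have "\<not> CS_functional \<xi> h \<nu> < CS_functional \<xi> h \<mu>" using assms \<nu>(1) by (auto simp: is_arg_min_def)
  then show "cost k h (cdf (real_law \<mu>)) \<le> cost k h G"
    using CS_functional_eq_cost[OF mu] CS_functional_eq_cost[OF \<nu>(1)] \<nu>(2) by simp
qed

lemma (in CS_setting) CS_minimizer_exists: "\<exists>\<mu>. CS_minimizer \<xi> h \<mu>"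
proof -
  obtain F where F: "cdf01 F" "\<And>G. cdf01 G \<Longrightarrow> cost k h F \<le> cost k h G"
    using minimizer_exists by blast
  obtain \<mu> where "\<mu> \<in> Pr01" "cdf (real_law \<mu>) = F" using cdf01_imp_Pr01[OF F(1)] by blast
  with F(2) have "CS_minimizer \<xi> h \<mu>" by unfold_locales auto
  then show ?thesis ..
qed

context CS_minimizer
begin

lemma maximizer_optimality:
  assumes max: "is_arg_max (dual_functional \<xi> h) (\<lambda>\<zeta>. \<zeta> \<in> Lambda_set \<xi> h) \<eta>"
  shows "distr_deriv2_eq_neg_measure {0<..<1} (\<lambda>s. 1 / sqrt (distr2 \<eta> s)) \<mu>"
    and "measure_support \<mu> \<subseteq> {s \<in> {0..<1}. \<eta> s = \<xi> s}"
proof -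
  have X: "\<eta> \<in> X_space" using max by (simp add: is_arg_max_def Lambda_set_def)
  show "distr_deriv2_eq_neg_measure {0<..<1} (\<lambda>s. 1 / sqrt (distr2 \<eta> s)) \<mu>"
    by (rule euler_lagrange[OF maximizer_eq_eta0(2)[OF max] abs_cont_on_measurable_01[OF distr2_abs_cont_on[OF X]]])
  show "measure_support \<mu> \<subseteq> {s \<in> {0..<1}. \<eta> s = \<xi> s}"
    using support_subset maximizer_eq_eta0(1)[OF max] by (auto simp: u_def)
qed

lemma maximizer_regularity:
  assumes max: "is_arg_max (dual_functional \<xi> h) (\<lambda>\<zeta>. \<zeta> \<in> Lambda_set \<xi> h) \<eta>"
  shows "C2_01 \<eta>"
    and "distr_deriv 1 {0<..<1} (deriv01 (deriv01 \<eta>)) third"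
    and "\<forall>\<^sub>F s in at_left 1. deriv01 (deriv01 \<eta>) s = 1 / (1 - s)\<^sup>2"
proof -
  note d2 = maximizer_second_derivative[OF max]
  have "C1_01 \<eta>" using max by (simp add: is_arg_max_def Lambda_set_def X_space_def)
  moreover have "C1_01 (deriv01 \<eta>)"
    unfolding C1_01_def
  proof
    show "\<forall>s\<in>{0..<1}. deriv01 \<eta> differentiable (at s within {0..<1})"
      using d2(1) real_differentiable_def by blast
    show "continuous_on {0..<1} (deriv01 (deriv01 \<eta>))"
      by (rule continuous_on_eq[OF curv_continuous]) (simp add: d2(2))
  qed
  ultimately show "C2_01 \<eta>" by (simp add: C2_01_def)
  show "distr_deriv 1 {0<..<1} (deriv01 (deriv01 \<eta>)) third"
  proof (rule abs_cont_on_distr_deriv)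
    show "abs_cont_on 0 q (deriv01 (deriv01 \<eta>)) third" if "q < 1" for q
      by (rule abs_cont_on_cong[OF curv_abs_cont_on[OF that]]) (use d2(2) that in auto)
  qed
  show "\<forall>\<^sub>F s in at_left 1. deriv01 (deriv01 \<eta>) s = 1 / (1 - s)\<^sup>2"
    unfolding eventually_at_left_field
    by (rule exI[of _ q0]) (use d2(2) curv_eq q0 in auto)
qed

lemma maximizer_consistency:
  assumes max: "is_arg_max (dual_functional \<xi> h) (\<lambda>\<zeta>. \<zeta> \<in> Lambda_set \<xi> h) \<eta>"
    and s: "s \<in> {0..<1}" and eq: "\<eta> s = \<xi> s"
  shows "deriv01 \<eta> s = deriv \<xi> s" "k s \<le> deriv01 (deriv01 \<eta>) s"
  using consistency[OF s] maximizer_eq_eta0(1,3)[OF max s] maximizer_second_derivative(2)[OF max s] eq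
  by (auto simp: u_def u1_def)

end

theorem proposition1p2:
  fixes \<beta> h :: real and b :: "nat \<Rightarrow> real" and \<xi> :: "real \<Rightarrow> real"
  assumes xi: "\<xi> = mixture \<beta> b"
    and fin: "\<exists>\<epsilon>>0. summable (\<lambda>p. \<beta>\<^sup>2 * (b (p + 2))\<^sup>2 * (1 + \<epsilon>) ^ (p + 2))"
    and h: "0 \<le> h"
  shows "\<exists>C>0. \<forall>\<eta>. is_arg_max (dual_functional \<xi> h) (\<lambda>\<zeta>. \<zeta> \<in> Lambda_set \<xi> h) \<eta> \<longrightarrow>
    (\<forall>\<mu>. is_arg_min (CS_functional \<xi> h) (\<lambda>\<nu>. \<nu> \<in> Pr01) \<mu> \<longrightarrow>
        distr_deriv2_eq_neg_measure {0<..<1} (\<lambda>s. 1 / sqrt (distr2 \<eta> s)) \<mu> \<and>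
        measure_support \<mu> \<subseteq> {s \<in> {0..<1}. \<eta> s = \<xi> s}) \<and>
    C2_01 \<eta> \<and>
    (\<exists>g. distr_deriv 1 {0<..<1} (deriv01 (deriv01 \<eta>)) g \<and>
        (\<forall>\<delta>\<in>{0<..<1}. BV_on {0<..<1 - \<delta>} g \<and> L_infty_on {0<..<1 - \<delta>} g)) \<and>
    (\<forall>s\<in>{0..<1}. 1 / (1 - s)\<^sup>2 \<le> deriv01 (deriv01 \<eta>) s \<and>
        deriv01 (deriv01 \<eta>) s \<le> C / (1 - s)\<^sup>2) \<and>
    (\<forall>\<^sub>F s in at_left 1. deriv01 (deriv01 \<eta>) s = 1 / (1 - s)\<^sup>2) \<and>
    (\<forall>s\<in>{0..<1}. \<eta> s = \<xi> s \<longrightarrow>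
        deriv01 \<eta> s = deriv \<xi> s \<and> deriv (deriv \<xi>) s \<le> deriv01 (deriv01 \<eta>) s)"
proof -
  interpret S: CS_setting \<xi> h unfolding xi by (rule mixture_CS_setting[OF fin])
  obtain \<nu> where "CS_minimizer \<xi> h \<nu>" using S.CS_minimizer_exists by blast
  then interpret N: CS_minimizer \<xi> h \<nu> .
  show ?thesis
  \<comment> \<open>As \<open>\<phi> s \<ge> (1 - q0) (1 - s)\<close>, this constant bounds \<open>(1 - s)^2/\<phi>^2\<close>.\<close>
  proof (rule exI[of _ "(1 / (1 - S.q0))\<^sup>2"], intro conjI allI impI)
    show "0 < (1 / (1 - S.q0))\<^sup>2" using S.q0(2) by simp
    fix \<eta> assume max: "is_arg_max (dual_functional \<xi> h) (\<lambda>\<zeta>. \<zeta> \<in> Lambda_set \<xi> h) \<eta>"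
    show "\<exists>g. distr_deriv 1 {0<..<1} (deriv01 (deriv01 \<eta>)) g \<and>
        (\<forall>\<delta>\<in>{0<..<1}. BV_on {0<..<1 - \<delta>} g \<and> L_infty_on {0<..<1 - \<delta>} g)"
      using N.maximizer_regularity(2)[OF max] N.third_BV by blast
    show "\<forall>s\<in>{0..<1}. 1 / (1 - s)\<^sup>2 \<le> deriv01 (deriv01 \<eta>) s \<and>
        deriv01 (deriv01 \<eta>) s \<le> (1 / (1 - S.q0))\<^sup>2 / (1 - s)\<^sup>2"
      using N.curv_lower N.curv_upper N.maximizer_second_derivative(2)[OF max] by auto
    show "\<forall>s\<in>{0..<1}. \<eta> s = \<xi> s \<longrightarrow>
        deriv01 \<eta> s = deriv \<xi> s \<and> deriv (deriv \<xi>) s \<le> deriv01 (deriv01 \<eta>) s"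
      using N.maximizer_consistency[OF max] by blast
    fix \<mu> assume "is_arg_min (CS_functional \<xi> h) (\<lambda>\<nu>. \<nu> \<in> Pr01) \<mu>"
    then interpret M: CS_minimizer \<xi> h \<mu> by (rule S.CS_minimizerI)
    show "distr_deriv2_eq_neg_measure {0<..<1} (\<lambda>s. 1 / sqrt (distr2 \<eta> s)) \<mu>"
      "measure_support \<mu> \<subseteq> {s \<in> {0..<1}. \<eta> s = \<xi> s}"
      using M.maximizer_optimality[OF max] by auto
  qed (use N.maximizer_regularity in auto)
qed

end
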